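(* Let $(\mu,\nu)$ be a pair of Borel probability measures on $\mathbb{R}$ satisfying at least one of the following two hypotheses: 1. $\mu$ and $\nu$ both have finite support; 2. for all $k\in\mathcal{K}^+$ (respectively $k\in\mathcal{K}^-$), the components $(\mu_k^+,\nu_k^+)$ (respectively $(\mu_k^-,\nu_k^-)$) of $(\mu,\nu)$ form a pair of mutually singular measures. Then $\pi_\varepsilon$ converges weakly to $\mathcal{K}(\mu,\nu)$ as $\varepsilon\to0^+$.
   Context: Notation. $\mathcal{M}_+(E)$ and $\mathcal{M}_+^\sigma(E)$ are the finite, resp. $\sigma$-finite, positive Borel measures on $E$. $\gamma|_A$ is the restriction of $\gamma$ to $A$; $F_\gamma^+(t)=\gamma((-\infty,t])$, $F_\gamma^-(t)=\gamma((-\infty,t))$; $\{F_\mu^+>F_\nu^+\}=\{x: F_\mu^+(x)>F_\nu^+(x)\}$, etc.; $\gamma(x)=\gamma(\{x\})$. $\mathrm{Marg}(\mu,\nu)$ is the set of $\pi\in\mathcal{M}_+(\mathbb{R}^2)$ with marginals $\mu,\nu$. $\mathrm F=\{(x,y)\in\mathbb{R}^2:x\le y\}$. Components of the real line. $E^+=\{F_\mu^+>F_\nu^+\}\cap\{F_\mu^->F_\nu^-\}$, $E^-=\{F_\mu^+<F_\nu^+\}\cap\{F_\mu^-<F_\nu^-\}$ (both open), $E^==\mathbb{R}\setminus(E^+\cup E^-)$. Let $(]a_k^+,b_k^+[)_{k\in\mathcal{K}^+}$ and $(]a_k^-,b_k^-[)_{k\in\mathcal{K}^-}$ be the countable families of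 connected components of $E^+$ and $E^-$ (endpoints may be infinite). $B$ is the set of all finite endpoints $a_k^\pm,b_k^\pm$. Components of the marginals (terms at infinite endpoints are zero). For $k\in\mathcal{K}^+$: $\mu_k^+=(F_\mu^+(a_k^+)-F_\nu^+(a_k^+))\delta_{a_k^+}+\mu|_{]a_k^+,b_k^+[}$ and $\nu_k^+=\nu|_{]a_k^+,b_k^+[}+(F_\mu^-(b_k^+)-F_\nu^-(b_k^+))\delta_{b_k^+}$. For $k\in\mathcal{K}^-$: $\mu_k^-=\mu|_{]a_k^-,b_k^-[}+(F_\nu^-(b_k^-)-F_\mu^-(b_k^-))\delta_{b_k^-}$ and $\nu_k^-=(F_\nu^+(a_k^-)-F_\mu^+(a_k^-))\delta_{a_k^-}+\nu|_{]a_k^-,b_k^-[}$. With $\mu^\pm=\sum_{k\in\mathcal{K}^\pm}\mu_k^\pm$: $\mu^==\mu|_{B^c\cap E^=}+\sum_{x\in B}(\mu(x)-\mu^+(x)-\mu^-(x))\delta_x$. Kellerer transport plans. For each $k\in\mathcal{K}^+$ there is exactly one measure in $\mathrm{Marg}(\mu_k^+,\nu_k^+)$ of the form $(\eta_1\otimes\eta_2)|_{\mathrm F}$ with $\eta_1,\eta_2\in\mathcal{M}_+^\sigma(\mathbb{R})$ (theorem of Kellerer); it is denoted $\mathcal{K}_{\mathrm F}(\mu_k^+,\nu_k^+)$. For $k\in\mathcal{K}^-$, likewise $\mathcal{K}_{\mathrm F}(\nu_k^-,\mu_k^-)$ exists and is unique, and $\mathcal{K}_{\tilde{\mathrm F}}(\mu_k^-,\nu_k^-):=i_\#\mathcal{K}_{\mathrm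 F}(\nu_k^-,\mu_k^-)$ with $i(x,y)=(y,x)$. Define $$\mathcal{K}(\mu,\nu)=\sum_{k\in\mathcal{K}^+}\mathcal{K}_{\mathrm F}(\mu_k^+,\nu_k^+)+\sum_{k\in\mathcal{K}^-}\mathcal{K}_{\tilde{\mathrm F}}(\mu_k^-,\nu_k^-)+(\mathrm{id},\mathrm{id})_\#\mu^=.$$ Entropic minimizers. For $\varepsilon>0$, $\pi\in\mathrm{Marg}(\mu,\nu)$ is $\varepsilon$-cyclically invariant if $\pi=f\cdot(\mu\otimes\nu)$ for some $f:\mathbb{R}^2\to[0,+\infty[$ such that for all $n\ge1$ and all $((x_i,y_i))_{1\le i\le n}\in(\mathbb{R}^2)^n$, $\prod_{i=1}^n e^{|y_i-x_i|/\varepsilon}f(x_i,y_i)=\prod_{i=1}^n e^{|y_{i+1}-x_i|/\varepsilon}f(x_i,y_{i+1})$ (with $y_{n+1}=y_1$). There is exactly one such plan (known theorem), denoted $\pi_\varepsilon$. If $J_\varepsilon(\pi)=\int|y-x|\,d\pi+\varepsilon\,\mathrm{Ent}(\pi|\mu\otimes\nu)$ has finite infimum over $\mathrm{Marg}(\mu,\nu)$ (where $\mathrm{Ent}(\pi|\mu\otimes\nu)=\int\log\frac{d\pi}{d(\mu\otimes\nu)}\,d\pi$ if $\pi\ll\mu\otimes\nu$ and $+\infty$ otherwise), then $\pi_\varepsilon$ is its unique minimizer. *)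

theory Defs
  imports "HOL-Probability.Probability"
begin

section \<open>Borel measures\<close>

text \<open>Restriction of a measure to a set, kept as a measure on the whole space
  (unlike \<^const>\<open>restrict_space\<close>).\<close>

definition restr :: "'a measure \<Rightarrow> 'a set \<Rightarrow> 'a measure" where
  "restr M A = density M (indicator A)"

definition plus_measure :: "'a::topological_space measure \<Rightarrow> 'a measure \<Rightarrow> 'a measure" where
  "plus_measure M N = measure_of UNIV (sets borel) (\<lambda>A. emeasure M A + emeasure N A)"

definition sum_measure :: "'i set \<Rightarrow> ('i \<Rightarrow> 'a::topological_space measure) \<Rightarrow> 'a measure" where
  "sum_measure I M =
     measure_of UNIV (sets borel) (\<lambda>A. \<integral>\<^sup>+ i. emeasure (M i) A \<partial>count_space I)"

text \<open>Point mass of weight \<open>c\<close> at \<open>x\<close>; negative weights are truncated to 0, but all weights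
  used below are nonnegative.\<close>

definition atom :: "real \<Rightarrow> real \<Rightarrow> real measure" where
  "atom c x = scale_measure (ennreal c) (return borel x)"

lemma sets_plus_measure [simp, measurable_cong]: "sets (plus_measure M N) = sets borel"
  unfolding plus_measure_def by (metis sets.sets_measure_of_eq space_borel)

lemma sets_sum_measure [simp, measurable_cong]: "sets (sum_measure I M) = sets borel"
  unfolding sum_measure_def by (metis sets.sets_measure_of_eq space_borel)

lemma sets_restr [simp, measurable_cong]: "sets (restr M A) = sets M"
  by (simp add: restr_def)

lemma sets_atom [simp, measurable_cong]: "sets (atom c x) = sets borel"
  by (simp add: atom_def)

lemma emeasure_restr:
  assumes "A \<in> sets M" "X \<in> sets M"
  shows "emeasure (restr M A) X = emeasure M (A \<inter> X)"
  using assms by (simp add: restr_def emeasure_restricted)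

lemma emeasure_plus_measure:
  assumes "sets M = sets borel" "sets N = sets borel" "A \<in> sets borel"
  shows "emeasure (plus_measure M N) A = emeasure M A + emeasure N A"
proof (rule emeasure_measure_of[OF plus_measure_def])
  show "countably_additive (sets (plus_measure M N)) (\<lambda>A. emeasure M A + emeasure N A)"
  proof (rule countably_additiveI)
    fix X :: "nat \<Rightarrow> _"
    assume X: "range X \<subseteq> sets (plus_measure M N)" "disjoint_family X"
    have "(\<Sum>i. emeasure M (X i) + emeasure N (X i)) =
        (\<Sum>i. emeasure M (X i)) + (\<Sum>i. emeasure N (X i))"
      by (rule suminf_add[symmetric]) auto
    also have "\<dots> = emeasure M (\<Union>i. X i) + emeasure N (\<Union>i. X i)"
      using X assms by (simp add: suminf_emeasure)
    finally show "(\<Sum>i. emeasure M (X i) + emeasure N (X i)) =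
        emeasure M (\<Union>i. X i) + emeasure N (\<Union>i. X i)" .
  qed
qed (use assms in \<open>auto simp: positive_def\<close>)

lemma emeasure_sum_measure:
  assumes "\<And>i. i \<in> I \<Longrightarrow> sets (M i) = sets borel" "A \<in> sets borel"
  shows "emeasure (sum_measure I M) A = (\<integral>\<^sup>+ i. emeasure (M i) A \<partial>count_space I)"
proof (rule emeasure_measure_of[OF sum_measure_def])
  show "countably_additive (sets (sum_measure I M))
      (\<lambda>A. \<integral>\<^sup>+ i. emeasure (M i) A \<partial>count_space I)"
  proof (rule countably_additiveI)
    fix X :: "nat \<Rightarrow> _"
    assume X: "range X \<subseteq> sets (sum_measure I M)" "disjoint_family X"
    have "(\<Sum>j. \<integral>\<^sup>+ i. emeasure (M i) (X j) \<partial>count_space I) =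
        (\<integral>\<^sup>+ i. (\<Sum>j. emeasure (M i) (X j)) \<partial>count_space I)"
      by (rule nn_integral_suminf[symmetric]) auto
    also have "\<dots> = (\<integral>\<^sup>+ i. emeasure (M i) (\<Union>j. X j) \<partial>count_space I)"
      using X assms by (intro nn_integral_cong suminf_emeasure) auto
    finally show "(\<Sum>j. \<integral>\<^sup>+ i. emeasure (M i) (X j) \<partial>count_space I) =
        (\<integral>\<^sup>+ i. emeasure (M i) (\<Union>j. X j) \<partial>count_space I)" .
  qed
qed (use assms in \<open>auto simp: positive_def\<close>)

definition msupport :: "'a::topological_space measure \<Rightarrow> 'a set" where
  "msupport M = {x. \<forall>U. open U \<and> x \<in> U \<longrightarrow> emeasure M U > 0}"

definition mutually_singular :: "'a::topological_space measure \<Rightarrow> 'a measure \<Rightarrow> bool" where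
  "mutually_singular M N \<longleftrightarrow> (\<exists>A\<in>sets borel. emeasure M A = 0 \<and> emeasure N (- A) = 0)"

definition weakly_converges ::
    "('b \<Rightarrow> 'a::topological_space measure) \<Rightarrow> 'a measure \<Rightarrow> 'b filter \<Rightarrow> bool" where
  "weakly_converges M N F \<longleftrightarrow>
     (\<forall>f :: 'a \<Rightarrow> real. continuous_on UNIV f \<longrightarrow> bounded (range f) \<longrightarrow>
        ((\<lambda>e. integral\<^sup>L (M e) f) \<longlongrightarrow> integral\<^sup>L N f) F)"

definition Marg :: "real measure \<Rightarrow> real measure \<Rightarrow> (real \<times> real) measure set" where
  "Marg \<mu> \<nu> = {\<pi>. finite_measure \<pi> \<and> sets \<pi> = sets borel \<and>
                  distr \<pi> borel fst = \<mu> \<and> distr \<pi> borel snd = \<nu>}"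

section \<open>Components of the real line and of the marginals\<close>

text \<open>$F^+$ is \<^const>\<open>cdf\<close>; this is $F^-$, its left limit.\<close>

definition cdf_left :: "real measure \<Rightarrow> real \<Rightarrow> real" where
  "cdf_left M x = measure M {..<x}"

definition E_plus :: "real measure \<Rightarrow> real measure \<Rightarrow> real set" where
  "E_plus \<mu> \<nu> = {x. cdf \<mu> x > cdf \<nu> x} \<inter> {x. cdf_left \<mu> x > cdf_left \<nu> x}"

definition E_minus :: "real measure \<Rightarrow> real measure \<Rightarrow> real set" where
  "E_minus \<mu> \<nu> = {x. cdf \<mu> x < cdf \<nu> x} \<inter> {x. cdf_left \<mu> x < cdf_left \<nu> x}"

definition E_eq :: "real measure \<Rightarrow> real measure \<Rightarrow> real set" where
  "E_eq \<mu> \<nu> = - (E_plus \<mu> \<nu> \<union> E_minus \<mu> \<nu>)"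

text \<open>The connected components, i.e. the elements of \<^const>\<open>components\<close>, serve as their own
  indices. As they are nonempty open intervals, the left endpoint of \<open>I\<close> is finite iff
  \<^term>\<open>bdd_below I\<close>, and then it is \<^term>\<open>Inf I\<close>; similarly on the right.\<close>

definition finite_endpoints :: "real measure \<Rightarrow> real measure \<Rightarrow> real set" where
  "finite_endpoints \<mu> \<nu> =
     (let C = components (E_plus \<mu> \<nu>) \<union> components (E_minus \<mu> \<nu>)
      in Inf ` {I \<in> C. bdd_below I} \<union> Sup ` {I \<in> C. bdd_above I})"

definition left_atom :: "real set \<Rightarrow> (real \<Rightarrow> real) \<Rightarrow> real measure" where
  "left_atom I c = (if bdd_below I then atom (c (Inf I)) (Inf I) else null_measure borel)"

definition right_atom :: "real set \<Rightarrow> (real \<Rightarrow> real) \<Rightarrow> real measure" where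
  "right_atom I c = (if bdd_above I then atom (c (Sup I)) (Sup I) else null_measure borel)"

definition mu_plus_comp :: "real measure \<Rightarrow> real measure \<Rightarrow> real set \<Rightarrow> real measure" where
  "mu_plus_comp \<mu> \<nu> I =
     plus_measure (left_atom I (\<lambda>a. cdf \<mu> a - cdf \<nu> a)) (restr \<mu> I)"

definition nu_plus_comp :: "real measure \<Rightarrow> real measure \<Rightarrow> real set \<Rightarrow> real measure" where
  "nu_plus_comp \<mu> \<nu> I =
     plus_measure (restr \<nu> I) (right_atom I (\<lambda>b. cdf_left \<mu> b - cdf_left \<nu> b))"

definition mu_minus_comp :: "real measure \<Rightarrow> real measure \<Rightarrow> real set \<Rightarrow> real measure" where
  "mu_minus_comp \<mu> \<nu> I =
     plus_measure (restr \<mu> I) (right_atom I (\<lambda>b. cdf_left \<nu> b - cdf_left \<mu> b))"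

definition nu_minus_comp :: "real measure \<Rightarrow> real measure \<Rightarrow> real set \<Rightarrow> real measure" where
  "nu_minus_comp \<mu> \<nu> I =
     plus_measure (left_atom I (\<lambda>a. cdf \<nu> a - cdf \<mu> a)) (restr \<nu> I)"

definition mu_plus :: "real measure \<Rightarrow> real measure \<Rightarrow> real measure" where
  "mu_plus \<mu> \<nu> = sum_measure (components (E_plus \<mu> \<nu>)) (mu_plus_comp \<mu> \<nu>)"

definition mu_minus :: "real measure \<Rightarrow> real measure \<Rightarrow> real measure" where
  "mu_minus \<mu> \<nu> = sum_measure (components (E_minus \<mu> \<nu>)) (mu_minus_comp \<mu> \<nu>)"

definition mu_eq :: "real measure \<Rightarrow> real measure \<Rightarrow> real measure" where
  "mu_eq \<mu> \<nu> =
     plus_measure (restr \<mu> (- finite_endpoints \<mu> \<nu> \<inter> E_eq \<mu> \<nu>))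
       (sum_measure (finite_endpoints \<mu> \<nu>)
          (\<lambda>x. atom (measure \<mu> {x} - measure (mu_plus \<mu> \<nu>) {x} - measure (mu_minus \<mu> \<nu>) {x}) x))"

section \<open>Kellerer transport plans\<close>

definition is_kellerer_plan ::
    "real measure \<Rightarrow> real measure \<Rightarrow> (real \<times> real) measure \<Rightarrow> bool" where
  "is_kellerer_plan \<mu> \<nu> \<pi> \<longleftrightarrow>
     \<pi> \<in> Marg \<mu> \<nu> \<and>
     (\<exists>\<eta>1 \<eta>2 :: real measure.
        sigma_finite_measure \<eta>1 \<and> sets \<eta>1 = sets borel \<and>
        sigma_finite_measure \<eta>2 \<and> sets \<eta>2 = sets borel \<and>
        \<pi> = restr (\<eta>1 \<Otimes>\<^sub>M \<eta>2) {(x, y). x \<le> y})"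

text \<open>Existence and uniqueness hold for the components of the marginals (theorem of Kellerer).\<close>

definition kellerer_plan :: "real measure \<Rightarrow> real measure \<Rightarrow> (real \<times> real) measure" where
  "kellerer_plan \<mu> \<nu> = (THE \<pi>. is_kellerer_plan \<mu> \<nu> \<pi>)"

definition kellerer_plan_rev :: "real measure \<Rightarrow> real measure \<Rightarrow> (real \<times> real) measure" where
  "kellerer_plan_rev \<mu> \<nu> = distr (kellerer_plan \<nu> \<mu>) borel (\<lambda>(x, y). (y, x))"

definition kellerer_transport :: "real measure \<Rightarrow> real measure \<Rightarrow> (real \<times> real) measure" where
  "kellerer_transport \<mu> \<nu> =
     plus_measure
       (plus_measure
          (sum_measure (components (E_plus \<mu> \<nu>))
             (\<lambda>I. kellerer_plan (mu_plus_comp \<mu> \<nu> I) (nu_plus_comp \<mu> \<nu> I)))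
          (sum_measure (components (E_minus \<mu> \<nu>))
             (\<lambda>I. kellerer_plan_rev (mu_minus_comp \<mu> \<nu> I) (nu_minus_comp \<mu> \<nu> I))))
       (distr (mu_eq \<mu> \<nu>) borel (\<lambda>x. (x, x)))"

section \<open>Entropic minimizers\<close>

definition eps_cyclically_invariant ::
    "real \<Rightarrow> real measure \<Rightarrow> real measure \<Rightarrow> (real \<times> real) measure \<Rightarrow> bool" where
  "eps_cyclically_invariant \<epsilon> \<mu> \<nu> \<pi> \<longleftrightarrow>
     \<pi> \<in> Marg \<mu> \<nu> \<and>
     (\<exists>f :: real \<times> real \<Rightarrow> real.
        f \<in> borel_measurable borel \<and> (\<forall>z. f z \<ge> 0) \<and>
        \<pi> = density (\<mu> \<Otimes>\<^sub>M \<nu>) (\<lambda>z. ennreal (f z)) \<and>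
        (\<forall>n\<ge>1. \<forall>x y :: nat \<Rightarrow> real.
           (\<Prod>i<n. exp (\<bar>y i - x i\<bar> / \<epsilon>) * f (x i, y i)) =
           (\<Prod>i<n. exp (\<bar>y (Suc i mod n) - x i\<bar> / \<epsilon>) * f (x i, y (Suc i mod n)))))"

text \<open>For $\varepsilon > 0$ and probability measures there is exactly one such plan; it is the
  minimizer of the entropic transport problem with cost $|y - x|$ whenever that problem has a
  finite value.\<close>

definition entropic_plan :: "real \<Rightarrow> real measure \<Rightarrow> real measure \<Rightarrow> (real \<times> real) measure" where
  "entropic_plan \<epsilon> \<mu> \<nu> = (THE \<pi>. eps_cyclically_invariant \<epsilon> \<mu> \<nu> \<pi>)"

end

theory Submission
  imports Defs
begin

text \<open>By compactness it suffices to identify every weak limit \<open>\<pi>\<close> of entropic plans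
  \<open>\<pi>\<^sub>\<epsilon> = a(x) b(y) exp (- \<bar>y - x\<bar> / \<epsilon>) \<mu> \<otimes> \<nu>\<close>. For \<open>A \<subseteq> {..t}\<close> and \<open>B \<subseteq> {t..}\<close> the kernel factors on
  \<open>A \<times> B\<close>, so \<open>\<pi>\<^sub>\<epsilon>\<close>, hence \<open>\<pi>\<close>, is a product there; and the mass that crosses a gap \<open>]s, t[\<close>
  to the right times the mass that crosses it to the left is at most \<open>exp (- 2 (t - s) / \<epsilon>)\<close>, so in the
  limit mass crosses each point in one direction only, in an amount read off from the distribution
  functions. Therefore \<open>\<pi>\<close> splits along the components, according to the position of the midpoint
  \<open>(x + y) / 2\<close>; the marginals of each piece are the prescribed ones, and the local product
  structure makes each piece a Kellerer plan, as soon as its restriction to the diagonal is carried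
  by countably many points. The latter is what either hypothesis provides.

  The existence of \<open>\<pi>\<^sub>\<epsilon>\<close> itself is obtained from Sinkhorn's iteration for the kernels
  \<open>max (exp (- \<bar>y - x\<bar> / \<epsilon>)) (1 / n)\<close> and the same compactness; the existence of the Kellerer plans is a
  by-product of the convergence.\<close>

section \<open>Uniqueness of factored plans\<close>

text \<open>Weak convergence tests continuous functions only, whereas the product identities concern
  arbitrary Borel rectangles. The gap closes because all plans share their marginals: the indicator
  of a set in one coordinate is approximated in L1 of that marginal with an error common to all
  plans, so the masses of rectangles converge as well.

  The obstacle is the diagonal. Quadrants \<open>{..t} \<times> {t..}\<close> with \<open>t\<close>
  in a countable dense set reach every pair with x < y, but only countably many points of the
  diagonal, so diffuse mass there escapes the local product structure. Under mutual singularity a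
  component has no diagonal mass at all; under finite support its diagonal mass sits at finitely
  many points, which are added to the set of \<open>t\<close>.

  The midpoint is used because a pair may start and end at the two endpoints of the component that
  it crosses: neither coordinate lies in the component then, but the midpoint does.

  Uniqueness is one argument used twice: two entropic plans, and likewise two Kellerer plans, have
  product densities with respect to a common reference measure.\<close>

lemma MargD:
  assumes "\<pi> \<in> Marg \<mu> \<nu>"
  shows "finite_measure \<pi>" "sets \<pi> = sets borel" "space \<pi> = UNIV"
    "distr \<pi> borel fst = \<mu>" "distr \<pi> borel snd = \<nu>"
  using assms sets_eq_imp_space_eq[of \<pi> borel] by (auto simp: Marg_def)

lemma Marg_AE_fst_iff:
  assumes "\<pi> \<in> Marg \<mu> \<nu>" and [measurable]: "Measurable.pred borel P"
  shows "(AE z in \<pi>. P (fst z)) \<longleftrightarrow> (AE x in \<mu>. P x)"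
proof -
  note M = MargD[OF assms(1)]
  have [measurable_cong]: "sets \<pi> = sets (borel \<Otimes>\<^sub>M borel)" by (subst borel_prod) (rule M(2))
  show ?thesis
    unfolding M(4)[symmetric] by (subst AE_distr_iff) auto
qed

lemma Marg_AE_snd_iff:
  assumes "\<pi> \<in> Marg \<mu> \<nu>" and [measurable]: "Measurable.pred borel P"
  shows "(AE z in \<pi>. P (snd z)) \<longleftrightarrow> (AE x in \<nu>. P x)"
proof -
  note M = MargD[OF assms(1)]
  have [measurable_cong]: "sets \<pi> = sets (borel \<Otimes>\<^sub>M borel)" by (subst borel_prod) (rule M(2))
  show ?thesis
    unfolding M(5)[symmetric] by (subst AE_distr_iff) auto
qed

lemma Marg_integral_fst:
  fixes f :: "real \<Rightarrow> real"
  assumes "\<pi> \<in> Marg \<mu> \<nu>" and [measurable]: "f \<in> borel_measurable borel"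
  shows "(\<integral>z. f (fst z) \<partial>\<pi>) = integral\<^sup>L \<mu> f"
proof -
  note M = MargD[OF assms(1)]
  have [measurable_cong]: "sets \<pi> = sets (borel \<Otimes>\<^sub>M borel)" by (subst borel_prod) (rule M(2))
  show ?thesis
    unfolding M(4)[symmetric] by (subst integral_distr) auto
qed

lemma Marg_integral_snd:
  fixes f :: "real \<Rightarrow> real"
  assumes "\<pi> \<in> Marg \<mu> \<nu>" and [measurable]: "f \<in> borel_measurable borel"
  shows "(\<integral>z. f (snd z) \<partial>\<pi>) = integral\<^sup>L \<nu> f"
proof -
  note M = MargD[OF assms(1)]
  have [measurable_cong]: "sets \<pi> = sets (borel \<Otimes>\<^sub>M borel)" by (subst borel_prod) (rule M(2))
  show ?thesis
    unfolding M(5)[symmetric] by (subst integral_distr) auto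
qed

text \<open>\<open>arctan\<close> is odd and strictly increasing, so a sum of two arctangents has
  the sign of the sum of their arguments, here \<open>ln (p * q) - ln (p' * q')\<close>.\<close>

lemma arctan_ratio_sign:
  fixes p q p' q' :: real
  assumes "p > 0" "q > 0" "p' > 0" "q' > 0"
  defines "\<theta> \<equiv> arctan (ln p - ln p') + arctan (ln q - ln q')"
  shows "(p * q - p' * q') * \<theta> \<ge> 0" and "(p * q - p' * q') * \<theta> = 0 \<longleftrightarrow> p * q = p' * q'"
proof -
  have \<theta>: "\<theta> = arctan (ln p - ln p') - arctan (ln q' - ln q)"
    using arctan_minus[of "ln q' - ln q"] by (simp add: \<theta>_def)
  have ln: "ln (p * q) = ln p + ln q" "ln (p' * q') = ln p' + ln q'"
    using assms by (auto simp: ln_mult)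
  have pos: "p * q > 0" "p' * q' > 0" using assms by auto
  have gt: "\<theta> > 0 \<longleftrightarrow> p * q > p' * q'"
    using ln_less_cancel_iff[OF pos(2,1)] by (simp add: \<theta> arctan_less_iff ln algebra_simps)
  have lt: "\<theta> < 0 \<longleftrightarrow> p * q < p' * q'"
    using ln_less_cancel_iff[OF pos(1,2)] by (simp add: \<theta> arctan_less_iff ln algebra_simps)
  show "(p * q - p' * q') * \<theta> \<ge> 0"
    using gt lt by (metis diff_gt_0_iff_gt diff_less_0_iff_less less_eq_real_def linorder_cases
        mult_eq_0_iff mult_neg_neg mult_pos_pos)
  show "(p * q - p' * q') * \<theta> = 0 \<longleftrightarrow> p * q = p' * q'"
    using gt lt by (metis mult_eq_0_iff linorder_neqE_linordered_idom less_irrefl right_minus_eq)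
qed

text \<open>Formally \<open>\<integral> ln (d\<pi>/d\<pi>') d(\<pi> - \<pi>') = 0\<close>, because the logarithm of the ratio of the densities
  is a sum \<open>u(x) + v(y)\<close> and the marginals agree. Replacing \<open>u\<close>, \<open>v\<close> by their arctangents
  preserves the sign of the sum and removes all integrability problems.\<close>

lemma factored_density_unique:
  fixes lam :: "(real \<times> real) measure" and p q p' q' :: "real \<Rightarrow> real"
  assumes sets_lam: "sets lam = sets borel"
    and meas [measurable]: "p \<in> borel_measurable borel" "q \<in> borel_measurable borel"
      "p' \<in> borel_measurable borel" "q' \<in> borel_measurable borel"
    and nn: "\<And>x. p x \<ge> 0" "\<And>x. q x \<ge> 0" "\<And>x. p' x \<ge> 0" "\<And>x. q' x \<ge> 0"
    and \<pi>: "\<pi> = density lam (\<lambda>z. ennreal (p (fst z) * q (snd z)))"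
    and \<pi>': "\<pi>' = density lam (\<lambda>z. ennreal (p' (fst z) * q' (snd z)))"
    and M: "\<pi> \<in> Marg \<mu> \<nu>" and M': "\<pi>' \<in> Marg \<mu> \<nu>"
  shows "\<pi> = \<pi>'"
proof -
  have [measurable_cong]: "sets lam = sets (borel \<Otimes>\<^sub>M borel)"
    by (subst borel_prod) (rule sets_lam)
  interpret pi: finite_measure \<pi> using MargD(1)[OF M] .
  interpret pi': finite_measure \<pi>' using MargD(1)[OF M'] .
  have [measurable_cong]: "sets \<pi> = sets (borel \<Otimes>\<^sub>M borel)" "sets \<pi>' = sets (borel \<Otimes>\<^sub>M borel)"
    by (subst borel_prod, simp add: MargD(2)[OF M] MargD(2)[OF M'])+
  define g where "g z = p (fst z) * q (snd z)" for z
  define g' where "g' z = p' (fst z) * q' (snd z)" for z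
  have [measurable]: "g \<in> borel_measurable lam" "g' \<in> borel_measurable lam"
    by (auto simp: g_def[abs_def] g'_def[abs_def])
  define s where "s x = arctan (ln (p x) - ln (p' x))" for x
  define t where "t y = arctan (ln (q y) - ln (q' y))" for y
  have [measurable]: "s \<in> borel_measurable borel" "t \<in> borel_measurable borel"
    by (auto simp: s_def[abs_def] t_def[abs_def])
  define \<theta> where "\<theta> z = s (fst z) + t (snd z)" for z
  have [measurable]: "\<theta> \<in> borel_measurable lam"
    by (auto simp: \<theta>_def[abs_def])
  have arct: "\<bar>arctan x\<bar> \<le> 2" for x :: real
    using arctan_ubound[of x] arctan_lbound[of x] pi_less_4 by (auto simp: abs_if)
  have stb: "\<bar>s x\<bar> \<le> 2" "\<bar>t x\<bar> \<le> 2" for x unfolding s_def t_def by (rule arct)+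
  \<comment> \<open>Positivity of one factor is a condition on one coordinate, so it passes from one
    plan to the other through the common marginal. Hence, off a null set, either both densities
    vanish or all four factors are positive and the logarithms are genuine.\<close>
  have pos: "AE z in lam. (g z = 0 \<and> g' z = 0) \<or> (p (fst z) > 0 \<and> q (snd z) > 0 \<and> p' (fst z) > 0 \<and> q' (snd z) > 0)"
  proof -
    have 0: "AE z in \<pi>. p (fst z) > 0 \<and> q (snd z) > 0"
      unfolding \<pi> using nn by (subst AE_density) (auto simp: zero_less_mult_iff intro!: AE_I2 dest: leD)
    have z': "AE z in \<pi>'. p' (fst z) > 0 \<and> q' (snd z) > 0"
      unfolding \<pi>' using nn by (subst AE_density) (auto simp: zero_less_mult_iff intro!: AE_I2 dest: leD)
    have "AE z in \<pi>'. p (fst z) > 0" "AE z in \<pi>'. q (snd z) > 0"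
      using 0 Marg_AE_fst_iff[OF M, of "\<lambda>x. p x > 0"] Marg_AE_fst_iff[OF M', of "\<lambda>x. p x > 0"]
        Marg_AE_snd_iff[OF M, of "\<lambda>x. q x > 0"] Marg_AE_snd_iff[OF M', of "\<lambda>x. q x > 0"]
      by auto
    with z' have 1: "AE z in \<pi>'. p (fst z) > 0 \<and> q (snd z) > 0 \<and> p' (fst z) > 0 \<and> q' (snd z) > 0"
      by auto
    have "AE z in \<pi>. p' (fst z) > 0" "AE z in \<pi>. q' (snd z) > 0"
      using z' Marg_AE_fst_iff[OF M, of "\<lambda>x. p' x > 0"] Marg_AE_fst_iff[OF M', of "\<lambda>x. p' x > 0"]
        Marg_AE_snd_iff[OF M, of "\<lambda>x. q' x > 0"] Marg_AE_snd_iff[OF M', of "\<lambda>x. q' x > 0"]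
      by auto
    with 0 have 2: "AE z in \<pi>. p (fst z) > 0 \<and> q (snd z) > 0 \<and> p' (fst z) > 0 \<and> q' (snd z) > 0"
      by auto
    have 3: "AE z in lam. 0 < ennreal (g z) \<longrightarrow> p (fst z) > 0 \<and> q (snd z) > 0 \<and> p' (fst z) > 0 \<and> q' (snd z) > 0"
      using 2 unfolding \<pi> by (subst (asm) AE_density) (auto simp: g_def)
    have 4: "AE z in lam. 0 < ennreal (g' z) \<longrightarrow> p (fst z) > 0 \<and> q (snd z) > 0 \<and> p' (fst z) > 0 \<and> q' (snd z) > 0"
      using 1 unfolding \<pi>' by (subst (asm) AE_density) (auto simp: g'_def)
    have gnn: "g z \<ge> 0" "g' z \<ge> 0" for z by (auto simp: g_def g'_def nn)
    show ?thesis
      using 3 4 proof eventually_elim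
      case (elim z)
      then show ?case using gnn[of z] by (auto simp: less_le)
    qed
  qed
  have thb: "norm (\<theta> z) \<le> 4" for z
    using stb(1)[of "fst z"] stb(2)[of "snd z"] by (simp add: \<theta>_def abs_le_iff)
  have [measurable]: "\<theta> \<in> borel_measurable \<pi>" "\<theta> \<in> borel_measurable \<pi>'"
    by (auto simp: \<theta>_def[abs_def])
  have int: "integrable \<pi> \<theta>" "integrable \<pi>' \<theta>"
    using thb by (auto intro!: pi.integrable_const_bound[of _ 4] pi'.integrable_const_bound[of _ 4] AE_I2 simp del: split_paired_All)
  have sint: "integrable \<pi> (\<lambda>z. s (fst z))" "integrable \<pi>' (\<lambda>z. s (fst z))"
    "integrable \<pi> (\<lambda>z. t (snd z))" "integrable \<pi>' (\<lambda>z. t (snd z))"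
    using stb by (auto intro!: pi.integrable_const_bound[of _ 2] pi'.integrable_const_bound[of _ 2] AE_I2)
  have eq: "integral\<^sup>L \<pi> \<theta> = integral\<^sup>L \<pi>' \<theta>"
    unfolding \<theta>_def[abs_def]
    using sint Marg_integral_fst[OF M, of s] Marg_integral_fst[OF M', of s]
      Marg_integral_snd[OF M, of t] Marg_integral_snd[OF M', of t] by simp
  have gnn: "g z \<ge> 0" "g' z \<ge> 0" for z by (auto simp: g_def g'_def nn)
  have i1: "integrable lam (\<lambda>z. g z * \<theta> z)" "integrable lam (\<lambda>z. g' z * \<theta> z)"
    using int gnn integrable_density[of \<theta> lam g] integrable_density[of \<theta> lam g']
    unfolding \<pi> \<pi>' by (auto simp: g_def g'_def)
  have e1: "integral\<^sup>L \<pi> \<theta> = (\<integral>z. g z * \<theta> z \<partial>lam)" "integral\<^sup>L \<pi>' \<theta> = (\<integral>z. g' z * \<theta> z \<partial>lam)"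
    using gnn integral_density[of \<theta> lam g] integral_density[of \<theta> lam g']
    unfolding \<pi> \<pi>' by (auto simp: g_def g'_def)
  have i2: "integrable lam (\<lambda>z. (g z - g' z) * \<theta> z)" and e2: "(\<integral>z. (g z - g' z) * \<theta> z \<partial>lam) = 0"
    using i1 e1 eq by (auto simp: left_diff_distrib)
  have nn2: "AE z in lam. (g z - g' z) * \<theta> z \<ge> 0"
    using pos
  proof eventually_elim
    case (elim z)
    then show ?case
    proof
      assume "p (fst z) > 0 \<and> q (snd z) > 0 \<and> p' (fst z) > 0 \<and> q' (snd z) > 0"
      then show ?thesis unfolding g_def g'_def \<theta>_def s_def t_def by (intro arctan_ratio_sign(1)) auto
    qed simp
  qed
  have "AE z in lam. (g z - g' z) * \<theta> z = 0"
    using e2 integral_nonneg_eq_0_iff_AE[OF i2 nn2] by simp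
  with pos have "AE z in lam. g z = g' z"
  proof eventually_elim
    case (elim z)
    from elim(1) show ?case
    proof
      assume "p (fst z) > 0 \<and> q (snd z) > 0 \<and> p' (fst z) > 0 \<and> q' (snd z) > 0"
      then show ?thesis
        using elim(2) arctan_ratio_sign(2)[of "p (fst z)" "q (snd z)" "p' (fst z)" "q' (snd z)"]
        unfolding g_def g'_def \<theta>_def s_def t_def by blast
    qed simp
  qed
  then show ?thesis
    unfolding \<pi> \<pi>' g_def g'_def by (intro density_cong) auto
qed

section \<open>Cyclic invariance and factored densities\<close>

definition cost_kernel :: "real \<Rightarrow> real \<times> real \<Rightarrow> real" where
  "cost_kernel \<epsilon> z = exp (- \<bar>snd z - fst z\<bar> / \<epsilon>)"

lemma cost_kernel_pos [simp]: "cost_kernel \<epsilon> z > 0" "cost_kernel \<epsilon> z \<ge> 0"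
  by (simp_all add: cost_kernel_def)

lemma measurable_cost_kernel [measurable]:
  "cost_kernel \<epsilon> \<in> borel_measurable (borel \<Otimes>\<^sub>M borel)"
  unfolding cost_kernel_def[abs_def] by measurable

lemma real_distribution_sets_pair:
  assumes "real_distribution \<mu>" "real_distribution \<nu>"
  shows "sets (\<mu> \<Otimes>\<^sub>M \<nu>) = sets (borel \<Otimes>\<^sub>M borel)" "sets (\<mu> \<Otimes>\<^sub>M \<nu>) = sets borel"
proof -
  interpret m: real_distribution \<mu> by fact
  interpret n: real_distribution \<nu> by fact
  show "sets (\<mu> \<Otimes>\<^sub>M \<nu>) = sets (borel \<Otimes>\<^sub>M borel)"
    by (intro sets_pair_measure_cong) auto
  then show "sets (\<mu> \<Otimes>\<^sub>M \<nu>) = sets borel"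
    by (subst (asm) borel_prod)
qed

text \<open>The case \<open>n = 2\<close> of the cyclic identity is a rank-one identity for
  \<open>g\<close>, the density with the kernel divided out:
  \<open>g x0 y0 * g x y = g x0 y * g x y0\<close>. A base point with \<open>g x0 y0 > 0\<close>
  exists because the plan has mass 1, and the sections of \<open>g\<close> through it are the
  factors.\<close>

lemma eps_cyclically_invariant_imp_factored:
  assumes \<mu>: "real_distribution \<mu>" and \<nu>: "real_distribution \<nu>"
    and inv: "eps_cyclically_invariant \<epsilon> \<mu> \<nu> \<pi>"
  shows "\<exists>a b :: real \<Rightarrow> real. a \<in> borel_measurable borel \<and> b \<in> borel_measurable borel \<and>
    (\<forall>x. a x \<ge> 0) \<and> (\<forall>y. b y \<ge> 0) \<and>
    \<pi> = density (\<mu> \<Otimes>\<^sub>M \<nu>) (\<lambda>z. ennreal (a (fst z) * b (snd z) * cost_kernel \<epsilon> z))"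
proof -
  interpret m: real_distribution \<mu> by fact
  interpret n: real_distribution \<nu> by fact
  have M: "\<pi> \<in> Marg \<mu> \<nu>" using inv by (simp add: eps_cyclically_invariant_def)
  obtain f :: "real \<times> real \<Rightarrow> real" where
    f0: "f \<in> borel_measurable borel" and fnn: "\<And>z. f z \<ge> 0" and
    \<pi>: "\<pi> = density (\<mu> \<Otimes>\<^sub>M \<nu>) (\<lambda>z. ennreal (f z))" and
    cyc: "\<And>n x y. n \<ge> 1 \<Longrightarrow>
           (\<Prod>i<n. exp (\<bar>y i - x i\<bar> / \<epsilon>) * f (x i, y i)) =
           (\<Prod>i<n. exp (\<bar>y (Suc i mod n) - x i\<bar> / \<epsilon>) * f (x i, y (Suc i mod n)))"
    using inv unfolding eps_cyclically_invariant_def by blast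
  have [measurable]: "f \<in> borel_measurable (borel \<Otimes>\<^sub>M borel)" using f0 by (subst borel_prod)
  note [measurable_cong] = real_distribution_sets_pair(1)[OF \<mu> \<nu>]
  have "\<exists>z. f z \<noteq> 0"
  proof (rule ccontr)
    assume "\<not> ?thesis"
    then have "f = (\<lambda>_. 0)" by auto
    then have "emeasure \<pi> (space \<pi>) = 0"
      unfolding \<pi> space_density by (subst emeasure_density[OF _ sets.top]) simp_all
    then have "emeasure (distr \<pi> borel fst) (space borel) = 0"
      by (simp add: emeasure_distr \<pi> real_distribution_sets_pair(1)[OF \<mu> \<nu>])
    then show False
      unfolding MargD(4)[OF M] using m.emeasure_space_1 by (simp add: m.space_eq_univ)
  qed
  then obtain x0 y0 where f0: "f (x0, y0) > 0"
    using fnn by (metis less_eq_real_def surj_pair)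
  define g where "g x y = exp (\<bar>y - x\<bar> / \<epsilon>) * f (x, y)" for x y
  have g0: "g x0 y0 > 0" using f0 by (simp add: g_def)
  have gg: "g x0 y0 * g x y = g x0 y * g x y0" for x y
    using cyc[of 2 "\<lambda>i. if i = 0 then y0 else y" "\<lambda>i. if i = 0 then x0 else x"]
    by (simp add: g_def numeral_2_eq_2)
  have fg: "f z = g (fst z) (snd z) * cost_kernel \<epsilon> z" for z
    by (cases z) (simp add: g_def cost_kernel_def mult.assoc exp_minus flip: exp_add)
  have feq: "f z = (g (fst z) y0) * (g x0 (snd z) / g x0 y0) * cost_kernel \<epsilon> z" for z
    using gg[of "fst z" "snd z"] g0 by (simp add: fg[of z] field_simps)
  have [measurable]: "(\<lambda>x. g x y0) \<in> borel_measurable borel" "(\<lambda>y. g x0 y) \<in> borel_measurable borel"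
    unfolding g_def by measurable
  have gnn: "g x y \<ge> 0" for x y by (simp add: g_def fnn)
  have f_eq: "f = (\<lambda>z. (g (fst z) y0) * (g x0 (snd z) / g x0 y0) * cost_kernel \<epsilon> z)"
    by (rule ext) (rule feq)
  have "\<pi> = density (\<mu> \<Otimes>\<^sub>M \<nu>)
      (\<lambda>z. ennreal ((g (fst z) y0) * (g x0 (snd z) / g x0 y0) * cost_kernel \<epsilon> z))"
    unfolding \<pi> by (subst f_eq) (rule refl)
  then show ?thesis
    using gnn by (intro exI[of _ "\<lambda>x. g x y0"] exI[of _ "\<lambda>y. g x0 y / g x0 y0"] conjI) auto
qed

text \<open>The exponential weights cancel the kernel and leave \<open>a (x i) * b (y j)\<close>;
  the cyclic shift of the indices then only permutes the factors \<open>b\<close>.\<close>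

lemma factored_imp_eps_cyclically_invariant:
  assumes \<mu>: "real_distribution \<mu>" and \<nu>: "real_distribution \<nu>"
    and M: "\<pi> \<in> Marg \<mu> \<nu>"
    and [measurable]: "a \<in> borel_measurable borel" "b \<in> borel_measurable borel"
    and nn: "\<And>x. a x \<ge> 0" "\<And>y. b y \<ge> 0"
    and \<pi>: "\<pi> = density (\<mu> \<Otimes>\<^sub>M \<nu>) (\<lambda>z. ennreal (a (fst z) * b (snd z) * cost_kernel \<epsilon> z))"
  shows "eps_cyclically_invariant \<epsilon> \<mu> \<nu> \<pi>"
  unfolding eps_cyclically_invariant_def
proof (intro conjI M exI[of _ "\<lambda>z. a (fst z) * b (snd z) * cost_kernel \<epsilon> z"] allI impI)
  show "(\<lambda>z. a (fst z) * b (snd z) * cost_kernel \<epsilon> z) \<in> borel_measurable borel"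
    unfolding borel_prod[symmetric] by measurable
  show "0 \<le> a (fst z) * b (snd z) * cost_kernel \<epsilon> z" for z
    using nn by simp
  fix n :: nat and x y :: "nat \<Rightarrow> real" assume n: "1 \<le> n"
  have e: "exp (\<bar>y j - x i\<bar> / \<epsilon>) * (a (fst (x i, y j)) * b (snd (x i, y j)) * cost_kernel \<epsilon> (x i, y j))
      = a (x i) * b (y j)" for i j
    by (simp add: cost_kernel_def exp_minus)
  have "bij_betw (\<lambda>i. Suc i mod n) {..<n} {..<n}"
  proof (rule bij_betwI[where g = "\<lambda>i. if i = 0 then n - 1 else i - 1"])
    show "(if Suc x mod n = 0 then n - 1 else Suc x mod n - 1) = x" if "x \<in> {..<n}" for x
      using that n by (cases "Suc x = n") auto
    show "Suc (if y = 0 then n - 1 else y - 1) mod n = y" if "y \<in> {..<n}" for y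
      using that n by auto
  qed (use n in auto)
  then have "(\<Prod>i<n. b (y (Suc i mod n))) = (\<Prod>i<n. b (y i))"
    by (rule prod.reindex_bij_betw)
  then show "(\<Prod>i<n. exp (\<bar>y i - x i\<bar> / \<epsilon>) * (a (fst (x i, y i)) * b (snd (x i, y i)) * cost_kernel \<epsilon> (x i, y i))) =
    (\<Prod>i<n. exp (\<bar>y (Suc i mod n) - x i\<bar> / \<epsilon>) *
       (a (fst (x i, y (Suc i mod n))) * b (snd (x i, y (Suc i mod n))) * cost_kernel \<epsilon> (x i, y (Suc i mod n))))"
    by (simp only: e prod.distrib)
qed (rule \<pi>)

text \<open>Once the kernel is moved into the reference measure, both densities are products of a
  function of x and a function of y.\<close>

lemma eps_cyclically_invariant_unique:
  assumes \<mu>: "real_distribution \<mu>" and \<nu>: "real_distribution \<nu>"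
    and "eps_cyclically_invariant \<epsilon> \<mu> \<nu> \<pi>" "eps_cyclically_invariant \<epsilon> \<mu> \<nu> \<pi>'"
  shows "\<pi> = \<pi>'"
proof -
  note [measurable_cong] = real_distribution_sets_pair(1)[OF \<mu> \<nu>]
  obtain a b where ab [measurable]: "a \<in> borel_measurable borel" "b \<in> borel_measurable borel"
    and ab_nn: "\<And>x. a x \<ge> 0" "\<And>y. b y \<ge> 0"
    and \<pi>: "\<pi> = density (\<mu> \<Otimes>\<^sub>M \<nu>) (\<lambda>z. ennreal (a (fst z) * b (snd z) * cost_kernel \<epsilon> z))"
    using eps_cyclically_invariant_imp_factored[OF \<mu> \<nu> assms(3)] by blast
  obtain a' b' where ab' [measurable]: "a' \<in> borel_measurable borel" "b' \<in> borel_measurable borel"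
    and ab'_nn: "\<And>x. a' x \<ge> 0" "\<And>y. b' y \<ge> 0"
    and \<pi>': "\<pi>' = density (\<mu> \<Otimes>\<^sub>M \<nu>) (\<lambda>z. ennreal (a' (fst z) * b' (snd z) * cost_kernel \<epsilon> z))"
    using eps_cyclically_invariant_imp_factored[OF \<mu> \<nu> assms(4)] by blast
  let ?lam = "density (\<mu> \<Otimes>\<^sub>M \<nu>) (\<lambda>z. ennreal (cost_kernel \<epsilon> z))"
  have 1: "\<pi> = density ?lam (\<lambda>z. ennreal (a (fst z) * b (snd z)))"
    unfolding \<pi> by (subst density_density_eq)
      (auto simp: ab_nn mult.commute simp flip: ennreal_mult intro!: density_cong)
  have 2: "\<pi>' = density ?lam (\<lambda>z. ennreal (a' (fst z) * b' (snd z)))"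
    unfolding \<pi>' by (subst density_density_eq)
      (auto simp: ab'_nn mult.commute simp flip: ennreal_mult intro!: density_cong)
  show ?thesis
    by (rule factored_density_unique[OF _ ab ab' ab_nn ab'_nn 1 2])
      (use assms real_distribution_sets_pair(2)[OF \<mu> \<nu>] in \<open>auto simp: eps_cyclically_invariant_def\<close>)
qed

section \<open>Schoenberg's space-filling curve\<close>

text \<open>The binary digit of weight \<open>(1/2) ^ Suc k\<close>; at dyadic numbers the floors
  select the terminating expansion.\<close>

definition bdigit :: "nat \<Rightarrow> real \<Rightarrow> real" where
  "bdigit k u = real_of_int (\<lfloor>2 ^ Suc k * u\<rfloor> - 2 * \<lfloor>2 ^ k * u\<rfloor>)"

lemma bdigit_01: "bdigit k u = 0 \<or> bdigit k u = 1"
proof -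
  have "2 * \<lfloor>2 ^ k * u\<rfloor> \<le> \<lfloor>2 * (2 ^ k * u)\<rfloor>" "\<lfloor>2 * (2 ^ k * u)\<rfloor> \<le> 2 * \<lfloor>2 ^ k * u\<rfloor> + 1"
    by linarith+
  then have "\<lfloor>2 ^ Suc k * u\<rfloor> - 2 * \<lfloor>2 ^ k * u\<rfloor> = 0 \<or> \<lfloor>2 ^ Suc k * u\<rfloor> - 2 * \<lfloor>2 ^ k * u\<rfloor> = 1"
    by (simp only: power_Suc mult.assoc) linarith
  then show ?thesis unfolding bdigit_def by auto
qed

lemma bdigit_measurable [measurable]: "bdigit k \<in> borel_measurable borel"
  unfolding bdigit_def[abs_def] by measurable

text \<open>The partial sums telescope to \<open>\<lfloor>2 ^ n * u\<rfloor> / 2 ^ n\<close>; the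
  bounds on \<open>u\<close> make the integral part vanish, with which the telescoping
  starts.\<close>

lemma bdigit_sums:
  assumes "0 \<le> u" "u < 1"
  shows "(\<lambda>k. (1/2) ^ Suc k * bdigit k u) sums u"
proof -
  have ps: "(\<Sum>k<n. (1/2) ^ Suc k * bdigit k u) = real_of_int \<lfloor>2 ^ n * u\<rfloor> / 2 ^ n" for n
  proof (induction n)
    case 0
    have "\<lfloor>u\<rfloor> = 0" using assms by (simp add: floor_eq_iff)
    then show ?case by simp
  next
    case (Suc n)
    then show ?case by (simp add: bdigit_def field_simps power_divide)
  qed
  have "(\<lambda>n. real_of_int \<lfloor>2 ^ n * u\<rfloor> / 2 ^ n) \<longlonglongrightarrow> u"
  proof (rule tendsto_sandwich[of "\<lambda>n. u - (1/2)^n" _ _ "\<lambda>n. u"])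
    have "u - (1/2)^n \<le> real_of_int \<lfloor>2 ^ n * u\<rfloor> / 2 ^ n" for n
    proof -
      have "2 ^ n * u - 1 \<le> real_of_int \<lfloor>2 ^ n * u\<rfloor>" by linarith
      then have "(2 ^ n * u - 1) / 2 ^ n \<le> real_of_int \<lfloor>2 ^ n * u\<rfloor> / 2 ^ n"
        by (rule divide_right_mono) simp
      then show ?thesis by (simp add: diff_divide_distrib power_divide)
    qed
    then show "\<forall>\<^sub>F n in sequentially. u - (1/2)^n \<le> real_of_int \<lfloor>2 ^ n * u\<rfloor> / 2 ^ n" by simp
    have "real_of_int \<lfloor>2 ^ n * u\<rfloor> / 2 ^ n \<le> u" for n
      by (simp add: field_simps)
    then show "\<forall>\<^sub>F n in sequentially. real_of_int \<lfloor>2 ^ n * u\<rfloor> / 2 ^ n \<le> u" by simp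
    have "(\<lambda>n. u - (1/2)^n) \<longlonglongrightarrow> u - 0"
      by (intro tendsto_intros LIMSEQ_power_zero) auto
    then show "(\<lambda>n. u - (1/2)^n) \<longlonglongrightarrow> u" by simp
  qed simp
  then show ?thesis unfolding sums_def ps .
qed

text \<open>The point of Cantor's set with ternary digits \<open>2 * d k\<close>.\<close>

definition ternary_code :: "(nat \<Rightarrow> real) \<Rightarrow> real" where
  "ternary_code d = (\<Sum>k. 2 * d k * (1/3) ^ Suc k)"

lemma ternary_code_summable:
  assumes "\<And>k. d k = 0 \<or> d k = (1::real)"
  shows "summable (\<lambda>k. 2 * d k * (1/3) ^ Suc k)"
proof (rule summable_comparison_test'[where N = 0])
  show "summable (\<lambda>k. 2 * (1/3::real) ^ Suc k)"
    by (intro summable_mult) (simp add: summable_mult)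
  show "norm (2 * d n * (1/3) ^ Suc n) \<le> 2 * (1/3::real) ^ Suc n" for n
    using assms[of n] by auto
qed

lemma ternary_code_bounds:
  assumes "\<And>k. d k = 0 \<or> d k = (1::real)"
  shows "0 \<le> ternary_code d" "ternary_code d \<le> 1"
proof -
  have dk: "0 \<le> d k" "d k \<le> 1" for k using assms[of k] by auto
  show "0 \<le> ternary_code d"
    unfolding ternary_code_def using dk by (intro suminf_nonneg ternary_code_summable assms) auto
  have s: "(\<lambda>k. 2/3 * (1/3::real) ^ k) sums (2/3 * (1 / (1 - 1/3)))"
    by (intro sums_mult geometric_sums) auto
  have "ternary_code d \<le> (\<Sum>k. 2/3 * (1/3::real) ^ k)"
    unfolding ternary_code_def
    by (intro suminf_le ternary_code_summable assms sums_summable[OF s]) (use dk in auto)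
  also have "\<dots> = 1" using s by (simp add: sums_iff)
  finally show "ternary_code d \<le> 1" .
qed

lemma ternary_code_step:
  assumes d: "\<And>k. d k = 0 \<or> d k = (1::real)"
  shows "3 * ternary_code d = 2 * d 0 + ternary_code (\<lambda>k. d (Suc k))"
proof -
  have "ternary_code d = 2 * d 0 / 3 + (\<Sum>k. 2 * d (Suc k) * (1/3) ^ Suc (Suc k))"
    unfolding ternary_code_def using suminf_split_head[OF ternary_code_summable[of d, OF d]] by simp
  also have "(\<Sum>k. 2 * d (Suc k) * (1/3) ^ Suc (Suc k)) = 1/3 * ternary_code (\<lambda>k. d (Suc k))"
    unfolding ternary_code_def
    by (subst suminf_mult[symmetric, OF ternary_code_summable[of "\<lambda>k. d (Suc k)", OF d]]) simp
  finally show ?thesis by simp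
qed

text \<open>Multiplication by \<open>3 ^ j\<close> moves \<open>j\<close> ternary digits in front of
  the point. They are 0 or 2, so the integral part is even, that is, a multiple of the period of
  \<open>wave\<close>.\<close>

lemma ternary_code_shift:
  assumes "\<And>k. d k = 0 \<or> d k = (1::real)"
  shows "\<exists>m::int. 3 ^ j * ternary_code d = 2 * of_int m + ternary_code (\<lambda>k. d (k + j))"
proof (induction j)
  case 0
  show ?case by (rule exI[of _ 0]) simp
next
  case (Suc j)
  then obtain m :: int where m: "3 ^ j * ternary_code d = 2 * of_int m + ternary_code (\<lambda>k. d (k + j))"
    by blast
  have *: "3 * ternary_code (\<lambda>k. d (k + j)) = 2 * d j + ternary_code (\<lambda>k. d (k + Suc j))"
    using ternary_code_step[of "\<lambda>k. d (k + j)"] assms by simp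
  have "3 ^ Suc j * ternary_code d = 3 * (3 ^ j * ternary_code d)" by simp
  also have "\<dots> = 2 * of_int (3 * m) + 2 * d j + ternary_code (\<lambda>k. d (k + Suc j))"
    using * unfolding m by simp
  also have "\<dots> = 2 * of_int (3 * m + \<lfloor>d j\<rfloor>) + ternary_code (\<lambda>k. d (k + Suc j))"
    using assms[of j] by auto
  finally show ?case by blast
qed

text \<open>A clipped cosine of period 2 in place of Schoenberg's piecewise linear function: it is 0
  on [0, 1/3] and 1 on [2/3, 1], so it reads off the leading ternary digit of a point of Cantor's
  set.\<close>

definition wave :: "real \<Rightarrow> real" where
  "wave t = max 0 (min 1 (1/2 - cos (pi * t)))"

lemma wave_bounds: "0 \<le> wave t" "wave t \<le> 1"
  by (auto simp: wave_def)

lemma wave_ternary_code: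
  assumes d: "\<And>k. d k = 0 \<or> d k = (1::real)"
  shows "wave (3 ^ j * ternary_code d) = d j"
proof -
  obtain m :: int where m: "3 ^ j * ternary_code d = 2 * of_int m + ternary_code (\<lambda>k. d (k + j))"
    using ternary_code_shift[of d, OF d] by blast
  have r: "ternary_code (\<lambda>k. d (k + j)) = 2 * d j / 3 + ternary_code (\<lambda>k. d (k + Suc j)) / 3"
    using ternary_code_step[of "\<lambda>k. d (k + j)"] d by simp
  define r where "r = ternary_code (\<lambda>k. d (k + j))"
  have b: "0 \<le> ternary_code (\<lambda>k. d (k + Suc j))" "ternary_code (\<lambda>k. d (k + Suc j)) \<le> 1"
    using ternary_code_bounds[of "\<lambda>k. d (k + Suc j)"] d by auto
  have "cos (pi * (3 ^ j * ternary_code d)) = cos (pi * r + 2 * of_int m * pi)"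
    unfolding m r_def by (simp add: algebra_simps)
  also have "\<dots> = cos (pi * r)"
    by (metis add.commute cos_int_2pin cos_add sin_int_2pin mult.commute mult.left_commute mult_1 mult_zero_left diff_zero)
  finally have c: "cos (pi * (3 ^ j * ternary_code d)) = cos (pi * r)" .
  have rb: "0 \<le> r" "r \<le> 1" using ternary_code_bounds[of "\<lambda>k. d (k + j)"] d by (auto simp: r_def)
  show ?thesis
  proof (cases "d j = 0")
    case True
    then have "r \<le> 1/3" using r b by (simp add: r_def)
    then have "cos (pi * r) \<ge> cos (pi / 3)"
      using rb by (intro cos_monotone_0_pi_le) (auto simp: mult_left_le field_simps)
    then show ?thesis using True by (simp add: wave_def c cos_60)
  next
    case False
    then have "d j = 1" using d[of j] by simp
    then have "r \<ge> 2/3" using r b by (simp add: r_def)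
    then have "cos (pi * r) \<le> cos (pi * (2 / 3))"
      using rb by (intro cos_monotone_0_pi_le) (auto simp: field_simps)
    also have "pi * (2/3) = pi - pi/3" by simp
    also have "cos (pi - pi/3) = - (1/2)" by (simp only: cos_pi_minus cos_60)
    finally show ?thesis using \<open>d j = 1\<close> by (simp add: wave_def c)
  qed
qed

text \<open>The coordinates of Schoenberg's curve are \<open>i = 0\<close> and \<open>i = 1\<close>:
  they collect the even and the odd digits of a code as binary digits.\<close>

definition schoenberg :: "nat \<Rightarrow> real \<Rightarrow> real" where
  "schoenberg i t = (\<Sum>k. (1/2) ^ Suc k * wave (3 ^ (2 * k + i) * t))"

lemma schoenberg_continuous: "continuous_on UNIV (schoenberg i)"
proof -
  have "uniform_limit UNIV (\<lambda>n t. \<Sum>k<n. (1/2) ^ Suc k * wave (3 ^ (2 * k + i) * t))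
      (\<lambda>t. \<Sum>k. (1/2) ^ Suc k * wave (3 ^ (2 * k + i) * t)) sequentially"
  proof (rule Weierstrass_m_test[where M = "\<lambda>k. (1/2) ^ Suc k"])
    show "summable (\<lambda>k. (1/2::real) ^ Suc k)"
      by (simp add: summable_mult)
    show "norm ((1/2) ^ Suc k * wave (3 ^ (2 * k + i) * t)) \<le> (1/2) ^ Suc k" for k t
      using wave_bounds[of "3 ^ (2 * k + i) * t"] by (simp add: mult_left_le)
  qed
  then show ?thesis
    unfolding schoenberg_def[abs_def]
    by (rule uniform_limit_theorem[rotated])
      (auto simp: wave_def intro!: always_eventually continuous_intros)
qed

text \<open>Interleaving the binary digits of the two coordinates gives a right inverse of the
  curve. Borel measurability of it is enough, since it only serves to push measures forward.\<close>

definition square_code :: "real \<times> real \<Rightarrow> real" where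
  "square_code z = ternary_code (\<lambda>k. if even k then bdigit (k div 2) (fst z) else bdigit (k div 2) (snd z))"

lemma square_code_measurable [measurable]: "square_code \<in> borel_measurable (borel \<Otimes>\<^sub>M borel)"
  unfolding square_code_def[abs_def] ternary_code_def
  by (intro borel_measurable_suminf borel_measurable_times borel_measurable_const) auto

lemma square_code_bounds: "0 \<le> square_code z" "square_code z \<le> 1"
  unfolding square_code_def by (rule ternary_code_bounds; use bdigit_01 in metis)+

lemma schoenberg_square_code:
  assumes "0 \<le> fst z" "fst z < 1" "0 \<le> snd z" "snd z < 1"
  shows "schoenberg 0 (square_code z) = fst z" "schoenberg 1 (square_code z) = snd z"
proof -
  let ?d = "\<lambda>k. if even k then bdigit (k div 2) (fst z) else bdigit (k div 2) (snd z)"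
  have d: "?d k = 0 \<or> ?d k = 1" for k using bdigit_01 by metis
  have "schoenberg 0 (square_code z) = (\<Sum>k. (1/2) ^ Suc k * bdigit k (fst z))"
    unfolding schoenberg_def square_code_def by (subst wave_ternary_code) (rule d, simp)
  also have "\<dots> = fst z" using bdigit_sums[of "fst z"] assms by (simp add: sums_iff)
  finally show "schoenberg 0 (square_code z) = fst z" .
  have "schoenberg 1 (square_code z) = (\<Sum>k. (1/2) ^ Suc k * bdigit k (snd z))"
    unfolding schoenberg_def square_code_def by (subst wave_ternary_code) (rule d, simp)
  also have "\<dots> = snd z" using bdigit_sums[of "snd z"] assms by (simp add: sums_iff)
  finally show "schoenberg 1 (square_code z) = snd z" .
qed

section \<open>Compactness of the set of plans\<close>

text \<open>Three-epsilon argument: the error \<open>e\<close> has to be uniform in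
  \<open>n\<close>, which is what the fixed marginals provide in both applications.\<close>

lemma tendsto_by_approx:
  fixes a :: "nat \<Rightarrow> real"
  assumes "\<And>e. e > 0 \<Longrightarrow> \<exists>b c. b \<longlonglongrightarrow> c \<and> (\<forall>n. \<bar>a n - b n\<bar> \<le> e) \<and> \<bar>l - c\<bar> \<le> e"
  shows "a \<longlonglongrightarrow> l"
proof (rule LIMSEQ_I)
  fix e :: real assume "e > 0"
  then obtain b c where b: "b \<longlonglongrightarrow> c" and ab: "\<And>n. \<bar>a n - b n\<bar> \<le> e/4" and lc: "\<bar>l - c\<bar> \<le> e/4"
    using assms[of "e/4"] by auto
  obtain N where N: "\<And>n. n \<ge> N \<Longrightarrow> norm (b n - c) < e/4"
    using LIMSEQ_D[OF b, of "e/4"] \<open>e > 0\<close> by auto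
  have "norm (a n - l) < e" if "n \<ge> N" for n
    using ab[of n] lc N[OF that] unfolding real_norm_def by linarith
  then show "\<exists>N. \<forall>n\<ge>N. norm (a n - l) < e" by blast
qed

definition closed_cutoff :: "real set \<Rightarrow> nat \<Rightarrow> real \<Rightarrow> real" where
  "closed_cutoff K n x = max 0 (1 - real n * infdist x K)"

lemma closed_cutoff_continuous: "continuous_on UNIV (closed_cutoff K n)"
  unfolding closed_cutoff_def[abs_def] by (intro continuous_intros)

lemma closed_cutoff_measurable [measurable]: "closed_cutoff K n \<in> borel_measurable borel"
  by (intro borel_measurable_continuous_onI closed_cutoff_continuous)

lemma closed_cutoff_bounds: "0 \<le> closed_cutoff K n x" "closed_cutoff K n x \<le> 1"
  by (auto simp: closed_cutoff_def infdist_nonneg)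

text \<open>Nonemptiness matters: \<open>infdist x {}\<close> is 0, so the cutoff of the empty set
  is constantly 1.\<close>

lemma closed_cutoff_tendsto:
  assumes K: "closed K" "K \<noteq> {}"
  shows "(\<lambda>n. closed_cutoff K n x) \<longlonglongrightarrow> indicator K x"
proof (cases "x \<in> K")
  case True
  then show ?thesis by (simp add: closed_cutoff_def)
next
  case False
  then have d: "infdist x K > 0"
    using K in_closed_iff_infdist_zero[of K x] infdist_nonneg[of x K] by (simp add: less_le)
  obtain N :: nat where N: "1 / infdist x K < real N" using reals_Archimedean2 by blast
  have "closed_cutoff K n x = 0" if "n \<ge> N" for n
  proof -
    have "1 / infdist x K < real n" using N that by linarith
    then show ?thesis using d by (simp add: closed_cutoff_def field_simps)
  qed
  then have "eventually (\<lambda>n. closed_cutoff K n x = 0) sequentially"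
    using eventually_sequentially by blast
  then show ?thesis using False by (simp add: tendsto_eventually)
qed

text \<open>Inner regularity gives a compact \<open>K \<subseteq> A\<close> that misses less than
  \<open>e/2\<close> of the mass, and by dominated convergence some cutoff of \<open>K\<close> is
  \<open>e/2\<close>-close to its indicator. A set of mass at most \<open>e\<close> is approximated
  by 0; otherwise \<open>K\<close> is nonempty, as the cutoffs require.\<close>

lemma L1_approx_indicator:
  assumes M: "finite_measure M" and [measurable_cong]: "sets M = sets borel"
    and A [measurable]: "A \<in> sets (borel :: real measure)" and e: "e > 0"
  shows "\<exists>g. continuous_on UNIV g \<and> (\<forall>x. 0 \<le> g x \<and> g x \<le> 1) \<and> (\<integral>x. \<bar>indicator A x - g x\<bar> \<partial>M) \<le> (e::real)"
proof (cases "measure M A \<le> e")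
  case True
  then show ?thesis
    using sets_eq_imp_space_eq[of M borel] assms(2) by (intro exI[of _ "\<lambda>_. 0"]) auto
next
  case False
  interpret finite_measure M by fact
  have sp: "space M = UNIV" using sets_eq_imp_space_eq[of M borel] assms(2) by auto
  have "ennreal (measure M A - e/2) < emeasure M A"
    using False e by (simp add: emeasure_eq_measure ennreal_less_iff)
  also have "emeasure M A = (SUP K\<in>{K. K \<subseteq> A \<and> compact K}. emeasure M K)"
    by (rule inner_regular) (auto simp: assms emeasure_eq_measure)
  finally obtain K where K: "K \<subseteq> A" "compact K" "ennreal (measure M A - e/2) < emeasure M K"
    by (auto simp: less_SUP_iff)
  have [measurable]: "K \<in> sets borel" using K(2) by (rule borel_compact)
  have mK: "measure M A - e/2 < measure M K"
    using K(3) False e by (simp add: emeasure_eq_measure ennreal_less_iff)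
  then have "K \<noteq> {}" using False e by auto
  have "(\<lambda>n. \<integral>x. \<bar>indicator K x - closed_cutoff K n x\<bar> \<partial>M) \<longlonglongrightarrow> (\<integral>x. 0 \<partial>M)"
  proof (rule integral_dominated_convergence[where w = "\<lambda>_. 1"])
    show "AE x in M. (\<lambda>n. \<bar>indicator K x - closed_cutoff K n x\<bar>) \<longlonglongrightarrow> 0"
    proof (rule AE_I2)
      fix x
      have "(\<lambda>n. \<bar>indicator K x - closed_cutoff K n x\<bar>) \<longlonglongrightarrow> \<bar>indicator K x - indicator K x\<bar>"
        by (intro tendsto_intros closed_cutoff_tendsto compact_imp_closed K \<open>K \<noteq> {}\<close>)
      then show "(\<lambda>n. \<bar>indicator K x - closed_cutoff K n x\<bar>) \<longlonglongrightarrow> 0" by simp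
    qed
    show "AE x in M. norm \<bar>indicator K x - closed_cutoff K n x\<bar> \<le> 1" for n
    proof (rule AE_I2)
      fix x show "norm \<bar>indicator K x - closed_cutoff K n x\<bar> \<le> 1"
        using closed_cutoff_bounds[of K n x] by (auto simp: indicator_def)
    qed
  qed auto
  then have "(\<lambda>n. \<integral>x. \<bar>indicator K x - closed_cutoff K n x\<bar> \<partial>M) \<longlonglongrightarrow> 0" by simp
  from order_tendstoD(2)[OF this, of "e/2"] e
  have "eventually (\<lambda>n. (\<integral>x. \<bar>indicator K x - closed_cutoff K n x\<bar> \<partial>M) < e/2) sequentially"
    by auto
  then obtain n where n: "(\<integral>x. \<bar>indicator K x - closed_cutoff K n x\<bar> \<partial>M) < e/2"
    using eventually_happens'[OF sequentially_bot] by blast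
  let ?g = "closed_cutoff K n"
  have i1: "integrable M (\<lambda>x. \<bar>indicator B x - ?g x\<bar>)" if [measurable]: "B \<in> sets borel" for B
    by (rule integrable_const_bound[of _ 1])
      (use closed_cutoff_bounds[of K n] in \<open>auto simp: indicator_def intro!: AE_I2\<close>)
  have "(\<integral>x. \<bar>indicator A x - ?g x\<bar> \<partial>M) \<le> (\<integral>x. indicator (A - K) x + \<bar>indicator K x - ?g x\<bar> \<partial>M)"
  proof (rule integral_mono)
    show "integrable M (\<lambda>x. indicator (A - K) x + \<bar>indicator K x - ?g x\<bar>)"
      by (intro Bochner_Integration.integrable_add i1) (auto simp: emeasure_eq_measure)
    show "\<bar>indicator A x - ?g x\<bar> \<le> indicator (A - K) x + \<bar>indicator K x - ?g x\<bar>" for x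
      using K(1) by (auto simp: indicator_def)
  qed (intro i1 A)
  also have "\<dots> = measure M (A - K) + (\<integral>x. \<bar>indicator K x - ?g x\<bar> \<partial>M)"
    by (subst Bochner_Integration.integral_add) (auto intro!: i1 simp: emeasure_eq_measure sp)
  also have "measure M (A - K) = measure M A - measure M K"
    using K(1) by (intro finite_measure_Diff) auto
  finally show ?thesis
    using mK n closed_cutoff_bounds[of K n] closed_cutoff_continuous[of K n]
    by (intro exI[of _ ?g]) auto
qed

text \<open>The distribution function at \<open>a\<close> is the limit of the integrals of the
  cutoffs of \<open>{..a}\<close>.\<close>

lemma real_distribution_eqI_continuous:
  assumes M: "real_distribution M" and N: "real_distribution N"
    and eq: "\<And>f :: real \<Rightarrow> real. continuous_on UNIV f \<Longrightarrow> (\<And>x. 0 \<le> f x \<and> f x \<le> 1) \<Longrightarrow> integral\<^sup>L M f = integral\<^sup>L N f"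
  shows "M = N"
proof (rule cdf_unique[OF M N], rule ext)
  fix a :: real
  have lim: "(\<lambda>n. \<integral>x. closed_cutoff {..a} n x \<partial>M') \<longlonglongrightarrow> cdf M' a" if "real_distribution M'" for M'
  proof -
    interpret m: real_distribution M' by fact
    have "(\<lambda>n. \<integral>x. closed_cutoff {..a} n x \<partial>M') \<longlonglongrightarrow> (\<integral>x. indicator {..a} x \<partial>M')"
      by (rule integral_dominated_convergence[where w = "\<lambda>_. 1"])
        (use closed_cutoff_bounds in \<open>auto intro!: closed_cutoff_tendsto\<close>)
    then show ?thesis by (simp add: cdf_def)
  qed
  show "cdf M a = cdf N a"
    by (rule LIMSEQ_unique[OF lim[OF M]])
      (use lim[OF N] eq[OF closed_cutoff_continuous] closed_cutoff_bounds in auto)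
qed

text \<open>Compactness is inherited from Helly's theorem on the line: the plans are pushed to the line
  by a Borel section of a continuous surjection of an interval onto the square (Schoenberg's
  curve), and the limit is mapped back.\<close>

theorem Marg_sequentially_compact:
  fixes \<pi> :: "nat \<Rightarrow> (real \<times> real) measure"
  assumes \<mu>: "real_distribution \<mu>" and \<nu>: "real_distribution \<nu>" and M: "\<And>n. \<pi> n \<in> Marg \<mu> \<nu>"
  shows "\<exists>r \<sigma>. strict_mono r \<and> \<sigma> \<in> Marg \<mu> \<nu> \<and>
    (\<forall>f :: real \<times> real \<Rightarrow> real. continuous_on UNIV f \<longrightarrow> bounded (range f) \<longrightarrow>
        (\<lambda>n. integral\<^sup>L (\<pi> (r n)) f) \<longlonglongrightarrow> integral\<^sup>L \<sigma> f)"
proof -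
  interpret m: real_distribution \<mu> by fact
  interpret n: real_distribution \<nu> by fact
  note MD = MargD[OF M]
  have [measurable_cong]: "sets (\<pi> n) = sets (borel \<Otimes>\<^sub>M borel)" for n
    by (subst borel_prod) (rule MD(2))
  have prob: "prob_space (\<pi> n)" for n
  proof
    have "emeasure (distr (\<pi> n) borel fst) (space borel) = 1"
      unfolding MD(4) using m.emeasure_space_1 by (simp add: m.space_eq_univ)
    then show "emeasure (\<pi> n) (space (\<pi> n)) = 1"
      by (subst (asm) emeasure_distr) (auto simp: MD(3))
  qed
  \<comment> \<open>A homeomorphism of the line onto the open unit interval with inverse
    \<open>\<psi>\<close>; it brings the plans into the unit square.\<close>
  define \<phi> :: "real \<Rightarrow> real" where "\<phi> x = 1/2 + arctan x / pi" for x
  define \<psi> :: "real \<Rightarrow> real" where "\<psi> u = tan (pi * (u - 1/2))" for u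
  have \<phi>b: "0 < \<phi> x" "\<phi> x < 1" for x
    using arctan_lbound[of x] arctan_ubound[of x] by (auto simp: \<phi>_def field_simps)
  have \<psi>\<phi>: "\<psi> (\<phi> x) = x" for x by (simp add: \<psi>_def \<phi>_def tan_arctan)
  have \<phi>\<psi>: "\<phi> (\<psi> u) = u" if "0 < u" "u < 1" for u
  proof -
    have "arctan (tan (pi * (u - 1/2))) = pi * (u - 1/2)"
      using that by (intro arctan_tan) (auto simp: field_simps)
    then show ?thesis by (simp add: \<psi>_def \<phi>_def)
  qed
  have \<phi>c: "continuous_on UNIV \<phi>" unfolding \<phi>_def by (intro continuous_intros) auto
  have [measurable]: "\<phi> \<in> borel_measurable borel" by (intro borel_measurable_continuous_onI \<phi>c)
  have [measurable]: "\<psi> \<in> borel_measurable borel" unfolding \<psi>_def tan_def by measurable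
  define X where "X = schoenberg 0"
  define Y where "Y = schoenberg 1"
  have Xc: "continuous_on UNIV X" "continuous_on UNIV Y"
    by (auto simp: X_def Y_def schoenberg_continuous)
  have [measurable]: "X \<in> borel_measurable borel" "Y \<in> borel_measurable borel"
    by (auto intro!: borel_measurable_continuous_onI Xc)
  define c where "c z = square_code (\<phi> (fst z), \<phi> (snd z))" for z
  have [measurable]: "c \<in> borel_measurable (borel \<Otimes>\<^sub>M borel)" unfolding c_def by measurable
  have Xc_eq: "X (c z) = \<phi> (fst z)" "Y (c z) = \<phi> (snd z)" for z
    unfolding X_def Y_def c_def using schoenberg_square_code[of "(\<phi> (fst z), \<phi> (snd z))"] \<phi>b
    by (auto simp: less_imp_le)
  have cb: "0 \<le> c z" "c z \<le> 1" for z by (auto simp: c_def square_code_bounds)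
  define \<rho> where "\<rho> n = distr (\<pi> n) borel c" for n
  have \<rho>d: "real_distribution (\<rho> n)" for n
    unfolding \<rho>_def by (intro prob_space.real_distribution_distr prob) measurable
  \<comment> \<open>Tightness is free, since all the images live on the unit interval; the left
    bound -1 keeps the point 0 inside the half-open interval.\<close>
  have "tight \<rho>"
    unfolding tight_def
  proof (intro conjI allI impI \<rho>d)
    fix e :: real assume "e > 0"
    have "measure (\<rho> n) {-1<..1} = 1" for n
    proof -
      have "measure (\<rho> n) {-1<..1} = measure (\<pi> n) (c -` {-1<..1} \<inter> space (\<pi> n))"
        unfolding \<rho>_def by (rule measure_distr) auto
      also have "c -` {-1<..1} \<inter> space (\<pi> n) = space (\<pi> n)"
        using cb by (auto simp: less_le_trans[of "-1" 0])
      finally show ?thesis using prob_space.prob_space[OF prob] by simp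
    qed
    then show "\<exists>a b. a < b \<and> (\<forall>n. 1 - e < measure (\<rho> n) {a<..b})"
      using \<open>e > 0\<close> by (intro exI[of _ "-1"] exI[of _ 1]) auto
  qed
  from tight_imp_convergent_subsubsequence[OF this strict_mono_id]
  obtain r R where r: "strict_mono (r :: nat \<Rightarrow> nat)" and R: "real_distribution R"
    and conv: "weak_conv_m (\<rho> \<circ> id \<circ> r) R" by blast
  interpret R: real_distribution R by fact
  have lim: "(\<lambda>n. \<integral>z. g (c z) \<partial>\<pi> (r n)) \<longlonglongrightarrow> integral\<^sup>L R g"
    if g: "continuous_on UNIV g" "\<And>t. \<bar>g t\<bar> \<le> B" for g :: "real \<Rightarrow> real" and B
  proof -
    have "(\<lambda>n. integral\<^sup>L ((\<rho> \<circ> id \<circ> r) n) g) \<longlonglongrightarrow> integral\<^sup>L R g"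
      by (rule weak_conv_imp_integral_bdd_continuous_conv[of _ _ g B])
        (use g \<rho>d R conv in \<open>auto simp: continuous_on_eq_continuous_at comp_def\<close>)
    moreover have "integral\<^sup>L (\<rho> n) g = (\<integral>z. g (c z) \<partial>\<pi> n)" for n
      unfolding \<rho>_def using g by (intro integral_distr) (auto intro: borel_measurable_continuous_onI)
    ultimately show ?thesis by simp
  qed
  \<comment> \<open>The marginal is visible along the curve through a continuous function:
    \<open>X (c z) = \<phi> (fst z)\<close>. So the integrals of \<open>f (X t)\<close> are constant
    along the sequence, and their limit identifies the image of \<open>R\<close>.\<close>
  have dX: "distr R borel X = distr \<mu> borel \<phi>"
  proof (rule real_distribution_eqI_continuous)
    fix f :: "real \<Rightarrow> real" assume f: "continuous_on UNIV f" "\<And>x. 0 \<le> f x \<and> f x \<le> 1"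
    then have [measurable]: "f \<in> borel_measurable borel" by (intro borel_measurable_continuous_onI)
    have "(\<lambda>n. \<integral>z. f (X (c z)) \<partial>\<pi> (r n)) \<longlonglongrightarrow> (\<integral>t. f (X t) \<partial>R)"
      by (rule lim[of _ 1]) (use f in \<open>auto intro!: continuous_on_compose2[OF f(1) Xc(1)]\<close>)
    moreover have "(\<integral>z. f (X (c z)) \<partial>\<pi> k) = (\<integral>x. f (\<phi> x) \<partial>\<mu>)" for k
      unfolding Xc_eq by (rule Marg_integral_fst[OF M]) measurable
    ultimately have "(\<integral>t. f (X t) \<partial>R) = (\<integral>x. f (\<phi> x) \<partial>\<mu>)"
      by (simp add: LIMSEQ_const_iff)
    then show "integral\<^sup>L (distr R borel X) f = integral\<^sup>L (distr \<mu> borel \<phi>) f"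
      by (simp add: integral_distr)
  qed (auto intro!: R.real_distribution_distr m.real_distribution_distr)
  have dY: "distr R borel Y = distr \<nu> borel \<phi>"
  proof (rule real_distribution_eqI_continuous)
    fix f :: "real \<Rightarrow> real" assume f: "continuous_on UNIV f" "\<And>x. 0 \<le> f x \<and> f x \<le> 1"
    then have [measurable]: "f \<in> borel_measurable borel" by (intro borel_measurable_continuous_onI)
    have "(\<lambda>n. \<integral>z. f (Y (c z)) \<partial>\<pi> (r n)) \<longlonglongrightarrow> (\<integral>t. f (Y t) \<partial>R)"
      by (rule lim[of _ 1]) (use f in \<open>auto intro!: continuous_on_compose2[OF f(1) Xc(2)]\<close>)
    moreover have "(\<integral>z. f (Y (c z)) \<partial>\<pi> k) = (\<integral>x. f (\<phi> x) \<partial>\<nu>)" for k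
      unfolding Xc_eq by (rule Marg_integral_snd[OF M]) measurable
    ultimately have "(\<integral>t. f (Y t) \<partial>R) = (\<integral>x. f (\<phi> x) \<partial>\<nu>)"
      by (simp add: LIMSEQ_const_iff)
    then show "integral\<^sup>L (distr R borel Y) f = integral\<^sup>L (distr \<nu> borel \<phi>) f"
      by (simp add: integral_distr)
  qed (auto intro!: R.real_distribution_distr n.real_distribution_distr)
  define \<sigma> where "\<sigma> = distr R (borel \<Otimes>\<^sub>M borel) (\<lambda>t. (\<psi> (X t), \<psi> (Y t)))"
  have s1: "distr \<sigma> borel fst = \<mu>"
  proof -
    have "distr \<sigma> borel fst = distr (distr R borel X) borel \<psi>"
      unfolding \<sigma>_def by (subst (1 2) distr_distr) (auto simp: comp_def)
    also have "\<dots> = \<mu>"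
      unfolding dX by (subst distr_distr) (auto simp: comp_def \<psi>\<phi> intro!: distr_id2)
    finally show ?thesis .
  qed
  have s2: "distr \<sigma> borel snd = \<nu>"
  proof -
    have "distr \<sigma> borel snd = distr (distr R borel Y) borel \<psi>"
      unfolding \<sigma>_def by (subst (1 2) distr_distr) (auto simp: comp_def)
    also have "\<dots> = \<nu>"
      unfolding dY by (subst distr_distr) (auto simp: comp_def \<psi>\<phi> intro!: distr_id2)
    finally show ?thesis .
  qed
  have ps: "prob_space \<sigma>" unfolding \<sigma>_def by (intro R.prob_space_distr) measurable
  have \<sigma>: "\<sigma> \<in> Marg \<mu> \<nu>"
    unfolding Marg_def using s1 s2 prob_space.finite_measure[OF ps]
    by (auto simp: \<sigma>_def borel_prod)
  have [measurable_cong]: "sets \<sigma> = sets (borel \<Otimes>\<^sub>M borel)" by (simp add: \<sigma>_def)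
  \<comment> \<open>A weak limit might charge the boundary of the square, where
    \<open>\<psi>\<close> does not invert \<open>\<phi>\<close>; the marginals exclude this.\<close>
  have X01: "AE t in R. 0 < X t \<and> X t < 1"
  proof -
    have "AE x in distr \<mu> borel \<phi>. 0 < x \<and> x < 1"
      by (subst AE_distr_iff) (auto simp: \<phi>b)
    then show ?thesis unfolding dX[symmetric] by (subst (asm) AE_distr_iff) auto
  qed
  have Y01: "AE t in R. 0 < Y t \<and> Y t < 1"
  proof -
    have "AE x in distr \<nu> borel \<phi>. 0 < x \<and> x < 1"
      by (subst AE_distr_iff) (auto simp: \<phi>b)
    then show ?thesis unfolding dY[symmetric] by (subst (asm) AE_distr_iff) auto
  qed
  have "(\<lambda>n. integral\<^sup>L (\<pi> (r n)) f) \<longlonglongrightarrow> integral\<^sup>L \<sigma> f"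
    if f: "continuous_on UNIV f" and fb: "bounded (range f)" for f :: "real \<times> real \<Rightarrow> real"
  proof (rule tendsto_by_approx)
    fix e :: real assume e: "e > 0"
    obtain C where C: "C > 0" "\<And>z. \<bar>f z\<bar> \<le> C"
      using fb unfolding bounded_pos by auto
    have [measurable]: "f \<in> borel_measurable (borel \<Otimes>\<^sub>M borel)"
      unfolding borel_prod using f by (intro borel_measurable_continuous_onI)
    have tail: "\<exists>k. \<forall>j\<ge>k. measure M' {x. real j < \<bar>x\<bar>} < d" if M': "real_distribution M'" and d: "d > 0" for M' :: "real measure" and d
    proof -
      interpret m': real_distribution M' by fact
      have "(\<lambda>j. measure M' {x. real j < \<bar>x\<bar>}) \<longlonglongrightarrow> measure M' (\<Inter>j. {x. real j < \<bar>x\<bar>})"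
        by (rule m'.finite_Lim_measure_decseq) (auto simp: decseq_def)
      also have "(\<Inter>j. {x::real. real j < \<bar>x\<bar>}) = {}"
        by (auto simp: not_less) (meson less_le_not_le real_nat_ceiling_ge nle_le)
      finally have "(\<lambda>j. measure M' {x. real j < \<bar>x\<bar>}) \<longlonglongrightarrow> 0" by simp
      from order_tendstoD(2)[OF this d] show ?thesis by (simp add: eventually_sequentially)
    qed
    \<comment> \<open>The truncated test function differs from \<open>f\<close> by at most
      \<open>2 * C\<close>, so two tails of mass \<open>e / (4 * C)\<close> contribute at most
      \<open>e\<close>.\<close>
    obtain k1 where k1: "\<And>j. j \<ge> k1 \<Longrightarrow> measure \<mu> {x. real j < \<bar>x\<bar>} < e / (4 * C)"
      using tail[OF \<mu>, of "e / (4 * C)"] C e by auto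
    obtain k2 where k2: "\<And>j. j \<ge> k2 \<Longrightarrow> measure \<nu> {x. real j < \<bar>x\<bar>} < e / (4 * C)"
      using tail[OF \<nu>, of "e / (4 * C)"] C e by auto
    define k where "k = max k1 k2"
    define \<alpha> where "\<alpha> = arctan (real k)"
    have \<alpha>: "0 \<le> \<alpha>" "\<alpha> < pi/2" using arctan_ubound[of "real k"] by (auto simp: \<alpha>_def)
    \<comment> \<open>\<open>\<psi>\<close> truncated to values between \<open>- k\<close> and
      \<open>k\<close>. Unlike \<open>\<psi>\<close> it is continuous on the whole line, so
      \<open>f (K (X t), K (Y t))\<close> is an admissible test function for Helly's limit, and the
      truncation error is bounded by the tails of the marginals.\<close>
    define K where "K u = tan (max (-\<alpha>) (min \<alpha> (pi * (u - 1/2))))" for u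
    have Kc: "continuous_on UNIV K"
      unfolding K_def
    proof (intro continuous_intros ballI)
      fix u :: real
      have "cos (max (-\<alpha>) (min \<alpha> (pi * (u - 1/2)))) > 0"
        using \<alpha> by (intro cos_gt_zero_pi) auto
      then show "cos (max (-\<alpha>) (min \<alpha> (pi * (u - 1/2)))) \<noteq> 0" by simp
    qed
    then have [measurable]: "K \<in> borel_measurable borel" by (intro borel_measurable_continuous_onI)
    have K\<phi>: "K (\<phi> x) = x" if "\<bar>x\<bar> \<le> real k" for x
    proof -
      have "arctan x \<le> \<alpha>" "- \<alpha> \<le> arctan x"
        using that arctan_le_iff[of x "real k"] arctan_le_iff[of "- real k" x]
        by (auto simp: \<alpha>_def arctan_minus)
      then show ?thesis by (simp add: K_def \<phi>_def tan_arctan)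
    qed
    define D where "D z = f (K (\<phi> (fst z)), K (\<phi> (snd z)))" for z
    have [measurable]: "D \<in> borel_measurable (borel \<Otimes>\<^sub>M borel)" unfolding D_def by measurable
    have close: "\<bar>integral\<^sup>L S f - integral\<^sup>L S D\<bar> \<le> e" if S: "S \<in> Marg \<mu> \<nu>" for S
    proof -
      interpret S: finite_measure S using MargD(1)[OF S] .
      have [measurable_cong]: "sets S = sets (borel \<Otimes>\<^sub>M borel)"
        by (subst borel_prod) (rule MargD(2)[OF S])
      have i: "integrable S f" "integrable S D"
        using C by (auto intro!: S.integrable_const_bound[of _ C] AE_I2 simp: D_def)
      let ?A = "{x. real k < \<bar>x\<bar>}"
      have iA: "integrable S (\<lambda>z. indicator ?A (fst z) :: real)" "integrable S (\<lambda>z. indicator ?A (snd z) :: real)"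
        by (auto intro!: S.integrable_const_bound[of _ 1] AE_I2 simp: indicator_def)
      have "\<bar>integral\<^sup>L S f - integral\<^sup>L S D\<bar> = \<bar>\<integral>z. f z - D z \<partial>S\<bar>"
        using i by simp
      also have "\<dots> \<le> (\<integral>z. \<bar>f z - D z\<bar> \<partial>S)"
        by (rule integral_abs_bound)
      also have "\<dots> \<le> (\<integral>z. 2 * C * (indicator ?A (fst z) + indicator ?A (snd z)) \<partial>S)"
      proof (rule integral_mono)
        show "integrable S (\<lambda>z. \<bar>f z - D z\<bar>)" using i by auto
        show "integrable S (\<lambda>z. 2 * C * (indicator ?A (fst z) + indicator ?A (snd z)))"
          using iA by auto
        fix z
        have "\<bar>f z - D z\<bar> \<le> 2 * C"
          using C(2)[of z] C(2)[of "(K (\<phi> (fst z)), K (\<phi> (snd z)))"] unfolding D_def by linarith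
        moreover have "f z = D z" if "fst z \<notin> ?A" "snd z \<notin> ?A"
          using that by (simp add: D_def K\<phi>)
        ultimately show "\<bar>f z - D z\<bar> \<le> 2 * C * (indicator ?A (fst z) + indicator ?A (snd z))"
          using C(1) by (auto simp: indicator_def)
      qed
      also have "\<dots> = 2 * C * (measure \<mu> ?A + measure \<nu> ?A)"
        using iA Marg_integral_fst[OF S, of "indicator ?A"] Marg_integral_snd[OF S, of "indicator ?A"]
        by simp
      also have "\<dots> \<le> 2 * C * (e / (4 * C) + e / (4 * C))"
        using k1[of k] k2[of k] C by (intro mult_left_mono add_mono) (auto simp: k_def)
      also have "\<dots> = e" using C by (simp add: field_simps)
      finally show ?thesis .
    qed
    have "(\<lambda>n. \<integral>z. f (K (X (c z)), K (Y (c z))) \<partial>\<pi> (r n)) \<longlonglongrightarrow> (\<integral>t. f (K (X t), K (Y t)) \<partial>R)"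
      by (rule lim[of _ C]) (auto simp: C intro!: continuous_on_compose2[OF f] continuous_on_Pair
          continuous_on_compose2[OF Kc] Xc)
    moreover have "(\<integral>t. f (K (X t), K (Y t)) \<partial>R) = integral\<^sup>L \<sigma> D"
      unfolding \<sigma>_def
    proof (subst integral_distr)
      show "(\<integral>t. f (K (X t), K (Y t)) \<partial>R) = (\<integral>t. D (\<psi> (X t), \<psi> (Y t)) \<partial>R)"
        using X01 Y01 by (intro integral_cong_AE) (auto simp: D_def \<phi>\<psi>)
    qed auto
    ultimately have "(\<lambda>n. integral\<^sup>L (\<pi> (r n)) D) \<longlonglongrightarrow> integral\<^sup>L \<sigma> D"
      by (simp add: Xc_eq D_def[abs_def])
    then show "\<exists>b c. b \<longlonglongrightarrow> c \<and> (\<forall>n. \<bar>integral\<^sup>L (\<pi> (r n)) f - b n\<bar> \<le> e) \<and> \<bar>integral\<^sup>L \<sigma> f - c\<bar> \<le> e"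
      using close[OF M] close[OF \<sigma>] by blast
  qed
  with r \<sigma> show ?thesis by blast
qed

text \<open>Replacing the indicators by continuous functions costs an integral against each
  marginal, hence the same amount for every plan. The factor \<open>f\<close> is carried along for
  the weights that occur in the existence proof.\<close>

lemma Marg_weak_conv_imp_rectangle_conv:
  fixes \<pi> :: "nat \<Rightarrow> (real \<times> real) measure" and f :: "real \<times> real \<Rightarrow> real"
  assumes M: "\<And>n. \<pi> n \<in> Marg \<mu> \<nu>" and \<sigma>: "\<sigma> \<in> Marg \<mu> \<nu>"
    and \<mu>: "real_distribution \<mu>" and \<nu>: "real_distribution \<nu>"
    and conv: "\<And>f :: real \<times> real \<Rightarrow> real. continuous_on UNIV f \<Longrightarrow> bounded (range f) \<Longrightarrow>
        (\<lambda>n. integral\<^sup>L (\<pi> n) f) \<longlonglongrightarrow> integral\<^sup>L \<sigma> f"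
    and f: "continuous_on UNIV f" "bounded (range f)"
    and A [measurable]: "A \<in> sets borel" and B [measurable]: "B \<in> sets borel"
  shows "(\<lambda>n. \<integral>z. indicator A (fst z) * indicator B (snd z) * f z \<partial>\<pi> n) \<longlonglongrightarrow>
         (\<integral>z. indicator A (fst z) * indicator B (snd z) * f z \<partial>\<sigma>)"
proof (rule tendsto_by_approx)
  fix e :: real assume e: "e > 0"
  interpret m: real_distribution \<mu> by fact
  interpret n: real_distribution \<nu> by fact
  obtain C where C: "C > 0" "\<And>z. \<bar>f z\<bar> \<le> C"
    using f(2) unfolding bounded_pos by auto
  have [measurable]: "f \<in> borel_measurable (borel \<Otimes>\<^sub>M borel)"
    unfolding borel_prod using f by (intro borel_measurable_continuous_onI)
  obtain g where g: "continuous_on UNIV g" "\<And>x. 0 \<le> g x \<and> g x \<le> 1"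
    "(\<integral>x. \<bar>indicator A x - g x\<bar> \<partial>\<mu>) \<le> e / (2 * C)"
    using L1_approx_indicator[OF m.finite_measure_axioms m.events_eq_borel A, of "e / (2 * C)"] C e by auto
  obtain h where h: "continuous_on UNIV h" "\<And>x. 0 \<le> h x \<and> h x \<le> 1"
    "(\<integral>x. \<bar>indicator B x - h x\<bar> \<partial>\<nu>) \<le> e / (2 * C)"
    using L1_approx_indicator[OF n.finite_measure_axioms n.events_eq_borel B, of "e / (2 * C)"] C e by auto
  have [measurable]: "g \<in> borel_measurable borel" "h \<in> borel_measurable borel"
    using g h by (auto intro: borel_measurable_continuous_onI)
  have ghb: "\<bar>g (fst z) * h (snd z) * f z\<bar> \<le> C" for z
  proof -
    have "\<bar>g (fst z) * h (snd z) * f z\<bar> \<le> 1 * 1 * C"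
      unfolding abs_mult using g(2) h(2) C by (intro mult_mono) auto
    then show ?thesis by simp
  qed
  have close: "\<bar>(\<integral>z. indicator A (fst z) * indicator B (snd z) * f z \<partial>S) - (\<integral>z. g (fst z) * h (snd z) * f z \<partial>S)\<bar> \<le> e"
    if S: "S \<in> Marg \<mu> \<nu>" for S
  proof -
    interpret S: finite_measure S using MargD(1)[OF S] .
    have [measurable_cong]: "sets S = sets (borel \<Otimes>\<^sub>M borel)"
      by (subst borel_prod) (rule MargD(2)[OF S])
    let ?F = "\<lambda>z. indicator A (fst z) * indicator B (snd z) * f z" and ?G = "\<lambda>z. g (fst z) * h (snd z) * f z"
    let ?a = "\<lambda>x. \<bar>indicator A x - g x\<bar>" and ?b = "\<lambda>y. \<bar>indicator B y - h y\<bar>"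
    have ab: "?a x \<le> 1" "?b x \<le> 1" for x
      using g(2)[of x] h(2)[of x] by (auto simp: indicator_def)
    have i: "integrable S ?F" "integrable S ?G"
      using ghb C by (auto intro!: S.integrable_const_bound[of _ C] AE_I2 simp: indicator_def less_imp_le)
    have iA: "integrable S (\<lambda>z. ?a (fst z))" "integrable S (\<lambda>z. ?b (snd z))"
      using ab by (auto intro!: S.integrable_const_bound[of _ 1] AE_I2)
    have "\<bar>integral\<^sup>L S ?F - integral\<^sup>L S ?G\<bar> = \<bar>\<integral>z. ?F z - ?G z \<partial>S\<bar>"
      using i by simp
    also have "\<dots> \<le> (\<integral>z. \<bar>?F z - ?G z\<bar> \<partial>S)"
      by (rule integral_abs_bound)
    also have "\<dots> \<le> (\<integral>z. C * (?a (fst z) + ?b (snd z)) \<partial>S)"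
    proof (rule integral_mono)
      show "integrable S (\<lambda>z. \<bar>?F z - ?G z\<bar>)" using i by auto
      show "integrable S (\<lambda>z. C * (?a (fst z) + ?b (snd z)))" using iA by auto
      fix z :: "real \<times> real"
      have "?F z - ?G z = ((indicator A (fst z) - g (fst z)) * indicator B (snd z)
          + g (fst z) * (indicator B (snd z) - h (snd z))) * f z"
        by (simp add: algebra_simps)
      also have "\<bar>\<dots>\<bar> \<le> (?a (fst z) + ?b (snd z)) * C"
        unfolding abs_mult
      proof (intro mult_mono C order_trans[OF abs_triangle_ineq] add_mono)
        show "\<bar>(indicator A (fst z) - g (fst z)) * indicator B (snd z)\<bar> \<le> ?a (fst z)"
          by (simp add: indicator_def)
        show "\<bar>g (fst z) * (indicator B (snd z) - h (snd z))\<bar> \<le> ?b (snd z)"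
          using g(2)[of "fst z"] by (simp add: abs_mult mult_left_le_one_le)
      qed auto
      finally show "\<bar>?F z - ?G z\<bar> \<le> C * (?a (fst z) + ?b (snd z))" by (simp add: mult.commute)
    qed
    also have "\<dots> = C * ((\<integral>x. ?a x \<partial>\<mu>) + (\<integral>y. ?b y \<partial>\<nu>))"
      using iA Marg_integral_fst[OF S, of ?a] Marg_integral_snd[OF S, of ?b] by simp
    also have "\<dots> \<le> C * (e / (2 * C) + e / (2 * C))"
      using g h C by (intro mult_left_mono add_mono) auto
    also have "\<dots> = e" using C by (simp add: field_simps)
    finally show ?thesis .
  qed
  have "(\<lambda>n. \<integral>z. g (fst z) * h (snd z) * f z \<partial>\<pi> n) \<longlonglongrightarrow> (\<integral>z. g (fst z) * h (snd z) * f z \<partial>\<sigma>)"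
  proof (rule conv)
    show "continuous_on UNIV (\<lambda>z. g (fst z) * h (snd z) * f z)"
      by (intro continuous_intros f continuous_on_compose2[OF g(1)] continuous_on_compose2[OF h(1)]) auto
    show "bounded (range (\<lambda>z. g (fst z) * h (snd z) * f z))"
      unfolding bounded_iff using ghb by (intro exI[of _ C]) auto
  qed
  then show "\<exists>b c. b \<longlonglongrightarrow> c \<and>
      (\<forall>n. \<bar>(\<integral>z. indicator A (fst z) * indicator B (snd z) * f z \<partial>\<pi> n) - b n\<bar> \<le> e) \<and>
      \<bar>(\<integral>z. indicator A (fst z) * indicator B (snd z) * f z \<partial>\<sigma>) - c\<bar> \<le> e"
    using close[OF M] close[OF \<sigma>] by blast
qed

section \<open>Sinkhorn iteration for kernels bounded below\<close>

definition pos_bounded :: "(real \<Rightarrow> real) \<Rightarrow> bool" where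
  "pos_bounded f \<longleftrightarrow> f \<in> borel_measurable borel \<and> (\<exists>c C. 0 < c \<and> (\<forall>x. c \<le> f x \<and> f x \<le> C))"

lemma pos_boundedI:
  "f \<in> borel_measurable borel \<Longrightarrow> 0 < c \<Longrightarrow> (\<And>x. c \<le> f x) \<Longrightarrow> (\<And>x. f x \<le> C) \<Longrightarrow> pos_bounded f"
  unfolding pos_bounded_def by blast

lemma pos_boundedD:
  assumes "pos_bounded f"
  shows "f \<in> borel_measurable borel" "0 < f x"
  using assms unfolding pos_bounded_def by (auto intro: less_le_trans)

text \<open>That is, \<open>f / g\<close> varies by a factor of at most \<open>R\<close>: a multiplicative form of Hilbert's projective
  metric, in which the contraction property of the Sinkhorn step \<open>sink\<close> is elementary.\<close>

definition ratio_osc :: "(real \<Rightarrow> real) \<Rightarrow> (real \<Rightarrow> real) \<Rightarrow> real \<Rightarrow> bool" where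
  "ratio_osc f g R \<longleftrightarrow> (\<forall>y y'. f y * g y' \<le> R * f y' * g y)"

text \<open>The lower bound \<delta> gives a contraction factor that does not depend on the
  functions involved. \<open>cost_kernel\<close> has no such bound on the plane, which is the reason
  for its truncation.\<close>

locale bounded_kernel = real_distribution \<nu> for \<nu> :: "real measure" +
  fixes k :: "real \<Rightarrow> real \<Rightarrow> real" and \<delta> :: real
  assumes k_meas [measurable]: "case_prod k \<in> borel_measurable (borel \<Otimes>\<^sub>M borel)"
    and \<delta>: "0 < \<delta>" and k_bounds: "\<And>x y. \<delta> \<le> k x y" "\<And>x y. k x y \<le> 1"
begin

definition kint :: "(real \<Rightarrow> real) \<Rightarrow> real \<Rightarrow> real" where
  "kint f x = (\<integral>y. k x y * f y \<partial>\<nu>)"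

text \<open>Half a step of the iteration: with \<open>a = sink f\<close>, the density
  \<open>a x * k x y * f y\<close> satisfies one of the two marginal conditions.\<close>

definition sink :: "(real \<Rightarrow> real) \<Rightarrow> real \<Rightarrow> real" where
  "sink f x = 1 / kint f x"

lemma \<delta>_le_1: "\<delta> \<le> 1" using k_bounds[of 0 0] by simp

lemma k_meas' [measurable (raw)]:
  "f \<in> borel_measurable M \<Longrightarrow> g \<in> borel_measurable M \<Longrightarrow> (\<lambda>x. k (f x) (g x)) \<in> borel_measurable M"
  using measurable_compose[OF measurable_Pair k_meas] by simp

lemma k_nonneg [simp]: "0 \<le> k x y" "\<bar>k x y\<bar> = k x y"
  using k_bounds(1)[of x y] \<delta> by auto

lemma integrable_k:
  assumes "pos_bounded f"
  shows "integrable \<nu> (\<lambda>y. k x y * f y)" "integrable \<nu> f"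
proof -
  obtain c C where f: "f \<in> borel_measurable borel" "0 < c" "\<And>x. c \<le> f x" "\<And>x. f x \<le> C"
    using assms unfolding pos_bounded_def by blast
  have [measurable]: "f \<in> borel_measurable borel" by fact
  have "norm (k x y * f y) \<le> C" "norm (f y) \<le> C" for y
  proof -
    have "0 \<le> f y" using f(2) f(3)[of y] by linarith
    then have "k x y * f y \<le> 1 * C" using k_bounds(2)[of x y] f(4)[of y] by (intro mult_mono) auto
    then show "norm (k x y * f y) \<le> C" "norm (f y) \<le> C" using f(4)[of y] \<open>0 \<le> f y\<close> by auto
  qed
  then show "integrable \<nu> (\<lambda>y. k x y * f y)" "integrable \<nu> f"
    by (auto intro!: integrable_const_bound[of _ C] AE_I2)
qed

lemma kint_pos_bounded:
  assumes "pos_bounded f" shows "pos_bounded (kint f)"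
proof -
  obtain c C where f: "f \<in> borel_measurable borel" "0 < c" "\<And>x. c \<le> f x" "\<And>x. f x \<le> C"
    using assms unfolding pos_bounded_def by blast
  have [measurable]: "f \<in> borel_measurable borel" by fact
  note i = integrable_k(1)[OF assms]
  have f0: "0 \<le> f y" for y using f(2) f(3)[of y] by linarith
  show ?thesis
  proof (rule pos_boundedI[of _ "\<delta> * c" C])
    show "kint f \<in> borel_measurable borel"
      unfolding kint_def[abs_def] by measurable
    show "0 < \<delta> * c" using \<delta> f by simp
    have "(\<integral>y. \<delta> * c \<partial>\<nu>) \<le> kint f x" for x
      unfolding kint_def using f k_bounds \<delta>
      by (intro integral_mono i) (auto intro!: mult_mono)
    then show "\<delta> * c \<le> kint f x" for x using prob_space by simp
    have "kint f x \<le> (\<integral>y. C \<partial>\<nu>)" for x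
      unfolding kint_def using f k_bounds f0
      by (intro integral_mono i) (auto intro!: order_trans[OF mult_left_le_one_le])
    then show "kint f x \<le> C" for x using prob_space by simp
  qed
qed

lemma sink_pos_bounded:
  assumes "pos_bounded f" shows "pos_bounded (sink f)"
proof -
  obtain c C where f: "kint f \<in> borel_measurable borel" "0 < c" "\<And>x. c \<le> kint f x" "\<And>x. kint f x \<le> C"
    using kint_pos_bounded[OF assms] unfolding pos_bounded_def by blast
  have [measurable]: "kint f \<in> borel_measurable borel" by fact
  have p: "0 < kint f x" for x using f(2) f(3)[of x] by linarith
  then have C: "0 < C" using f(4)[of 0] p[of 0] by linarith
  show ?thesis
  proof (rule pos_boundedI[of _ "1 / C" "1 / c"])
    show "sink f \<in> borel_measurable borel" unfolding sink_def[abs_def] by measurable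
    show "1 / C \<le> sink f x" "sink f x \<le> 1 / c" for x
      unfolding sink_def using f p[of x] C by (auto intro!: divide_left_mono)
  qed (use C in simp)
qed

text \<open>Since \<open>k\<close> takes values between \<delta> and 1, the weights that average at
  two points \<open>x\<close>, \<open>x'\<close> share a fraction \<open>\<delta>\<^sup>2\<close>,
  and only the rest feels the oscillation of \<open>f / g\<close>. The new constant is therefore the
  mixture \<open>\<delta>\<^sup>2 * 1 + (1 - \<delta>\<^sup>2) * R\<close>. Taking reciprocals
  merely exchanges the two points.\<close>

lemma sink_ratio_osc:
  assumes f: "pos_bounded f" and g: "pos_bounded g" and R: "ratio_osc f g R"
  shows "ratio_osc (sink f) (sink g) (1 + (1 - \<delta>\<^sup>2) * (R - 1))"
proof -
  note fp = pos_boundedD[OF f] note gp = pos_boundedD[OF g]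
  note Fp = pos_boundedD(2)[OF kint_pos_bounded[OF f]]
  note Gp = pos_boundedD(2)[OF kint_pos_bounded[OF g]]
  note iF = integrable_k[OF f] note iG = integrable_k[OF g]
  have main: "kint f x * kint g x' \<le> (1 + (1 - \<delta>\<^sup>2) * (R - 1)) * kint f x' * kint g x" for x x'
  proof -
    let ?F = "kint f" and ?G = "kint g"
    have Gx: "\<delta> * ?G x \<le> ?G x'"
    proof -
      have "\<delta> * ?G x = (\<integral>y. \<delta> * (k x y * g y) \<partial>\<nu>)" by (simp add: kint_def)
      also have "\<dots> \<le> ?G x'"
        unfolding kint_def
      proof (intro integral_mono iG)
        show "integrable \<nu> (\<lambda>y. \<delta> * (k x y * g y))" using iG by simp
        show "\<delta> * (k x y * g y) \<le> k x' y * g y" for y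
        proof -
          have "\<delta> * k x y \<le> \<delta> * 1" using k_bounds \<delta> by (intro mult_left_mono) auto
          also have "\<dots> \<le> k x' y" using k_bounds by simp
          finally have "(\<delta> * k x y) * g y \<le> k x' y * g y" using gp(2)[of y] by (intro mult_right_mono) auto
          then show ?thesis by (simp add: mult.assoc)
        qed
      qed
      finally show ?thesis .
    qed
    \<comment> \<open>The oscillation bound, integrated in its second argument against the kernel at
      \<open>x'\<close>: \<open>f / g\<close> is at most \<open>R\<close> times the ratio of the
      averages at \<open>x'\<close>.\<close>
    have fg: "f y * ?G x' \<le> R * ?F x' * g y" for y
    proof -
      have "f y * ?G x' = (\<integral>y'. f y * (k x' y' * g y') \<partial>\<nu>)" by (simp add: kint_def)
      also have "\<dots> \<le> (\<integral>y'. (R * g y) * (k x' y' * f y') \<partial>\<nu>)"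
      proof (rule integral_mono)
        fix y'
        have "k x' y' * (f y * g y') \<le> k x' y' * (R * f y' * g y)"
          using R by (intro mult_left_mono) (auto simp: ratio_osc_def)
        then show "f y * (k x' y' * g y') \<le> (R * g y) * (k x' y' * f y')" by (simp add: ac_simps)
      qed (use iF iG in auto)
      also have "\<dots> = R * ?F x' * g y" by (simp add: kint_def)
      finally show ?thesis .
    qed
    \<comment> \<open>What is left of the weight at \<open>x\<close> after removal of the share
      common with \<open>x'\<close>. It is nonnegative, so \<open>fg\<close> can be integrated
      against it.\<close>
    define h where "h y = k x y * ?G x' - \<delta>\<^sup>2 * k x' y * ?G x" for y
    have h: "0 \<le> h y" for y
    proof -
      have "(\<delta> * k x' y) * (\<delta> * ?G x) \<le> k x y * ?G x'"
      proof (intro mult_mono Gx)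
        have "\<delta> * k x' y \<le> \<delta> * 1" using k_bounds \<delta> by (intro mult_left_mono) auto
        then show "\<delta> * k x' y \<le> k x y" using k_bounds(1)[of x y] by simp
      qed (use \<delta> Gp[of x] in auto)
      then show ?thesis by (simp add: h_def power2_eq_square ac_simps)
    qed
    have hi: "(\<integral>y. h y * u y \<partial>\<nu>) = kint u x * ?G x' - \<delta>\<^sup>2 * kint u x' * ?G x"
      and hint: "integrable \<nu> (\<lambda>y. h y * u y)" if u: "pos_bounded u" for u
    proof -
      have eq: "h y * u y = ?G x' * (k x y * u y) - (\<delta>\<^sup>2 * ?G x) * (k x' y * u y)" for y
        by (simp add: h_def algebra_simps)
      show "integrable \<nu> (\<lambda>y. h y * u y)" unfolding eq using integrable_k(1)[OF u] by simp
      show "(\<integral>y. h y * u y \<partial>\<nu>) = kint u x * ?G x' - \<delta>\<^sup>2 * kint u x' * ?G x"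
        unfolding eq using integrable_k(1)[OF u] by (simp add: kint_def)
    qed
    have "?G x' * (\<integral>y. h y * f y \<partial>\<nu>) = (\<integral>y. h y * (f y * ?G x') \<partial>\<nu>)"
      by (subst integral_mult_right_zero[symmetric]) (simp add: ac_simps)
    also have "\<dots> \<le> (\<integral>y. (R * ?F x') * (h y * g y) \<partial>\<nu>)"
    proof (rule integral_mono)
      show "integrable \<nu> (\<lambda>y. h y * (f y * ?G x'))"
        using integrable_mult_left[OF hint[OF f], of "?G x'"] by (simp add: ac_simps)
      show "h y * (f y * ?G x') \<le> (R * ?F x') * (h y * g y)" for y
        using mult_left_mono[OF fg[of y] h[of y]] by (simp add: ac_simps)
    qed (use hint[OF g] in auto)
    also have "\<dots> = (R * ?F x') * (?G x * ?G x' - \<delta>\<^sup>2 * ?G x' * ?G x)"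
      using hi[OF g] by simp
    finally have "?G x' * (?F x * ?G x' - \<delta>\<^sup>2 * ?F x' * ?G x) \<le> ?G x' * (R * ?F x' * (1 - \<delta>\<^sup>2) * ?G x)"
      unfolding hi[OF f] by (simp add: algebra_simps)
    then have "?F x * ?G x' - \<delta>\<^sup>2 * ?F x' * ?G x \<le> R * ?F x' * (1 - \<delta>\<^sup>2) * ?G x"
      using Gp[of x'] by (simp add: mult_le_cancel_left_pos)
    then show ?thesis by (simp add: algebra_simps)
  qed
  show ?thesis
    unfolding ratio_osc_def sink_def
  proof (intro allI)
    fix y y'
    show "1 / kint f y * (1 / kint g y') \<le> (1 + (1 - \<delta>\<^sup>2) * (R - 1)) * (1 / kint f y') * (1 / kint g y)"
      using main[of y' y] Fp[of y] Fp[of y'] Gp[of y] Gp[of y'] by (simp add: field_simps)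
  qed
qed

text \<open>The bounds uniform in \<open>n\<close> allow dominated convergence, and the lower one
  keeps the limit integral away from 0.\<close>

lemma sink_tendsto:
  assumes "\<And>n. f n \<in> borel_measurable borel" "\<And>n x. c \<le> f n x" "\<And>n x. f n x \<le> C" "0 < c"
    and lim: "\<And>x. (\<lambda>n. f n x) \<longlonglongrightarrow> g x"
  shows "(\<lambda>n. sink (f n) x) \<longlonglongrightarrow> sink g x"
proof -
  have [measurable]: "f n \<in> borel_measurable borel" for n by fact
  have [measurable]: "g \<in> borel_measurable borel"
    by (rule borel_measurable_LIMSEQ_real[OF lim]) auto
  have g: "pos_bounded g"
  proof (rule pos_boundedI[of g c C])
    show "c \<le> g x" for x by (rule LIMSEQ_le_const[OF lim]) (use assms(2) in blast)
    show "g x \<le> C" for x by (rule LIMSEQ_le_const2[OF lim]) (use assms(3) in blast)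
  qed (use assms(4) in auto)
  have "(\<lambda>n. kint (f n) x) \<longlonglongrightarrow> kint g x"
    unfolding kint_def
  proof (rule integral_dominated_convergence[where w = "\<lambda>_. C"])
    show "AE y in \<nu>. norm (k x y * f n y) \<le> C" for n
    proof (rule AE_I2)
      fix y
      have "0 \<le> f n y" using assms(2)[of n y] assms(4) by linarith
      then have "k x y * f n y \<le> 1 * C" using k_bounds(2)[of x y] assms(3)[of n y] by (intro mult_mono) auto
      then show "norm (k x y * f n y) \<le> C" using \<open>0 \<le> f n y\<close> by auto
    qed
  qed (auto intro!: tendsto_intros lim)
  then show ?thesis
    unfolding sink_def using pos_boundedD(2)[OF kint_pos_bounded[OF g], of x]
    by (intro tendsto_divide tendsto_const) auto
qed

end

lemma bounded_kernel_swap: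
  assumes "bounded_kernel \<nu> k \<delta>" "real_distribution \<mu>"
  shows "bounded_kernel \<mu> (\<lambda>y x. k x y) \<delta>"
proof -
  interpret bounded_kernel \<nu> k \<delta> by fact
  interpret m: real_distribution \<mu> by fact
  show ?thesis
    using \<delta> k_bounds by unfold_locales auto
qed

text \<open>The contraction controls the ratio of consecutive iterates only up to a scalar.
  Conservation of mass fixes this scalar, so the iterates themselves converge, and they do so
  geometrically on the logarithmic scale.\<close>

lemma bounded_kernel_factors:
  assumes K: "bounded_kernel \<nu> k \<delta>" and \<mu>: "real_distribution \<mu>"
  shows "\<exists>a b. pos_bounded a \<and> pos_bounded b \<and>
    (\<forall>x. a x * (\<integral>y. k x y * b y \<partial>\<nu>) = 1) \<and> (\<forall>y. b y * (\<integral>x. k x y * a x \<partial>\<mu>) = 1)"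
proof -
  interpret B: bounded_kernel \<nu> k \<delta> by fact
  interpret A: bounded_kernel \<mu> "\<lambda>y x. k x y" \<delta> by (rule bounded_kernel_swap[OF K \<mu>])
  interpret P: pair_prob_space \<mu> \<nu> ..
  define b where "b n = ((\<lambda>f. A.sink (B.sink f)) ^^ n) (\<lambda>_. 1)" for n
  have b0: "b 0 = (\<lambda>_. 1)" and bS: "b (Suc n) = A.sink (B.sink (b n))" for n
    by (simp_all add: b_def)
  have pb: "pos_bounded (b n)" for n
  proof (induction n)
    case 0 show ?case unfolding b0 by (rule pos_boundedI[of _ 1 1]) auto
  next
    case (Suc n) then show ?case unfolding bS by (intro A.sink_pos_bounded B.sink_pos_bounded)
  qed
  have bm [measurable]: "b n \<in> borel_measurable borel" for n using pb pos_boundedD by blast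
  have bp: "0 < b n x" for n x using pb pos_boundedD by blast
  define q where "q = 1 - \<delta>\<^sup>2"
  have q: "0 \<le> q" "q < 1"
    using B.\<delta> B.\<delta>_le_1 by (auto simp: q_def power_le_one)
  obtain R0 where R0: "ratio_osc (b 1) (b 0) R0" "R0 \<ge> 1"
  proof -
    obtain c C where c: "0 < c" "\<And>x. c \<le> b 1 x" "\<And>x. b 1 x \<le> C"
      using pb[of 1] unfolding pos_bounded_def by blast
    have "c \<le> C" using c(2,3)[of 0] by simp
    have "b 1 y \<le> C / c * b 1 y'" for y y'
    proof -
      have "b 1 y \<le> C / c * c" using c by simp
      also have "\<dots> \<le> C / c * b 1 y'" using c \<open>c \<le> C\<close> by (intro mult_left_mono) auto
      finally show ?thesis .
    qed
    then show ?thesis using c \<open>c \<le> C\<close> by (intro that[of "C / c"]) (auto simp: ratio_osc_def b0)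
  qed
  \<comment> \<open>One step of the iteration applies two contractions, hence the exponent
    \<open>2 * n\<close>.\<close>
  have osc: "ratio_osc (b (Suc n)) (b n) (1 + q ^ (2 * n) * (R0 - 1))" for n
  proof (induction n)
    case 0 then show ?case using R0 by simp
  next
    case (Suc n)
    from A.sink_ratio_osc[OF B.sink_pos_bounded[OF pb] B.sink_pos_bounded[OF pb] B.sink_ratio_osc[OF pb pb Suc]]
    show ?case by (simp add: bS q_def[symmetric] mult.assoc)
  qed
  \<comment> \<open>The mass of \<open>a x * k x y * b n y\<close> computed in both orders:
    integration over \<open>y\<close> first gives 1 for every \<open>x\<close>, integration over
    \<open>x\<close> first gives \<open>b n y / b (Suc n) y\<close>.\<close>
  have mean: "(\<integral>y. b n y / b (Suc n) y \<partial>\<nu>) = 1"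
    and mean_int: "integrable \<nu> (\<lambda>y. b n y / b (Suc n) y)" for n
  proof -
    let ?a = "B.sink (b n)"
    have pa: "pos_bounded ?a" by (intro B.sink_pos_bounded pb)
    have am [measurable]: "?a \<in> borel_measurable borel" using pa pos_boundedD by blast
    have ap: "0 < ?a x" for x using pa pos_boundedD by blast
    obtain Ca where Ca: "\<And>x. ?a x \<le> Ca" using pa unfolding pos_bounded_def by blast
    obtain Cb where Cb: "\<And>x. b n x \<le> Cb" using pb unfolding pos_bounded_def by blast
    have int: "integrable (\<mu> \<Otimes>\<^sub>M \<nu>) (\<lambda>(x, y). ?a x * k x y * b n y)"
    proof (rule P.integrable_const_bound[of _ "Ca * Cb"])
      show "AE z in \<mu> \<Otimes>\<^sub>M \<nu>. norm (case z of (x, y) \<Rightarrow> ?a x * k x y * b n y) \<le> Ca * Cb"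
      proof (rule AE_I2, clarsimp)
        fix x y
        have "?a x * k x y * b n y \<le> Ca * 1 * Cb"
          using ap[of x] bp[of n y] Ca[of x] Cb[of y] B.k_bounds(2)[of x y]
          by (intro mult_mono) (auto intro: less_imp_le order_trans[OF less_imp_le])
        then show "\<bar>?a x * k x y * b n y\<bar> \<le> Ca * Cb"
          using ap[of x] bp[of n y] by (simp add: abs_mult)
      qed
    qed measurable
    have inner1: "(\<integral>y. ?a x * k x y * b n y \<partial>\<nu>) = 1" for x
    proof -
      have "(\<integral>y. ?a x * k x y * b n y \<partial>\<nu>) = ?a x * B.kint (b n) x"
        by (simp add: B.kint_def mult.assoc)
      then show ?thesis
        using pos_boundedD(2)[OF B.kint_pos_bounded[OF pb], of n x] by (simp add: B.sink_def)
    qed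
    have inner2: "(\<integral>x. ?a x * k x y * b n y \<partial>\<mu>) = b n y / b (Suc n) y" for y
    proof -
      have "(\<integral>x. ?a x * k x y * b n y \<partial>\<mu>) = b n y * A.kint ?a y"
        by (simp add: A.kint_def mult.commute mult.left_commute)
      then show ?thesis
        by (simp add: bS A.sink_def)
    qed
    have "(\<integral>y. (\<integral>x. ?a x * k x y * b n y \<partial>\<mu>) \<partial>\<nu>) = (\<integral>x. (\<integral>y. ?a x * k x y * b n y \<partial>\<nu>) \<partial>\<mu>)"
      by (rule P.Fubini_integral[OF int])
    also have "\<dots> = 1" using A.prob_space by (simp add: inner1)
    finally show "(\<integral>y. b n y / b (Suc n) y \<partial>\<nu>) = 1" by (simp only: inner2)
    show "integrable \<nu> (\<lambda>y. b n y / b (Suc n) y)"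
      using P.integrable_snd[OF int] by (simp only: inner2)
  qed
  define R where "R n = 1 + q ^ (2 * n) * (R0 - 1)" for n
  have R1: "R n \<ge> 1" for n using R0 q by (simp add: R_def)
  have quot: "b n y' / b (Suc n) y' \<le> R n * (b n y / b (Suc n) y)" for n y y'
  proof -
    have "b (Suc n) y * b n y' \<le> R n * b (Suc n) y' * b n y"
      using osc[of n] unfolding ratio_osc_def R_def by blast
    then show ?thesis
      using bp[of n y] bp[of n y'] bp[of "Suc n" y] bp[of "Suc n" y']
      by (simp add: field_simps)
  qed
  have B1: "measure \<nu> UNIV = 1" using B.prob_space by simp
  \<comment> \<open>A function with mean 1 that varies by a factor of at most \<open>R n\<close>
    lies between \<open>1 / R n\<close> and \<open>R n\<close>.\<close>
  have up: "b (Suc n) y \<le> R n * b n y" for n y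
  proof -
    have "(\<integral>y'. b n y' / b (Suc n) y' \<partial>\<nu>) \<le> (\<integral>y'. R n * (b n y / b (Suc n) y) \<partial>\<nu>)"
      by (intro integral_mono mean_int quot) auto
    then show ?thesis using bp[of "Suc n" y] by (simp add: mean B1 field_simps)
  qed
  have lo: "b n y \<le> R n * b (Suc n) y" for n y
  proof -
    have "(\<integral>y'. b n y / b (Suc n) y \<partial>\<nu>) \<le> (\<integral>y'. R n * (b n y' / b (Suc n) y') \<partial>\<nu>)"
      by (intro integral_mono quot integrable_mult_right mean_int) auto
    also have "\<dots> = R n"
      by (subst integral_mult_right_zero) (simp add: mean)
    finally show ?thesis using bp[of "Suc n" y] by (simp add: B1 field_simps)
  qed
  \<comment> \<open>On the logarithmic scale the successive ratios become a series;
    \<open>ln R \<le> R - 1\<close> bounds it by a geometric one.\<close>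
  define s where "s n y = ln (b (Suc n) y) - ln (b n y)" for n y
  have sb: "\<bar>s n y\<bar> \<le> (R0 - 1) * (q\<^sup>2) ^ n" for n y
  proof -
    have "ln (b (Suc n) y) \<le> ln (R n * b n y)" "ln (b n y) \<le> ln (R n * b (Suc n) y)"
      using up[of n y] lo[of n y] bp R1[of n] by auto
    then have "\<bar>s n y\<bar> \<le> ln (R n)"
      using bp[of n y] bp[of "Suc n" y] R1[of n] by (simp add: s_def ln_mult abs_le_iff)
    also have "\<dots> \<le> R n - 1" using R1[of n] ln_le_minus_one[of "R n"] by simp
    also have "R n - 1 = (R0 - 1) * (q\<^sup>2) ^ n"
      by (simp only: R_def power_mult add_diff_cancel_left' mult.commute[of "(q\<^sup>2) ^ n" "R0 - 1"])
    finally show ?thesis .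
  qed
  have q2: "q\<^sup>2 < 1" "0 \<le> q\<^sup>2" using q by (auto simp: power_less_one_iff abs_square_less_1)
  define D where "D = (R0 - 1) * (1 / (1 - q\<^sup>2))"
  have gs: "(\<lambda>n. (R0 - 1) * (q\<^sup>2) ^ n) sums D"
    unfolding D_def using q2 by (intro sums_mult geometric_sums) auto
  have ss: "summable (\<lambda>n. s n y)" for y
    by (rule summable_comparison_test'[OF sums_summable[OF gs], of 0]) (use sb in auto)
  have ps: "(\<Sum>i<n. s i y) = ln (b n y)" for n y
    unfolding s_def by (subst sum_lessThan_telescope) (simp add: b0)
  have psb: "\<bar>ln (b n y)\<bar> \<le> D" for n y
  proof -
    have "\<bar>\<Sum>i<n. s i y\<bar> \<le> (\<Sum>i<n. (R0 - 1) * (q\<^sup>2) ^ i)"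
      by (rule order_trans[OF sum_abs]) (intro sum_mono sb)
    also have "\<dots> \<le> D"
      unfolding sums_unique[OF gs] using R0 q2 by (intro sum_le_suminf sums_summable[OF gs]) auto
    finally show ?thesis by (simp add: ps)
  qed
  define L where "L y = exp (\<Sum>n. s n y)" for y
  have bexp: "b n y = exp (ln (b n y))" for n y using bp[of n y] by simp
  have blim: "(\<lambda>n. b n y) \<longlonglongrightarrow> L y" for y
  proof -
    have "(\<lambda>n. exp (\<Sum>i<n. s i y)) \<longlonglongrightarrow> L y"
      unfolding L_def by (intro tendsto_exp summable_LIMSEQ ss)
    then show ?thesis unfolding ps using bp by simp
  qed
  have bb: "exp (- D) \<le> b n y" "b n y \<le> exp D" for n y
    using psb[of n y] by (subst bexp, simp add: abs_le_iff)+
  have Lm: "L \<in> borel_measurable borel" by (rule borel_measurable_LIMSEQ_real[OF blim]) auto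
  have pL: "pos_bounded L"
  proof (rule pos_boundedI[of L "exp (-D)" "exp D"])
    show "exp (-D) \<le> L x" for x by (rule LIMSEQ_le_const[OF blim]) (use bb(1) in blast)
    show "L x \<le> exp D" for x by (rule LIMSEQ_le_const2[OF blim]) (use bb(2) in blast)
  qed (use Lm in auto)
  have alim: "(\<lambda>n. B.sink (b n) x) \<longlonglongrightarrow> B.sink L x" for x
    by (rule B.sink_tendsto[OF _ bb _ blim]) auto
  have kb: "\<delta> * exp (-D) \<le> B.kint (b n) x \<and> B.kint (b n) x \<le> exp D" for n x
  proof
    have "(\<integral>y. \<delta> * exp (-D) \<partial>\<nu>) \<le> B.kint (b n) x"
      unfolding B.kint_def using bb B.k_bounds B.\<delta>
      by (intro integral_mono B.integrable_k(1)[OF pb]) (auto intro!: mult_mono)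
    then show "\<delta> * exp (-D) \<le> B.kint (b n) x" using B.prob_space by simp
    have "B.kint (b n) x \<le> (\<integral>y. exp D \<partial>\<nu>)"
      unfolding B.kint_def
    proof (intro integral_mono B.integrable_k(1)[OF pb])
      fix y
      have "k x y * b n y \<le> 1 * exp D"
        using bp[of n y] bb(2)[of n y] B.k_bounds(2)[of x y] by (intro mult_mono) auto
      then show "k x y * b n y \<le> exp D" by simp
    qed auto
    then show "B.kint (b n) x \<le> exp D" using B.prob_space by simp
  qed
  have "0 < \<delta> * exp (-D)" using B.\<delta> by simp
  then have ab: "1 / exp D \<le> B.sink (b n) x" "B.sink (b n) x \<le> 1 / (\<delta> * exp (-D))" for n x
    using kb[of n x] unfolding B.sink_def
    by (auto intro!: divide_left_mono mult_pos_pos simp del: exp_gt_zero intro: less_le_trans)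
  have "(\<lambda>n. A.sink (B.sink (b n)) y) \<longlonglongrightarrow> A.sink (B.sink L) y" for y
    by (rule A.sink_tendsto[OF _ ab _ alim])
      (auto intro!: pos_boundedD(1)[OF B.sink_pos_bounded[OF pb]])
  then have "(\<lambda>n. b (Suc n) y) \<longlonglongrightarrow> A.sink (B.sink L) y" for y
    by (simp add: bS)
  then have fix_L: "A.sink (B.sink L) y = L y" for y
    using LIMSEQ_Suc[OF blim, of y] LIMSEQ_unique by blast
  let ?a = "B.sink L"
  have pa: "pos_bounded ?a" by (intro B.sink_pos_bounded pL)
  show ?thesis
  proof (rule exI[of _ ?a], rule exI[of _ L], intro conjI allI pa pL)
    fix x
    show "?a x * (\<integral>y. k x y * L y \<partial>\<nu>) = 1"
      using pos_boundedD(2)[OF B.kint_pos_bounded[OF pL], of x] by (simp add: B.sink_def B.kint_def)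
  next
    fix y
    show "L y * (\<integral>x. k x y * ?a x \<partial>\<mu>) = 1"
      using pos_boundedD(2)[OF A.kint_pos_bounded[OF pa], of y] fix_L[of y, unfolded A.sink_def A.kint_def]
      by (simp add: A.kint_def field_simps)
  qed
qed

text \<open>The two normalising equations say that the density integrates to 1 along each horizontal
  and each vertical line.\<close>

lemma bounded_kernel_plan:
  assumes K: "bounded_kernel \<nu> k \<delta>" and \<mu>: "real_distribution \<mu>"
  shows "\<exists>a b. a \<in> borel_measurable borel \<and> b \<in> borel_measurable borel \<and> (\<forall>x. 0 \<le> a x) \<and> (\<forall>y. 0 \<le> b y) \<and>
    density (\<mu> \<Otimes>\<^sub>M \<nu>) (\<lambda>z. ennreal (a (fst z) * b (snd z) * k (fst z) (snd z))) \<in> Marg \<mu> \<nu>"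
proof -
  interpret B: bounded_kernel \<nu> k \<delta> by fact
  interpret A: bounded_kernel \<mu> "\<lambda>y x. k x y" \<delta> by (rule bounded_kernel_swap[OF K \<mu>])
  interpret P: pair_prob_space \<mu> \<nu> ..
  obtain a b where a: "pos_bounded a" and b: "pos_bounded b"
    and ae: "\<And>x. a x * (\<integral>y. k x y * b y \<partial>\<nu>) = 1" and be: "\<And>y. b y * (\<integral>x. k x y * a x \<partial>\<mu>) = 1"
    using bounded_kernel_factors[OF K \<mu>] by blast
  have [measurable]: "a \<in> borel_measurable borel" "b \<in> borel_measurable borel"
    using a b pos_boundedD by auto
  have ap: "0 < a x" "0 < b x" for x using a b pos_boundedD by auto
  let ?f = "\<lambda>z. a (fst z) * b (snd z) * k (fst z) (snd z)"
  let ?\<pi> = "density (\<mu> \<Otimes>\<^sub>M \<nu>) (\<lambda>z. ennreal (?f z))"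
  have fn: "0 \<le> ?f z" for z using ap[of "fst z"] ap[of "snd z"] by (auto intro!: mult_nonneg_nonneg less_imp_le)
  have 1: "(\<integral>\<^sup>+y. ennreal (a x * b y * k x y) \<partial>\<nu>) = 1" for x
  proof -
    have "(\<integral>\<^sup>+y. ennreal (a x * b y * k x y) \<partial>\<nu>) = ennreal (\<integral>y. a x * (k x y * b y) \<partial>\<nu>)"
      using B.integrable_k(1)[OF b, of x] fn[of "(x, _)"]
      by (subst nn_integral_eq_integral[symmetric]) (auto simp: ac_simps)
    then show ?thesis using ae[of x] by simp
  qed
  have 2: "(\<integral>\<^sup>+x. ennreal (a x * b y * k x y) \<partial>\<mu>) = 1" for y
  proof -
    have "(\<integral>\<^sup>+x. ennreal (a x * b y * k x y) \<partial>\<mu>) = (\<integral>\<^sup>+x. ennreal (b y * (k x y * a x)) \<partial>\<mu>)"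
      by (simp add: ac_simps)
    also have "\<dots> = ennreal (\<integral>x. b y * (k x y * a x) \<partial>\<mu>)"
    proof (rule nn_integral_eq_integral)
      show "integrable \<mu> (\<lambda>x. b y * (k x y * a x))"
        by (rule integrable_mult_right) (rule A.integrable_k(1)[OF a])
    qed (use ap in \<open>auto intro!: AE_I2 mult_nonneg_nonneg simp: less_imp_le\<close>)
    finally have "(\<integral>\<^sup>+x. ennreal (a x * b y * k x y) \<partial>\<mu>) = ennreal (\<integral>x. b y * (k x y * a x) \<partial>\<mu>)" .
    then show ?thesis using be[of y] by simp
  qed
  have m1: "distr ?\<pi> borel fst = \<mu>"
  proof (rule measure_eqI)
    fix X assume "X \<in> sets (distr ?\<pi> borel fst)"
    then have [measurable]: "X \<in> sets borel" by simp
    have X: "fst -` X \<inter> space ?\<pi> \<in> sets (\<mu> \<Otimes>\<^sub>M \<nu>)"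
      using measurable_sets[of fst "\<mu> \<Otimes>\<^sub>M \<nu>" borel X] by simp
    have "emeasure (distr ?\<pi> borel fst) X = emeasure ?\<pi> (fst -` X \<inter> space ?\<pi>)"
      by (rule emeasure_distr) auto
    also have "\<dots> = (\<integral>\<^sup>+z. ennreal (?f z) * indicator X (fst z) \<partial>(\<mu> \<Otimes>\<^sub>M \<nu>))"
      by (subst emeasure_density[OF _ X]) (auto intro!: nn_integral_cong simp: indicator_def space_pair_measure)
    also have "\<dots> = (\<integral>\<^sup>+x. (\<integral>\<^sup>+y. ennreal (a x * b y * k x y) * indicator X x \<partial>\<nu>) \<partial>\<mu>)"
      by (subst B.nn_integral_fst[symmetric]) auto
    also have "\<dots> = (\<integral>\<^sup>+x. indicator X x \<partial>\<mu>)"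
      by (subst nn_integral_multc) (auto simp: 1)
    also have "\<dots> = emeasure \<mu> X" by simp
    finally show "emeasure (distr ?\<pi> borel fst) X = emeasure \<mu> X" .
  qed simp
  have m2: "distr ?\<pi> borel snd = \<nu>"
  proof (rule measure_eqI)
    fix X assume "X \<in> sets (distr ?\<pi> borel snd)"
    then have [measurable]: "X \<in> sets borel" by simp
    have X: "snd -` X \<inter> space ?\<pi> \<in> sets (\<mu> \<Otimes>\<^sub>M \<nu>)"
      using measurable_sets[of snd "\<mu> \<Otimes>\<^sub>M \<nu>" borel X] by simp
    have "emeasure (distr ?\<pi> borel snd) X = emeasure ?\<pi> (snd -` X \<inter> space ?\<pi>)"
      by (rule emeasure_distr) auto
    also have "\<dots> = (\<integral>\<^sup>+z. ennreal (?f z) * indicator X (snd z) \<partial>(\<mu> \<Otimes>\<^sub>M \<nu>))"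
      by (subst emeasure_density[OF _ X]) (auto intro!: nn_integral_cong simp: indicator_def space_pair_measure)
    also have "\<dots> = (\<integral>\<^sup>+y. (\<integral>\<^sup>+x. ennreal (a x * b y * k x y) * indicator X y \<partial>\<mu>) \<partial>\<nu>)"
      by (subst P.nn_integral_snd[symmetric]) auto
    also have "\<dots> = (\<integral>\<^sup>+y. indicator X y \<partial>\<nu>)"
      by (subst nn_integral_multc) (auto simp: 2)
    also have "\<dots> = emeasure \<nu> X" by simp
    finally show "emeasure (distr ?\<pi> borel snd) X = emeasure \<nu> X" .
  qed simp
  have "finite_measure ?\<pi>"
  proof
    have "emeasure (distr ?\<pi> borel fst) (space borel) = emeasure ?\<pi> (space ?\<pi>)"
      by (subst emeasure_distr) auto
    then show "emeasure ?\<pi> (space ?\<pi>) \<noteq> \<infinity>" unfolding m1 by (metis A.emeasure_finite infinity_ennreal_def)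
  qed
  then have "?\<pi> \<in> Marg \<mu> \<nu>"
    unfolding Marg_def using m1 m2 real_distribution_sets_pair(2)[OF \<mu> B.real_distribution_axioms] by simp
  then show ?thesis
    using ap by (intro exI[of _ a] exI[of _ b]) (auto intro: less_imp_le)
qed

section \<open>Existence of the entropic plan\<close>

lemma nn_integral_pair_mult:
  assumes \<nu>: "sigma_finite_measure \<nu>"
    and [measurable]: "f \<in> borel_measurable \<mu>" "g \<in> borel_measurable \<nu>"
  shows "(\<integral>\<^sup>+z. f (fst z) * g (snd z) \<partial>(\<mu> \<Otimes>\<^sub>M \<nu>)) = (\<integral>\<^sup>+x. f x \<partial>\<mu>) * (\<integral>\<^sup>+y. g y \<partial>\<nu>)"
proof -
  interpret sigma_finite_measure \<nu> by fact
  have "(\<integral>\<^sup>+z. f (fst z) * g (snd z) \<partial>(\<mu> \<Otimes>\<^sub>M \<nu>)) = (\<integral>\<^sup>+x. (\<integral>\<^sup>+y. f x * g y \<partial>\<nu>) \<partial>\<mu>)"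
    by (subst nn_integral_fst[symmetric]) auto
  also have "\<dots> = (\<integral>\<^sup>+x. f x * (\<integral>\<^sup>+y. g y \<partial>\<nu>) \<partial>\<mu>)"
    by (intro nn_integral_cong nn_integral_cmult) auto
  also have "\<dots> = (\<integral>\<^sup>+x. f x \<partial>\<mu>) * (\<integral>\<^sup>+y. g y \<partial>\<nu>)"
    by (intro nn_integral_multc) auto
  finally show ?thesis .
qed

lemma sigma_finite_restr:
  assumes "sigma_finite_measure M" "A \<in> sets M"
  shows "sigma_finite_measure (restr M A)"
proof -
  have "AE x in M. indicator A x \<noteq> (\<infinity> :: ennreal)"
    by (rule AE_I2) (simp add: indicator_def)
  then show ?thesis
    using assms(2) sigma_finite_measure.sigma_finite_iff_density_finite[OF assms(1), of "indicator A"]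
    by (simp add: restr_def)
qed

text \<open>A product measure is determined by its rectangles, so the restrictions to each
  \<open>A i \<times> B i\<close> agree; making the cover disjoint adds them up. Each rectangle is
  treated by itself, with no relation between different ones.\<close>

lemma pair_eq_on_countable_cover:
  fixes \<tau> :: "(real \<times> real) measure" and A B :: "nat \<Rightarrow> real set"
  assumes \<tau>: "sets \<tau> = sets borel"
    and \<alpha>: "sigma_finite_measure \<alpha>" "sets \<alpha> = sets borel"
    and \<beta>: "sigma_finite_measure \<beta>" "sets \<beta> = sets borel"
    and AB: "\<And>i. A i \<in> sets borel" "\<And>i. B i \<in> sets borel"
    and eq: "\<And>i S T. S \<in> sets borel \<Longrightarrow> T \<in> sets borel \<Longrightarrow> S \<subseteq> A i \<Longrightarrow> T \<subseteq> B i \<Longrightarrow>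
        emeasure \<alpha> S * emeasure \<beta> T = emeasure \<tau> (S \<times> T)"
    and X: "X \<in> sets borel" "X \<subseteq> (\<Union>i. A i \<times> B i)"
  shows "emeasure \<tau> X = emeasure (\<alpha> \<Otimes>\<^sub>M \<beta>) X"
proof -
  interpret \<beta>: sigma_finite_measure \<beta> by fact
  have s2: "sets (\<alpha> \<Otimes>\<^sub>M \<beta>) = sets (borel \<Otimes>\<^sub>M borel)"
    using \<alpha>(2) \<beta>(2) by (intro sets_pair_measure_cong)
  then have s2': "sets (\<alpha> \<Otimes>\<^sub>M \<beta>) = sets borel" by (subst (asm) borel_prod)
  have Rm: "A i \<times> B i \<in> sets borel" for i
    using AB[of i] by (subst borel_prod[symmetric]) auto
  have "restr \<alpha> (A i) \<Otimes>\<^sub>M restr \<beta> (B i) = restr \<tau> (A i \<times> B i)" for i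
  proof (rule pair_measure_eqI)
    show "sigma_finite_measure (restr \<alpha> (A i))" "sigma_finite_measure (restr \<beta> (B i))"
      using AB[of i] \<alpha> \<beta> by (auto intro!: sigma_finite_restr)
    show "sets (restr \<alpha> (A i) \<Otimes>\<^sub>M restr \<beta> (B i)) = sets (restr \<tau> (A i \<times> B i))"
      using s2' \<tau> by (simp cong: sets_pair_measure_cong)
    fix S T assume "S \<in> sets (restr \<alpha> (A i))" "T \<in> sets (restr \<beta> (B i))"
    then have ST: "S \<in> sets borel" "T \<in> sets borel" using \<alpha> \<beta> by auto
    then have "S \<times> T \<in> sets borel" by (subst borel_prod[symmetric]) auto
    then have "emeasure (restr \<tau> (A i \<times> B i)) (S \<times> T) = emeasure \<tau> ((A i \<inter> S) \<times> (B i \<inter> T))"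
      using Rm[of i] \<tau> by (subst emeasure_restr) (auto simp: Times_Int_Times)
    then show "emeasure (restr \<alpha> (A i)) S * emeasure (restr \<beta> (B i)) T =
        emeasure (restr \<tau> (A i \<times> B i)) (S \<times> T)"
      using eq[of "A i \<inter> S" "B i \<inter> T" i] ST AB[of i] \<alpha> \<beta> by (simp add: emeasure_restr)
  qed
  moreover have "restr \<alpha> (A i) \<Otimes>\<^sub>M restr \<beta> (B i) = restr (\<alpha> \<Otimes>\<^sub>M \<beta>) (A i \<times> B i)" for i
    unfolding restr_def
    using AB[of i] \<alpha> \<beta> sigma_finite_restr[OF \<beta>(1), of "B i", unfolded restr_def]
    by (subst pair_measure_density) (auto intro!: density_cong AE_I2 simp: indicator_def s2' Rm)
  ultimately have r: "restr \<tau> (A i \<times> B i) = restr (\<alpha> \<Otimes>\<^sub>M \<beta>) (A i \<times> B i)" for i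
    by simp
  have e: "emeasure \<tau> Y = emeasure (\<alpha> \<Otimes>\<^sub>M \<beta>) Y" if Y: "Y \<in> sets borel" "Y \<subseteq> A i \<times> B i" for Y i
  proof -
    have "(A i \<times> B i) \<inter> Y = Y" using Y by auto
    then show ?thesis
      using arg_cong[OF r[of i], of "\<lambda>M. emeasure M Y"] Y Rm[of i] \<tau> s2' by (simp add: emeasure_restr)
  qed
  define D where "D i = X \<inter> disjointed (\<lambda>i. A i \<times> B i) i" for i
  have Dm: "D i \<in> sets borel" for i
    unfolding D_def disjointed_def using X(1) Rm by (intro sets.Int sets.Diff sets.finite_UN) auto
  have Ds: "D i \<subseteq> A i \<times> B i" for i
    unfolding D_def using disjointed_subset[of "\<lambda>i. A i \<times> B i" i] by blast
  have DU: "(\<Union>i. D i) = X"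
    using X(2) unfolding D_def by (subst Int_UN_distrib[symmetric], subst UN_disjointed_eq) auto
  have Dd: "disjoint_family D"
    using disjoint_family_disjointed[of "\<lambda>i. A i \<times> B i"] unfolding D_def disjoint_family_on_def by blast
  have "emeasure \<tau> X = (\<Sum>i. emeasure \<tau> (D i))"
    using Dm Dd \<tau> by (subst suminf_emeasure) (auto simp: DU)
  also have "\<dots> = (\<Sum>i. emeasure (\<alpha> \<Otimes>\<^sub>M \<beta>) (D i))"
    using e[OF Dm Ds] by simp
  also have "\<dots> = emeasure (\<alpha> \<Otimes>\<^sub>M \<beta>) X"
    using Dm Dd s2' by (subst suminf_emeasure) (auto simp: DU)
  finally show ?thesis .
qed

lemma cost_kernel_continuous: "continuous_on UNIV (cost_kernel \<epsilon>)"
  unfolding cost_kernel_def[abs_def] divide_inverse by (intro continuous_intros)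

lemma sigma_finite_exhaustI:
  fixes A :: "nat \<Rightarrow> 'a set"
  assumes "\<And>n. A n \<in> sets M" "(\<Union>n. A n) = space M" "\<And>n. emeasure M (A n) \<noteq> \<infinity>"
  shows "sigma_finite_measure M"
  by (rule sigma_finite_measure.intro) (use assms in \<open>auto intro!: exI[of _ "range A"]\<close>)

text \<open>The four-rectangle identity says that \<tau> has rank one. A box
  \<open>J \<times> J\<close> of positive finite mass \<open>c\<close> serves as base point:
  \<open>\<alpha>\<close> is the mass of \<open>A \<times> J\<close>, and \<open>\<beta>\<close> the
  mass of \<open>J \<times> B\<close> divided by \<open>c\<close>. The identity is asked for in
  bounded boxes because \<tau> may have infinite mass.\<close>

lemma product_structure_bounded:
  fixes \<tau> :: "(real \<times> real) measure"
  assumes \<tau>: "sets \<tau> = sets borel"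
    and fin: "\<And>m::nat. emeasure \<tau> ({-real m..real m} \<times> {-real m..real m}) < \<infinity>"
    and prod: "\<And>(m::nat) A A' B B'. A \<in> sets borel \<Longrightarrow> A' \<in> sets borel \<Longrightarrow> B \<in> sets borel \<Longrightarrow> B' \<in> sets borel \<Longrightarrow>
      A \<union> A' \<union> B \<union> B' \<subseteq> {-real m..real m} \<Longrightarrow>
      emeasure \<tau> (A \<times> B) * emeasure \<tau> (A' \<times> B') = emeasure \<tau> (A \<times> B') * emeasure \<tau> (A' \<times> B)"
    and pos: "emeasure \<tau> UNIV > 0"
  obtains \<alpha> \<beta> :: "real measure" where "sets \<alpha> = sets borel" "sets \<beta> = sets borel"
    "sigma_finite_measure \<alpha>" "sigma_finite_measure \<beta>" "\<tau> = \<alpha> \<Otimes>\<^sub>M \<beta>"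
proof -
  define I where "I m = {-real m..real m}" for m :: nat
  have Im [measurable]: "I m \<in> sets borel" for m by (simp add: I_def)
  have I_mono: "I m \<subseteq> I n" if "m \<le> n" for m n using that by (auto simp: I_def)
  have IU: "(\<Union>m. I m) = UNIV"
  proof -
    have "\<exists>m. x \<in> I m" for x :: real
    proof -
      obtain m :: nat where "\<bar>x\<bar> \<le> real m" using real_arch_simple by blast
      then show ?thesis by (auto simp: I_def intro!: exI[of _ m])
    qed
    then show ?thesis by auto
  qed
  have IIU: "(\<Union>m. I m \<times> I m) = UNIV"
  proof -
    have "\<exists>m. (x, y) \<in> I m \<times> I m" for x y :: real
    proof -
      obtain m n where "x \<in> I m" "y \<in> I n" using IU by blast
      then have "(x, y) \<in> I (max m n) \<times> I (max m n)"
        using I_mono[of m "max m n"] I_mono[of n "max m n"] by auto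
      then show ?thesis by blast
    qed
    then show ?thesis by auto
  qed
  have Tm: "A \<times> B \<in> sets \<tau>" if "A \<in> sets borel" "B \<in> sets borel" for A B
    using that unfolding \<tau> by (subst borel_prod[symmetric]) auto
  have [measurable_cong]: "sets \<tau> = sets (borel \<Otimes>\<^sub>M borel)"
    by (subst borel_prod) (rule \<tau>)
  have sp: "space \<tau> = UNIV" using sets_eq_imp_space_eq[OF \<tau>] by simp
  have "\<exists>m. emeasure \<tau> (I m \<times> I m) \<noteq> 0"
  proof (rule ccontr)
    assume "\<not> ?thesis"
    then have "emeasure \<tau> (\<Union>m. I m \<times> I m) = 0"
      using Tm by (intro emeasure_UN_eq_0) auto
    then show False using pos by (simp add: IIU)
  qed
  then obtain m0 where m0: "emeasure \<tau> (I m0 \<times> I m0) \<noteq> 0" by blast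
  define J where "J = I m0"
  have [measurable]: "J \<in> sets borel" by (simp add: J_def)
  define c where "c = emeasure \<tau> (J \<times> J)"
  have c: "c \<noteq> 0" "c \<noteq> \<infinity>" using m0 fin[of m0] by (auto simp: c_def J_def I_def)
  define \<alpha> where "\<alpha> = distr (restr \<tau> (UNIV \<times> J)) borel fst"
  define \<beta> where "\<beta> = scale_measure (1 / c) (distr (restr \<tau> (J \<times> UNIV)) borel snd)"
  have s [simp]: "sets \<alpha> = sets borel" "sets \<beta> = sets borel" by (auto simp: \<alpha>_def \<beta>_def)
  have \<alpha>: "emeasure \<alpha> A = emeasure \<tau> (A \<times> J)" if [measurable]: "A \<in> sets borel" for A
  proof -
    have "emeasure \<alpha> A = emeasure (restr \<tau> (UNIV \<times> J)) (fst -` A \<inter> space \<tau>)"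
      unfolding \<alpha>_def by (subst emeasure_distr) (auto simp: restr_def)
    also have "fst -` A \<inter> space \<tau> = A \<times> UNIV" by (auto simp: sp)
    also have "emeasure (restr \<tau> (UNIV \<times> J)) (A \<times> UNIV) = emeasure \<tau> (A \<times> J)"
      by (subst emeasure_restr) (auto simp: Tm Times_Int_Times)
    finally show ?thesis .
  qed
  have \<beta>: "emeasure \<beta> B = 1 / c * emeasure \<tau> (J \<times> B)" if [measurable]: "B \<in> sets borel" for B
  proof -
    have "emeasure \<beta> B = 1 / c * emeasure (restr \<tau> (J \<times> UNIV)) (snd -` B \<inter> space \<tau>)"
      unfolding \<beta>_def by (subst emeasure_scale_measure, subst emeasure_distr) (auto simp: restr_def)
    also have "snd -` B \<inter> space \<tau> = UNIV \<times> B" by (auto simp: sp)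
    also have "emeasure (restr \<tau> (J \<times> UNIV)) (UNIV \<times> B) = emeasure \<tau> (J \<times> B)"
      by (subst emeasure_restr) (auto simp: Tm Times_Int_Times)
    finally show ?thesis .
  qed
  have finJ: "emeasure \<tau> (I m \<times> J) \<noteq> \<infinity>" "emeasure \<tau> (J \<times> I m) \<noteq> \<infinity>" for m
  proof -
    have "emeasure \<tau> (I m \<times> J) \<le> emeasure \<tau> (I (max m m0) \<times> I (max m m0))"
      using I_mono[of m "max m m0"] I_mono[of m0 "max m m0"] by (intro emeasure_mono Tm) (auto simp: J_def)
    then show "emeasure \<tau> (I m \<times> J) \<noteq> \<infinity>" using fin[of "max m m0"] by (auto simp: I_def top_unique)
    have "emeasure \<tau> (J \<times> I m) \<le> emeasure \<tau> (I (max m m0) \<times> I (max m m0))"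
      using I_mono[of m "max m m0"] I_mono[of m0 "max m m0"] by (intro emeasure_mono Tm) (auto simp: J_def)
    then show "emeasure \<tau> (J \<times> I m) \<noteq> \<infinity>" using fin[of "max m m0"] by (auto simp: I_def top_unique)
  qed
  have c1: "1 / c \<noteq> \<infinity>" using c by (simp add: ennreal_divide_eq_top_iff)
  have \<alpha>f: "sigma_finite_measure \<alpha>"
    by (rule sigma_finite_exhaustI[of I])
      (use finJ in \<open>auto simp: IU \<alpha> sets_eq_imp_space_eq[of \<alpha> borel]\<close>)
  have \<beta>f: "sigma_finite_measure \<beta>"
    by (rule sigma_finite_exhaustI[of I])
      (use finJ c1 in \<open>auto simp: IU \<beta> sets_eq_imp_space_eq[of \<beta> borel] ennreal_mult_eq_top_iff\<close>)
  have "\<tau> = \<alpha> \<Otimes>\<^sub>M \<beta>"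
  proof (rule measure_eqI)
    show "sets \<tau> = sets (\<alpha> \<Otimes>\<^sub>M \<beta>)"
      unfolding \<tau> by (subst borel_prod[symmetric]) (intro sets_pair_measure_cong, auto)
    fix X assume "X \<in> sets \<tau>"
    then have X: "X \<in> sets borel" by (simp add: \<tau>)
    show "emeasure \<tau> X = emeasure (\<alpha> \<Otimes>\<^sub>M \<beta>) X"
    proof (rule pair_eq_on_countable_cover[OF \<tau> \<alpha>f s(1) \<beta>f s(2), of I I])
      fix i S T assume ST: "S \<in> sets borel" "T \<in> sets borel" "S \<subseteq> I i" "T \<subseteq> I i"
      let ?m = "max i m0"
      have "emeasure \<tau> (S \<times> J) * emeasure \<tau> (J \<times> T) = emeasure \<tau> (S \<times> T) * c"
        unfolding c_def
        using I_mono[of i ?m] I_mono[of m0 ?m] ST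
        by (intro prod[of _ _ _ _ ?m]) (auto simp: J_def I_def[of ?m, symmetric])
      then have "emeasure \<alpha> S * emeasure \<beta> T = emeasure \<tau> (S \<times> T) * (c * (1 / c))"
        using ST by (simp add: \<alpha> \<beta> ac_simps)
      also have "c * (1 / c) = 1"
        using c by (simp add: ennreal_times_divide ennreal_divide_self less_top)
      finally show "emeasure \<alpha> S * emeasure \<beta> T = emeasure \<tau> (S \<times> T)" by simp
    qed (use X IIU in auto)
  qed
  then show ?thesis using that s \<alpha>f \<beta>f by blast
qed

text \<open>Integrating out the second coordinate shows that \<mu> has density
  \<open>\<kappa>\<close> with respect to \<alpha>. Positivity of \<open>K\<close> makes
  \<open>\<kappa>\<close> positive, and the finite mass of \<mu> makes it finite almost everywhere,
  so the density can be inverted.\<close>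

lemma marginal_of_product_density:
  fixes \<alpha> \<beta> \<mu> :: "real measure" and K :: "real \<times> real \<Rightarrow> ennreal"
  assumes s: "sets \<alpha> = sets borel" "sets \<beta> = sets borel"
    and \<alpha>: "sigma_finite_measure \<alpha>" and \<beta>: "sigma_finite_measure \<beta>"
    and [measurable]: "K \<in> borel_measurable (borel \<Otimes>\<^sub>M borel)" and Kpos: "\<And>z. K z > 0"
    and \<mu>: "\<mu> = distr (density (\<alpha> \<Otimes>\<^sub>M \<beta>) K) borel fst" and fin: "finite_measure \<mu>" "emeasure \<mu> UNIV > 0"
  shows "\<exists>a :: real \<Rightarrow> real. a \<in> borel_measurable borel \<and> (\<forall>x. 0 \<le> a x) \<and> \<alpha> = density \<mu> (\<lambda>x. ennreal (a x))"
proof -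
  interpret \<beta>: sigma_finite_measure \<beta> by fact
  note [measurable_cong] = s
  define \<kappa> where "\<kappa> x = (\<integral>\<^sup>+y. K (x, y) \<partial>\<beta>)" for x
  have [measurable]: "\<kappa> \<in> borel_measurable borel" unfolding \<kappa>_def by measurable
  have mu_eq: "\<mu> = density \<alpha> \<kappa>"
  proof (rule measure_eqI)
    show "sets \<mu> = sets (density \<alpha> \<kappa>)" by (simp add: \<mu> s)
    fix A assume "A \<in> sets \<mu>"
    then have [measurable]: "A \<in> sets borel" by (simp add: \<mu>)
    have X: "fst -` A \<inter> space (\<alpha> \<Otimes>\<^sub>M \<beta>) \<in> sets (\<alpha> \<Otimes>\<^sub>M \<beta>)"
      using measurable_sets[of fst "\<alpha> \<Otimes>\<^sub>M \<beta>" borel A] by simp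
    have "emeasure \<mu> A = emeasure (density (\<alpha> \<Otimes>\<^sub>M \<beta>) K) (fst -` A \<inter> space (\<alpha> \<Otimes>\<^sub>M \<beta>))"
      unfolding \<mu> by (subst emeasure_distr) auto
    also have "\<dots> = (\<integral>\<^sup>+z. K z * indicator A (fst z) \<partial>(\<alpha> \<Otimes>\<^sub>M \<beta>))"
      by (subst emeasure_density[OF _ X]) (auto intro!: nn_integral_cong simp: indicator_def)
    also have "\<dots> = (\<integral>\<^sup>+x. (\<integral>\<^sup>+y. K (x, y) * indicator A x \<partial>\<beta>) \<partial>\<alpha>)"
      by (subst \<beta>.nn_integral_fst[symmetric]) auto
    also have "\<dots> = (\<integral>\<^sup>+x. \<kappa> x * indicator A x \<partial>\<alpha>)"
      unfolding \<kappa>_def by (intro nn_integral_cong nn_integral_multc) auto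
    also have "\<dots> = emeasure (density \<alpha> \<kappa>) A"
      by (subst emeasure_density) auto
    finally show "emeasure \<mu> A = emeasure (density \<alpha> \<kappa>) A" .
  qed
  have \<beta>0: "emeasure \<beta> (space \<beta>) \<noteq> 0"
  proof
    assume "emeasure \<beta> (space \<beta>) = 0"
    then have "(\<integral>\<^sup>+y. K (x, y) \<partial>\<beta>) = 0" for x
      by (intro nn_integral_zero') (auto intro!: AE_I[of _ _ "space \<beta>"])
    then have "\<kappa> = (\<lambda>_. 0)" by (simp add: \<kappa>_def fun_eq_iff)
    then have "emeasure \<mu> (space \<alpha>) = 0" unfolding mu_eq by (subst emeasure_density) auto
    then show False using fin(2) sets_eq_imp_space_eq[OF s(1)] by simp
  qed
  have \<kappa>pos: "\<kappa> x > 0" for x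
  proof (rule ccontr)
    assume "\<not> ?thesis"
    then have "(\<integral>\<^sup>+y. K (x, y) \<partial>\<beta>) = 0" by (simp add: \<kappa>_def)
    then have "AE y in \<beta>. K (x, y) = 0"
      by (subst (asm) nn_integral_0_iff_AE) auto
    then have "AE y in \<beta>. False" using Kpos by (auto simp: less_le)
    then show False using \<beta>0 by (simp add: AE_iff_null null_sets_def)
  qed
  have "(\<integral>\<^sup>+x. \<kappa> x \<partial>\<alpha>) = emeasure \<mu> (space \<alpha>)"
    unfolding mu_eq by (subst emeasure_density) (auto intro!: nn_integral_cong)
  then have \<kappa>f: "AE x in \<alpha>. \<kappa> x \<noteq> \<infinity>"
    using finite_measure.emeasure_finite[OF fin(1)] by (intro nn_integral_PInf_AE) auto
  define a where "a x = enn2real (inverse (\<kappa> x))" for x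
  have ea: "ennreal (a x) = inverse (\<kappa> x)" for x
    unfolding a_def using \<kappa>pos[of x] by (simp add: ennreal_enn2real_if)
  have "\<alpha> = density \<mu> (\<lambda>x. ennreal (a x))"
  proof -
    have "density \<mu> (\<lambda>x. ennreal (a x)) = density \<alpha> (\<lambda>x. \<kappa> x * inverse (\<kappa> x))"
      unfolding ea mu_eq by (subst density_density_eq) auto
    also have "\<dots> = density \<alpha> (\<lambda>_. 1)"
    proof (rule density_cong)
      show "AE x in \<alpha>. \<kappa> x * inverse (\<kappa> x) = 1"
        using \<kappa>f
      proof eventually_elim
        case (elim x)
        then show ?case using \<kappa>pos[of x] by (simp add: less_top divide_ennreal_def[symmetric] ennreal_divide_self)
      qed
    qed auto
    also have "\<dots> = \<alpha>" by (rule density_1)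
    finally show ?thesis by simp
  qed
  then show ?thesis by (intro exI[of _ a]) (auto simp: a_def[abs_def])
qed

text \<open>The weight \<open>w\<close> makes the kernel factor on \<open>A \<times> B\<close>. In
  the applications it is the reciprocal of the kernel on a box, the constant 1 on a quadrant, where
  the kernel factors by itself, or an exponential that serves the crossing bound.\<close>

lemma nn_integral_factored_density:
  fixes a b u v :: "real \<Rightarrow> real" and k w :: "real \<times> real \<Rightarrow> real"
  assumes \<mu>: "real_distribution \<mu>" and \<nu>: "real_distribution \<nu>"
    and [measurable]: "a \<in> borel_measurable borel" "b \<in> borel_measurable borel"
      "k \<in> borel_measurable (borel \<Otimes>\<^sub>M borel)" "w \<in> borel_measurable (borel \<Otimes>\<^sub>M borel)"
      "u \<in> borel_measurable borel" "v \<in> borel_measurable borel" "A \<in> sets borel" "B \<in> sets borel"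
    and nn: "\<And>x. 0 \<le> a x" "\<And>y. 0 \<le> b y" "\<And>x. 0 \<le> u x" "\<And>y. 0 \<le> v y" "\<And>z. 0 \<le> k z" "\<And>z. 0 \<le> w z"
    and kw: "\<And>x y. x \<in> A \<Longrightarrow> y \<in> B \<Longrightarrow> k (x, y) * w (x, y) = u x * v y"
  shows "(\<integral>\<^sup>+z. ennreal (w z) * (indicator A (fst z) * indicator B (snd z))
        \<partial>density (\<mu> \<Otimes>\<^sub>M \<nu>) (\<lambda>z. ennreal (a (fst z) * b (snd z) * k z))) =
      (\<integral>\<^sup>+x. ennreal (a x * u x) * indicator A x \<partial>\<mu>) * (\<integral>\<^sup>+y. ennreal (b y * v y) * indicator B y \<partial>\<nu>)"
proof -
  interpret m: real_distribution \<mu> by fact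
  interpret n: real_distribution \<nu> by fact
  note [measurable_cong] = real_distribution_sets_pair(1)[OF \<mu> \<nu>]
  have "(\<integral>\<^sup>+z. ennreal (w z) * (indicator A (fst z) * indicator B (snd z))
        \<partial>density (\<mu> \<Otimes>\<^sub>M \<nu>) (\<lambda>z. ennreal (a (fst z) * b (snd z) * k z))) =
      (\<integral>\<^sup>+z. ennreal (a (fst z) * b (snd z) * k z) * (ennreal (w z) * (indicator A (fst z) * indicator B (snd z))) \<partial>(\<mu> \<Otimes>\<^sub>M \<nu>))"
    by (subst nn_integral_density) auto
  also have "\<dots> = (\<integral>\<^sup>+z. (ennreal (a (fst z) * u (fst z)) * indicator A (fst z)) *
      (ennreal (b (snd z) * v (snd z)) * indicator B (snd z)) \<partial>(\<mu> \<Otimes>\<^sub>M \<nu>))"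
  proof (rule nn_integral_cong)
    fix z :: "real \<times> real"
    show "ennreal (a (fst z) * b (snd z) * k z) * (ennreal (w z) * (indicator A (fst z) * indicator B (snd z))) =
      ennreal (a (fst z) * u (fst z)) * indicator A (fst z) * (ennreal (b (snd z) * v (snd z)) * indicator B (snd z))"
    proof (cases "fst z \<in> A \<and> snd z \<in> B")
      case True
      have e: "k z * w z = u (fst z) * v (snd z)"
        using kw[of "fst z" "snd z"] True by simp
      have "a (fst z) * b (snd z) * k z * w z = a (fst z) * b (snd z) * (k z * w z)"
        by (simp only: mult.assoc)
      also have "\<dots> = (a (fst z) * u (fst z)) * (b (snd z) * v (snd z))"
        unfolding e by (simp only: ac_simps)
      finally have "a (fst z) * b (snd z) * k z * w z = (a (fst z) * u (fst z)) * (b (snd z) * v (snd z))" .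
      then show ?thesis
        using True nn by (simp flip: ennreal_mult)
    qed (auto simp: indicator_def)
  qed
  also have "\<dots> = (\<integral>\<^sup>+x. ennreal (a x * u x) * indicator A x \<partial>\<mu>) * (\<integral>\<^sup>+y. ennreal (b y * v y) * indicator B y \<partial>\<nu>)"
    by (rule nn_integral_pair_mult) (auto intro: n.sigma_finite_measure_axioms)
  finally show ?thesis .
qed

text \<open>A weak limit does not display its density. But the limit divided by the kernel inherits
  the four-rectangle identity in bounded boxes, so it is a product measure, and positivity of the
  kernel makes its factors absolutely continuous with respect to the marginals.\<close>

theorem eps_cyclically_invariant_exists:
  assumes \<mu>: "real_distribution \<mu>" and \<nu>: "real_distribution \<nu>" and \<epsilon>: "\<epsilon> > 0"
  shows "\<exists>\<pi>. eps_cyclically_invariant \<epsilon> \<mu> \<nu> \<pi>"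
proof -
  interpret m: real_distribution \<mu> by fact
  interpret n: real_distribution \<nu> by fact
  define K where "K = cost_kernel \<epsilon>"
  have [measurable]: "K \<in> borel_measurable (borel \<Otimes>\<^sub>M borel)" by (simp add: K_def)
  have Kpos: "0 < K z" "K z \<le> 1" "0 \<le> K z" "K z \<noteq> 0" for z
    using \<epsilon> cost_kernel_pos(1)[of \<epsilon> z] by (auto simp: K_def cost_kernel_def less_imp_le)
  define k where "k n x y = max (K (x, y)) (1 / real (Suc n))" for n x y
  have "bounded_kernel \<nu> (k n) (1 / real (Suc n))" for n
  proof unfold_locales
    have "(\<lambda>z. max (K z) (1 / real (Suc n))) \<in> borel_measurable (borel \<Otimes>\<^sub>M borel)" by measurable
    then show "case_prod (k n) \<in> borel_measurable (borel \<Otimes>\<^sub>M borel)"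
      by (simp add: k_def split_beta')
  qed (simp_all add: k_def Kpos)
  from bounded_kernel_plan[OF this \<mu>]
  have "\<forall>n. \<exists>a b. a \<in> borel_measurable borel \<and> b \<in> borel_measurable borel \<and> (\<forall>x. 0 \<le> a x) \<and> (\<forall>y. 0 \<le> b y) \<and>
    density (\<mu> \<Otimes>\<^sub>M \<nu>) (\<lambda>z. ennreal (a (fst z) * b (snd z) * k n (fst z) (snd z))) \<in> Marg \<mu> \<nu>"
    by blast
  from choice[OF this] obtain a where "\<forall>n. \<exists>b. a n \<in> borel_measurable borel \<and> b \<in> borel_measurable borel \<and>
      (\<forall>x. 0 \<le> a n x) \<and> (\<forall>y. 0 \<le> b y) \<and>
    density (\<mu> \<Otimes>\<^sub>M \<nu>) (\<lambda>z. ennreal (a n (fst z) * b (snd z) * k n (fst z) (snd z))) \<in> Marg \<mu> \<nu>"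
    by blast
  from choice[OF this] obtain b where ab_all: "\<forall>n. a n \<in> borel_measurable borel \<and> b n \<in> borel_measurable borel \<and>
      (\<forall>x. 0 \<le> a n x) \<and> (\<forall>y. 0 \<le> b n y) \<and>
    density (\<mu> \<Otimes>\<^sub>M \<nu>) (\<lambda>z. ennreal (a n (fst z) * b n (snd z) * k n (fst z) (snd z))) \<in> Marg \<mu> \<nu>"
    by blast
  have ab [measurable]: "a n \<in> borel_measurable borel" "b n \<in> borel_measurable borel"
    and ab0: "0 \<le> a n x" "0 \<le> b n x"
    and abM: "density (\<mu> \<Otimes>\<^sub>M \<nu>) (\<lambda>z. ennreal (a n (fst z) * b n (snd z) * k n (fst z) (snd z))) \<in> Marg \<mu> \<nu>"
    for n x
    using ab_all by auto
  define \<pi> where "\<pi> n = density (\<mu> \<Otimes>\<^sub>M \<nu>) (\<lambda>z. ennreal (a n (fst z) * b n (snd z) * k n (fst z) (snd z)))" for n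
  have M: "\<pi> n \<in> Marg \<mu> \<nu>" for n using abM by (simp add: \<pi>_def)
  from Marg_sequentially_compact[OF \<mu> \<nu>, of \<pi>, OF M] obtain r \<sigma> where "strict_mono r \<and> \<sigma> \<in> Marg \<mu> \<nu> \<and>
    (\<forall>f :: real \<times> real \<Rightarrow> real. continuous_on UNIV f \<longrightarrow> bounded (range f) \<longrightarrow>
        (\<lambda>n. integral\<^sup>L (\<pi> (r n)) f) \<longlonglongrightarrow> integral\<^sup>L \<sigma> f)"
    by (elim exE)
  then have r: "strict_mono r" and \<sigma>: "\<sigma> \<in> Marg \<mu> \<nu>" and
    conv: "\<And>f :: real \<times> real \<Rightarrow> real. continuous_on UNIV f \<Longrightarrow> bounded (range f) \<Longrightarrow>
        (\<lambda>n. integral\<^sup>L (\<pi> (r n)) f) \<longlonglongrightarrow> integral\<^sup>L \<sigma> f"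
    by simp_all
  note S = MargD[OF \<sigma>]
  interpret S: finite_measure \<sigma> by fact
  have [measurable_cong]: "sets \<sigma> = sets (borel \<Otimes>\<^sub>M borel)" by (subst borel_prod) (rule S(2))
  define \<tau> where "\<tau> = density \<sigma> (\<lambda>z. ennreal (1 / K z))"
  have \<tau>s: "sets \<tau> = sets borel" by (simp add: \<tau>_def S(2))
  define I where "I m = {-real m..real m}" for m :: nat
  have [measurable]: "I m \<in> sets borel" for m by (simp add: I_def)
  \<comment> \<open>The reciprocal of the kernel is unbounded on the plane. On the box
    \<open>I m \<times> I m\<close> the coordinates differ by at most \<open>2 * m\<close>, so
    truncation at \<open>exp (2 * m / \<epsilon>)\<close> changes nothing there and yields a bounded
    continuous weight.\<close>
  define w where "w m z = min (1 / K z) (exp (2 * real m / \<epsilon>))" for m :: nat and z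
  have w0: "0 \<le> w m z" for m z using Kpos[of z] by (simp add: w_def)
  have wm [measurable]: "w m \<in> borel_measurable (borel \<Otimes>\<^sub>M borel)" for m unfolding w_def by measurable
  have wc: "continuous_on UNIV (w m)" for m
    unfolding w_def K_def using Kpos(4) by (intro continuous_intros cost_kernel_continuous) (auto simp: K_def)
  have wb: "\<bar>w m z\<bar> \<le> exp (2 * real m / \<epsilon>)" for m z
    using w0[of m z] by (simp add: w_def)
  have Kbox: "1 / K (x, y) \<le> exp (2 * real m / \<epsilon>)" if "x \<in> I m" "y \<in> I m" for x y m
  proof -
    have "\<bar>y - x\<bar> / \<epsilon> \<le> 2 * real m / \<epsilon>"
      using that \<epsilon> by (intro divide_right_mono) (auto simp: I_def)
    then show ?thesis by (simp add: K_def cost_kernel_def exp_minus inverse_eq_divide)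
  qed
  have wbox: "w m (x, y) = 1 / K (x, y)" if "x \<in> I m" "y \<in> I m" for x y m
    using Kbox[OF that] by (simp add: w_def)
  define T where "T m A B \<rho> = (\<integral>z. indicator A (fst z) * indicator B (snd z) * w m z \<partial>\<rho>)" for m A B \<rho>
  have Tnn: "ennreal (T m A B \<rho>) = (\<integral>\<^sup>+z. ennreal (w m z) * (indicator A (fst z) * indicator B (snd z)) \<partial>\<rho>)"
    and T0: "0 \<le> T m A B \<rho>"
    if \<rho>: "\<rho> \<in> Marg \<mu> \<nu>" and [measurable]: "A \<in> sets borel" "B \<in> sets borel" for m A B \<rho>
  proof -
    interpret R: finite_measure \<rho> using MargD(1)[OF \<rho>] .
    have [measurable_cong]: "sets \<rho> = sets (borel \<Otimes>\<^sub>M borel)" by (subst borel_prod) (rule MargD(2)[OF \<rho>])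
    have "integrable \<rho> (\<lambda>z. indicator A (fst z) * indicator B (snd z) * w m z)"
      by (rule R.integrable_const_bound[of _ "exp (2 * real m / \<epsilon>)"])
        (use wb in \<open>auto intro!: AE_I2 simp: indicator_def\<close>)
    then have "ennreal (T m A B \<rho>) = (\<integral>\<^sup>+z. ennreal (indicator A (fst z) * indicator B (snd z) * w m z) \<partial>\<rho>)"
      unfolding T_def using w0 by (intro nn_integral_eq_integral[symmetric]) auto
    also have "\<dots> = (\<integral>\<^sup>+z. ennreal (w m z) * (indicator A (fst z) * indicator B (snd z)) \<partial>\<rho>)"
      by (intro nn_integral_cong) (auto simp: indicator_def)
    finally show "ennreal (T m A B \<rho>) = (\<integral>\<^sup>+z. ennreal (w m z) * (indicator A (fst z) * indicator B (snd z)) \<partial>\<rho>)" .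
    show "0 \<le> T m A B \<rho>" unfolding T_def using w0 by (intro integral_nonneg_AE) auto
  qed
  have Tlim: "(\<lambda>n. T m A B (\<pi> (r n))) \<longlonglongrightarrow> T m A B \<sigma>"
    if "A \<in> sets borel" "B \<in> sets borel" for m A B
    unfolding T_def
    by (rule Marg_weak_conv_imp_rectangle_conv[OF M \<sigma> \<mu> \<nu> conv wc _ that])
      (use wb in \<open>auto simp: bounded_iff\<close>)
  have Tn: "\<exists>N. \<forall>n\<ge>N. T m A B (\<pi> (r n)) * T m A' B' (\<pi> (r n)) = T m A B' (\<pi> (r n)) * T m A' B (\<pi> (r n))"
    if [measurable]: "A \<in> sets borel" "A' \<in> sets borel" "B \<in> sets borel" "B' \<in> sets borel"
      and sub: "A \<union> A' \<union> B \<union> B' \<subseteq> I m" for m A A' B B'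
  proof -
    \<comment> \<open>From \<open>N\<close> on, the truncation level of the kernel lies below its
      smallest value on the box, so \<open>k (r n)\<close> is the kernel itself there.\<close>
    obtain N :: nat where N: "exp (2 * real m / \<epsilon>) \<le> real N" using real_arch_simple by blast
    have "T m A B (\<pi> (r n)) * T m A' B' (\<pi> (r n)) = T m A B' (\<pi> (r n)) * T m A' B (\<pi> (r n))" if "n \<ge> N" for n
    proof -
      have rn: "N \<le> r n" using that seq_suble[OF r, of n] by simp
      have kK: "k (r n) x y = K (x, y)" if "x \<in> I m" "y \<in> I m" for x y
      proof -
        have "1 / K (x, y) \<le> real (Suc (r n))" using Kbox[OF that] N rn by linarith
        then show ?thesis using Kpos(1)[of "(x, y)"] by (simp add: k_def field_simps)
      qed
      define f g where "f A = (\<integral>\<^sup>+x. ennreal (a (r n) x * 1) * indicator A x \<partial>\<mu>)"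
        and "g B = (\<integral>\<^sup>+y. ennreal (b (r n) y * 1) * indicator B y \<partial>\<nu>)" for A B
      have fg: "ennreal (T m A B (\<pi> (r n))) = f A * g B"
        if [measurable]: "A \<in> sets borel" "B \<in> sets borel" and "A \<subseteq> I m" "B \<subseteq> I m" for A B
        unfolding Tnn[OF M that(1,2)] unfolding f_def g_def \<pi>_def
      proof (rule nn_integral_factored_density[OF \<mu> \<nu>])
        show "(\<lambda>z. k (r n) (fst z) (snd z)) \<in> borel_measurable (borel \<Otimes>\<^sub>M borel)"
          unfolding k_def by simp
        fix x y assume "x \<in> A" "y \<in> B"
        then have "x \<in> I m" "y \<in> I m" using that by auto
        then show "k (r n) (fst (x, y)) (snd (x, y)) * w m (x, y) = 1 * 1"
          using kK wbox Kpos(4)[of "(x, y)"] by simp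
      qed (auto simp: ab0 w0 k_def le_max_iff_disj Kpos)
      have "ennreal (T m A B (\<pi> (r n)) * T m A' B' (\<pi> (r n))) = ennreal (T m A B' (\<pi> (r n)) * T m A' B (\<pi> (r n)))"
        using sub by (simp add: ennreal_mult T0[OF M] fg ac_simps)
      then show ?thesis by (simp add: T0[OF M])
    qed
    then show ?thesis by blast
  qed
  have Tprod: "T m A B \<sigma> * T m A' B' \<sigma> = T m A B' \<sigma> * T m A' B \<sigma>"
    if A: "A \<in> sets borel" "A' \<in> sets borel" "B \<in> sets borel" "B' \<in> sets borel"
      and sub: "A \<union> A' \<union> B \<union> B' \<subseteq> I m" for m A A' B B'
  proof (rule LIMSEQ_unique)
    show "(\<lambda>n. T m A B (\<pi> (r n)) * T m A' B' (\<pi> (r n))) \<longlonglongrightarrow> T m A B \<sigma> * T m A' B' \<sigma>"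
      by (intro tendsto_mult Tlim A)
    have "(\<lambda>n. T m A B' (\<pi> (r n)) * T m A' B (\<pi> (r n))) \<longlonglongrightarrow> T m A B' \<sigma> * T m A' B \<sigma>"
      by (intro tendsto_mult Tlim A)
    moreover have "eventually (\<lambda>n. T m A B (\<pi> (r n)) * T m A' B' (\<pi> (r n)) = T m A B' (\<pi> (r n)) * T m A' B (\<pi> (r n))) sequentially"
      using Tn[OF A sub] by (auto simp: eventually_sequentially)
    ultimately show "(\<lambda>n. T m A B (\<pi> (r n)) * T m A' B' (\<pi> (r n))) \<longlonglongrightarrow> T m A B' \<sigma> * T m A' B \<sigma>"
      by (simp cong: filterlim_cong)
  qed
  have \<tau>T: "emeasure \<tau> (A \<times> B) = ennreal (T m A B \<sigma>)"
    if [measurable]: "A \<in> sets borel" "B \<in> sets borel" and sub: "A \<subseteq> I m" "B \<subseteq> I m" for m A B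
  proof -
    have "emeasure \<tau> (A \<times> B) = (\<integral>\<^sup>+z. ennreal (1 / K z) * indicator (A \<times> B) z \<partial>\<sigma>)"
      unfolding \<tau>_def by (subst emeasure_density) auto
    also have "\<dots> = (\<integral>\<^sup>+z. ennreal (w m z) * (indicator A (fst z) * indicator B (snd z)) \<partial>\<sigma>)"
      using sub wbox[of "fst z" m "snd z" for z] by (intro nn_integral_cong) (auto simp: indicator_def wbox subset_iff)
    finally show ?thesis by (simp add: Tnn[OF \<sigma>])
  qed
  have "emeasure \<sigma> UNIV = 1"
  proof -
    have "emeasure \<mu> (space borel) = emeasure \<sigma> (fst -` space borel \<inter> space \<sigma>)"
      by (subst S(4)[symmetric], rule emeasure_distr) auto
    then show ?thesis using m.emeasure_space_1 by (simp add: S(3))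
  qed
  have \<sigma>\<tau>: "\<sigma> = density \<tau> (\<lambda>z. ennreal (K z))"
  proof -
    have "density \<tau> (\<lambda>z. ennreal (K z)) = density \<sigma> (\<lambda>z. ennreal (1 / K z) * ennreal (K z))"
      unfolding \<tau>_def by (subst density_density_eq) auto
    also have "\<dots> = density \<sigma> (\<lambda>_. 1)"
      using Kpos by (intro density_cong AE_I2) (auto simp flip: ennreal_mult)
    finally show ?thesis by (simp add: density_1)
  qed
  have \<tau>pos: "emeasure \<tau> UNIV > 0"
  proof -
    have "(\<integral>\<^sup>+z. 1 \<partial>\<sigma>) \<le> (\<integral>\<^sup>+z. ennreal (1 / K z) \<partial>\<sigma>)"
      using Kpos(1,2) by (intro nn_integral_mono) auto
    also have "\<dots> = emeasure \<tau> UNIV"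
      unfolding \<tau>_def using S(2) by (subst emeasure_density) auto
    finally have "1 \<le> emeasure \<tau> UNIV" using \<open>emeasure \<sigma> UNIV = 1\<close> by (simp add: S(3))
    then show ?thesis by (rule less_le_trans[rotated]) simp
  qed
  obtain \<alpha> \<beta> :: "real measure" where s: "sets \<alpha> = sets borel" "sets \<beta> = sets borel"
    and sf: "sigma_finite_measure \<alpha>" "sigma_finite_measure \<beta>" and \<tau>p: "\<tau> = \<alpha> \<Otimes>\<^sub>M \<beta>"
  proof (rule product_structure_bounded[OF \<tau>s _ _ \<tau>pos])
    show "emeasure \<tau> ({-real m..real m} \<times> {-real m..real m}) < \<infinity>" for m
      using \<tau>T[of "I m" "I m" m] by (simp add: I_def)
    show "emeasure \<tau> (A \<times> B) * emeasure \<tau> (A' \<times> B') = emeasure \<tau> (A \<times> B') * emeasure \<tau> (A' \<times> B)"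
      if "A \<in> sets borel" "A' \<in> sets borel" "B \<in> sets borel" "B' \<in> sets borel"
        "A \<union> A' \<union> B \<union> B' \<subseteq> {-real m..real m}" for m A A' B B'
      using that \<tau>T[of _ _ m] Tprod[OF that[folded I_def]] by (simp add: I_def T0[OF \<sigma>] flip: ennreal_mult)
  qed
  note [measurable_cong] = s
  have \<sigma>d: "\<sigma> = density (\<alpha> \<Otimes>\<^sub>M \<beta>) (\<lambda>z. ennreal (K z))" using \<sigma>\<tau> \<tau>p by simp
  have one: "emeasure \<mu> UNIV > 0" "emeasure \<nu> UNIV > 0"
    using m.emeasure_space_1 n.emeasure_space_1 by auto
  obtain a' where a': "a' \<in> borel_measurable borel" "\<And>x. 0 \<le> a' x" "\<alpha> = density \<mu> (\<lambda>x. ennreal (a' x))"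
    using marginal_of_product_density[OF s sf, of "\<lambda>z. ennreal (K z)" \<mu>] Kpos one m.finite_measure_axioms
      S(4)[unfolded \<sigma>d] by auto
  \<comment> \<open>Exchange of the coordinates, so that the statement about first marginals also
    yields the density of \<open>\<beta>\<close>.\<close>
  have fl: "distr (density (\<beta> \<Otimes>\<^sub>M \<alpha>) (\<lambda>z. ennreal (K (snd z, fst z)))) borel fst = \<nu>"
  proof -
    interpret A: sigma_finite_measure \<alpha> by fact
    interpret B: sigma_finite_measure \<beta> by fact
    interpret P: pair_sigma_finite \<alpha> \<beta> ..
    interpret Q: pair_sigma_finite \<beta> \<alpha> ..
    have "\<beta> \<Otimes>\<^sub>M \<alpha> = distr (\<alpha> \<Otimes>\<^sub>M \<beta>) (\<beta> \<Otimes>\<^sub>M \<alpha>) (\<lambda>(x, y). (y, x))" by (rule Q.distr_pair_swap)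
    then have "density (\<beta> \<Otimes>\<^sub>M \<alpha>) (\<lambda>z. ennreal (K (snd z, fst z))) =
        density (distr (\<alpha> \<Otimes>\<^sub>M \<beta>) (\<beta> \<Otimes>\<^sub>M \<alpha>) (\<lambda>(x, y). (y, x))) (\<lambda>z. ennreal (K (snd z, fst z)))"
      by simp
    also have "\<dots> = distr \<sigma> (\<beta> \<Otimes>\<^sub>M \<alpha>) (\<lambda>(x, y). (y, x))"
      unfolding \<sigma>d by (subst density_distr) (auto simp: split_beta split_beta')
    finally have "distr (density (\<beta> \<Otimes>\<^sub>M \<alpha>) (\<lambda>z. ennreal (K (snd z, fst z)))) borel fst =
        distr (distr \<sigma> (\<beta> \<Otimes>\<^sub>M \<alpha>) (\<lambda>(x, y). (y, x))) borel fst"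
      by simp
    also have "\<dots> = distr \<sigma> borel snd"
      by (subst distr_distr) (auto simp: comp_def split_beta')
    finally show ?thesis by (simp add: S(5))
  qed
  obtain b' where b': "b' \<in> borel_measurable borel" "\<And>x. 0 \<le> b' x" "\<beta> = density \<nu> (\<lambda>x. ennreal (b' x))"
    using marginal_of_product_density[OF s(2,1) sf(2,1), of "\<lambda>z. ennreal (K (snd z, fst z))" \<nu>] Kpos one n.finite_measure_axioms
      fl by auto
  have [measurable]: "a' \<in> borel_measurable borel" "b' \<in> borel_measurable borel" by fact+
  note [measurable_cong] = real_distribution_sets_pair(1)[OF \<mu> \<nu>]
  have "\<alpha> \<Otimes>\<^sub>M \<beta> = density (\<mu> \<Otimes>\<^sub>M \<nu>) (\<lambda>z. ennreal (a' (fst z) * b' (snd z)))"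
    unfolding a'(3) b'(3) using sf(2)[unfolded b'(3)] a'(2) b'(2) n.sigma_finite_measure_axioms
    by (subst pair_measure_density) (auto simp: split_beta' ennreal_mult)
  then have "\<sigma> = density (\<mu> \<Otimes>\<^sub>M \<nu>) (\<lambda>z. ennreal (a' (fst z) * b' (snd z) * cost_kernel \<epsilon> z))"
    unfolding \<sigma>d using a'(2) b'(2) Kpos
    by (simp add: density_density_eq K_def flip: ennreal_mult)
  then show ?thesis
    using factored_imp_eps_cyclically_invariant[OF \<mu> \<nu> \<sigma> a'(1) b'(1) a'(2) b'(2)] by blast
qed

lemma entropic_plan_factored:
  assumes \<mu>: "real_distribution \<mu>" and \<nu>: "real_distribution \<nu>" and \<epsilon>: "\<epsilon> > 0"
  shows "entropic_plan \<epsilon> \<mu> \<nu> \<in> Marg \<mu> \<nu>"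
    and "\<exists>a b :: real \<Rightarrow> real. a \<in> borel_measurable borel \<and> b \<in> borel_measurable borel \<and>
    (\<forall>x. a x \<ge> 0) \<and> (\<forall>y. b y \<ge> 0) \<and>
    entropic_plan \<epsilon> \<mu> \<nu> = density (\<mu> \<Otimes>\<^sub>M \<nu>) (\<lambda>z. ennreal (a (fst z) * b (snd z) * cost_kernel \<epsilon> z))"
proof -
  have "eps_cyclically_invariant \<epsilon> \<mu> \<nu> (entropic_plan \<epsilon> \<mu> \<nu>)"
    unfolding entropic_plan_def
    using eps_cyclically_invariant_exists[OF \<mu> \<nu> \<epsilon>] eps_cyclically_invariant_unique[OF \<mu> \<nu>]
    by (metis theI)
  then show "entropic_plan \<epsilon> \<mu> \<nu> \<in> Marg \<mu> \<nu>"
    and "\<exists>a b :: real \<Rightarrow> real. a \<in> borel_measurable borel \<and> b \<in> borel_measurable borel \<and>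
    (\<forall>x. a x \<ge> 0) \<and> (\<forall>y. b y \<ge> 0) \<and>
    entropic_plan \<epsilon> \<mu> \<nu> = density (\<mu> \<Otimes>\<^sub>M \<nu>) (\<lambda>z. ennreal (a (fst z) * b (snd z) * cost_kernel \<epsilon> z))"
    using eps_cyclically_invariant_imp_factored[OF \<mu> \<nu>] by (simp_all add: eps_cyclically_invariant_def)
qed

section \<open>Limits of entropic plans\<close>

lemma Times_borel [measurable]:
  fixes A B :: "real set"
  assumes "A \<in> sets borel" "B \<in> sets borel"
  shows "A \<times> B \<in> sets borel"
  using assms by (subst borel_prod[symmetric]) auto

lemma Marg_measure_fst:
  assumes "\<pi> \<in> Marg \<mu> \<nu>" "A \<in> sets borel"
  shows "measure \<pi> (A \<times> UNIV) = measure \<mu> A" "emeasure \<pi> (A \<times> UNIV) = emeasure \<mu> A"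
proof -
  note M = MargD[OF assms(1)]
  have [measurable_cong]: "sets \<pi> = sets (borel \<Otimes>\<^sub>M borel)" by (subst borel_prod) (rule M(2))
  have *: "fst -` A \<inter> space \<pi> = A \<times> UNIV" by (auto simp: M(3))
  show "measure \<pi> (A \<times> UNIV) = measure \<mu> A" "emeasure \<pi> (A \<times> UNIV) = emeasure \<mu> A"
    unfolding M(4)[symmetric] *[symmetric] using assms(2)
    by (subst measure_distr emeasure_distr; simp)+
qed

lemma Marg_measure_snd:
  assumes "\<pi> \<in> Marg \<mu> \<nu>" "B \<in> sets borel"
  shows "measure \<pi> (UNIV \<times> B) = measure \<nu> B" "emeasure \<pi> (UNIV \<times> B) = emeasure \<nu> B"
proof -
  note M = MargD[OF assms(1)]
  have [measurable_cong]: "sets \<pi> = sets (borel \<Otimes>\<^sub>M borel)" by (subst borel_prod) (rule M(2))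
  have *: "snd -` B \<inter> space \<pi> = UNIV \<times> B" by (auto simp: M(3))
  show "measure \<pi> (UNIV \<times> B) = measure \<nu> B" "emeasure \<pi> (UNIV \<times> B) = emeasure \<nu> B"
    unfolding M(5)[symmetric] *[symmetric] using assms(2)
    by (subst measure_distr emeasure_distr; simp)+
qed

lemma Marg_measure_le_1:
  assumes "\<pi> \<in> Marg \<mu> \<nu>" "real_distribution \<mu>"
  shows "measure \<pi> X \<le> 1" "emeasure \<pi> X \<le> 1"
proof -
  interpret m: real_distribution \<mu> by fact
  interpret finite_measure \<pi> using MargD(1)[OF assms(1)] .
  have 1: "emeasure \<pi> UNIV = 1"
    using Marg_measure_fst(2)[OF assms(1), of UNIV] m.emeasure_space_1 by simp
  show 2: "emeasure \<pi> X \<le> 1"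
    using emeasure_space[of \<pi> X] 1 MargD(3)[OF assms(1)] by simp
  then show "measure \<pi> X \<le> 1" by (simp add: emeasure_eq_measure)
qed

text \<open>For x \<le> y the kernel is
  \<open>exp (x / \<epsilon>) * exp (- y / \<epsilon>)\<close>, whence the products on quadrants.
  For the crossing bound the four factors are regrouped: \<open>F\<close> and \<open>G\<close> over
  the same half-line, \<open>{..s}\<close> or \<open>{t..}\<close>, combine to an integral against
  the plan itself, whose mass is 1.\<close>

lemma entropic_plan_products:
  assumes \<mu>: "real_distribution \<mu>" and \<nu>: "real_distribution \<nu>" and \<epsilon>: "\<epsilon> > 0"
  defines "\<pi> \<equiv> entropic_plan \<epsilon> \<mu> \<nu>"
  shows
    "\<And>t A A' B B'. A \<in> sets borel \<Longrightarrow> A' \<in> sets borel \<Longrightarrow> B \<in> sets borel \<Longrightarrow> B' \<in> sets borel \<Longrightarrow>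
        A \<union> A' \<subseteq> {..t} \<Longrightarrow> B \<union> B' \<subseteq> {t..} \<Longrightarrow>
        measure \<pi> (A \<times> B) * measure \<pi> (A' \<times> B') = measure \<pi> (A \<times> B') * measure \<pi> (A' \<times> B)" (is "\<And>t A A' B B'. PROP ?P1 t A A' B B'")
    and "\<And>t A A' B B'. A \<in> sets borel \<Longrightarrow> A' \<in> sets borel \<Longrightarrow> B \<in> sets borel \<Longrightarrow> B' \<in> sets borel \<Longrightarrow>
        A \<union> A' \<subseteq> {t..} \<Longrightarrow> B \<union> B' \<subseteq> {..t} \<Longrightarrow>
        measure \<pi> (A \<times> B) * measure \<pi> (A' \<times> B') = measure \<pi> (A \<times> B') * measure \<pi> (A' \<times> B)" (is "\<And>t A A' B B'. PROP ?P2 t A A' B B'")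
    and "\<And>s t. s < t \<Longrightarrow> measure \<pi> ({..s} \<times> {t..}) * measure \<pi> ({t..} \<times> {..s}) \<le> exp (- (2 * (t - s)) / \<epsilon>)" (is "\<And>s t. PROP ?P3 s t")
proof -
  have M: "\<pi> \<in> Marg \<mu> \<nu>" unfolding \<pi>_def by (rule entropic_plan_factored(1)[OF \<mu> \<nu> \<epsilon>])
  obtain a b :: "real \<Rightarrow> real" where ab [measurable]: "a \<in> borel_measurable borel" "b \<in> borel_measurable borel"
    and ab0: "\<And>x. a x \<ge> 0" "\<And>y. b y \<ge> 0"
    and \<pi>: "\<pi> = density (\<mu> \<Otimes>\<^sub>M \<nu>) (\<lambda>z. ennreal (a (fst z) * b (snd z) * cost_kernel \<epsilon> z))"
    using entropic_plan_factored(2)[OF \<mu> \<nu> \<epsilon>] unfolding \<pi>_def by blast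
  interpret finite_measure \<pi> using MargD(1)[OF M] .
  have [measurable_cong]: "sets \<pi> = sets (borel \<Otimes>\<^sub>M borel)" by (subst borel_prod) (rule MargD(2)[OF M])
  note factored = nn_integral_factored_density[OF \<mu> \<nu> ab measurable_cost_kernel, of _ _ _ _ _ \<epsilon>, folded \<pi>]
  have em: "(\<integral>\<^sup>+z. ennreal 1 * (indicator A (fst z) * indicator B (snd z)) \<partial>\<pi>) = emeasure \<pi> (A \<times> B)"
    if [measurable]: "A \<in> sets borel" "B \<in> sets borel" for A B
  proof -
    have "(\<integral>\<^sup>+z. ennreal 1 * (indicator A (fst z) * indicator B (snd z)) \<partial>\<pi>) = (\<integral>\<^sup>+z. indicator (A \<times> B) z \<partial>\<pi>)"
      by (intro nn_integral_cong) (auto simp: indicator_def)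
    then show ?thesis by (subst (asm) nn_integral_indicator) auto
  qed
  define F where "F c A = (\<integral>\<^sup>+x. ennreal (a x * exp (c * x / \<epsilon>)) * indicator A x \<partial>\<mu>)" for c A
  define G where "G c B = (\<integral>\<^sup>+y. ennreal (b y * exp (c * y / \<epsilon>)) * indicator B y \<partial>\<nu>)" for c B
  have up: "emeasure \<pi> (A \<times> B) = F 1 A * G (-1) B"
    if [measurable]: "A \<in> sets borel" "B \<in> sets borel" and "A \<subseteq> {..t}" "B \<subseteq> {t..}" for A B t
    unfolding em[symmetric, OF that(1,2)] F_def G_def
  proof (rule factored)
    fix x y assume "x \<in> A" "y \<in> B"
    then have "x \<le> y" using that(3,4) by fastforce
    then show "cost_kernel \<epsilon> (x, y) * 1 = exp (1 * x / \<epsilon>) * exp (- 1 * y / \<epsilon>)"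
      by (simp add: cost_kernel_def flip: exp_add) (simp add: diff_divide_distrib)
  qed (auto simp: ab0)
  have down: "emeasure \<pi> (A \<times> B) = F (-1) A * G 1 B"
    if [measurable]: "A \<in> sets borel" "B \<in> sets borel" and "A \<subseteq> {t..}" "B \<subseteq> {..t}" for A B t
    unfolding em[symmetric, OF that(1,2)] F_def G_def
  proof (rule factored)
    fix x y assume "x \<in> A" "y \<in> B"
    then have "y \<le> x" using that(3,4) by fastforce
    then show "cost_kernel \<epsilon> (x, y) * 1 = exp (- 1 * x / \<epsilon>) * exp (1 * y / \<epsilon>)"
      by (simp add: cost_kernel_def flip: exp_add) (simp add: diff_divide_distrib)
  qed (auto simp: ab0)
  show "PROP ?P1 t A A' B B'" for t A A' B B'
  proof -
    assume *: "A \<in> sets borel" "A' \<in> sets borel" "B \<in> sets borel" "B' \<in> sets borel"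
      "A \<union> A' \<subseteq> {..t}" "B \<union> B' \<subseteq> {t..}"
    have "ennreal (measure \<pi> (A \<times> B) * measure \<pi> (A' \<times> B')) = ennreal (measure \<pi> (A \<times> B') * measure \<pi> (A' \<times> B))"
      using * up[of _ _ t] by (simp add: ennreal_mult ac_simps flip: emeasure_eq_measure)
    then show "measure \<pi> (A \<times> B) * measure \<pi> (A' \<times> B') = measure \<pi> (A \<times> B') * measure \<pi> (A' \<times> B)" by simp
  qed
  show "PROP ?P2 t A A' B B'" for t A A' B B'
  proof -
    assume *: "A \<in> sets borel" "A' \<in> sets borel" "B \<in> sets borel" "B' \<in> sets borel"
      "A \<union> A' \<subseteq> {t..}" "B \<union> B' \<subseteq> {..t}"
    have "ennreal (measure \<pi> (A \<times> B) * measure \<pi> (A' \<times> B')) = ennreal (measure \<pi> (A \<times> B') * measure \<pi> (A' \<times> B))"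
      using * down[of _ _ t] by (simp add: ennreal_mult ac_simps flip: emeasure_eq_measure)
    then show "measure \<pi> (A \<times> B) * measure \<pi> (A' \<times> B') = measure \<pi> (A \<times> B') * measure \<pi> (A' \<times> B)" by simp
  qed
  \<comment> \<open>The exponent \<open>c * x + c * y + \<bar>y - x\<bar>\<close> equals
    \<open>2 * max x y\<close> for \<open>c = 1\<close> and \<open>- 2 * min x y\<close> for
    \<open>c = -1\<close>; on \<open>{..s}\<close> and on \<open>{t..}\<close> it is thus at most
    \<open>2 * s\<close> and \<open>- 2 * t\<close>.\<close>
  have bnd: "F c S * G c S \<le> ennreal (exp (2 * c * t / \<epsilon>))"
    if [measurable]: "S \<in> sets borel" and S: "\<And>x y. x \<in> S \<Longrightarrow> y \<in> S \<Longrightarrow> c * x + c * y + \<bar>y - x\<bar> \<le> 2 * c * t" for c S t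
  proof -
    define w where "w z = exp ((c * fst z + c * snd z + \<bar>snd z - fst z\<bar>) / \<epsilon>)" for z :: "real \<times> real"
    have [measurable]: "w \<in> borel_measurable (borel \<Otimes>\<^sub>M borel)" unfolding w_def by measurable
    have "F c S * G c S = (\<integral>\<^sup>+z. ennreal (w z) * (indicator S (fst z) * indicator S (snd z)) \<partial>\<pi>)"
      unfolding F_def G_def
    proof (rule factored[symmetric])
      show "cost_kernel \<epsilon> (x, y) * w (x, y) = exp (c * x / \<epsilon>) * exp (c * y / \<epsilon>)" for x y
        by (simp add: cost_kernel_def w_def add_divide_distrib flip: exp_add)
    qed (auto simp: ab0 w_def)
    also have "\<dots> \<le> (\<integral>\<^sup>+z. ennreal (exp (2 * c * t / \<epsilon>)) \<partial>\<pi>)"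
    proof (rule nn_integral_mono)
      fix z :: "real \<times> real"
      have "w z \<le> exp (2 * c * t / \<epsilon>)" if "fst z \<in> S" "snd z \<in> S"
        using S[OF that] \<epsilon> by (simp add: w_def divide_right_mono)
      then show "ennreal (w z) * (indicator S (fst z) * indicator S (snd z)) \<le> ennreal (exp (2 * c * t / \<epsilon>))"
        by (auto simp: indicator_def)
    qed
    also have "\<dots> = ennreal (exp (2 * c * t / \<epsilon>)) * emeasure \<pi> (space \<pi>)" by simp
    also have "\<dots> \<le> ennreal (exp (2 * c * t / \<epsilon>)) * 1"
      by (intro mult_left_mono Marg_measure_le_1(2)[OF M \<mu>]) simp
    finally show ?thesis by simp
  qed
  show "PROP ?P3 s t" for s t
  proof -
    assume "s < t"
    have "ennreal (measure \<pi> ({..s} \<times> {t..}) * measure \<pi> ({t..} \<times> {..s})) =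
        emeasure \<pi> ({..s} \<times> {t..}) * emeasure \<pi> ({t..} \<times> {..s})"
      by (simp add: ennreal_mult emeasure_eq_measure)
    also have "\<dots> = (F 1 {..s} * G 1 {..s}) * (F (-1) {t..} * G (-1) {t..})"
      using up[of "{..s}" "{t..}" s] down[of "{t..}" "{..s}" s] \<open>s < t\<close> by (simp add: ac_simps)
    also have "\<dots> \<le> ennreal (exp (2 * 1 * s / \<epsilon>)) * ennreal (exp (2 * (-1) * t / \<epsilon>))"
      by (intro mult_mono bnd) auto
    also have "\<dots> = ennreal (exp (- (2 * (t - s)) / \<epsilon>))"
      by (simp flip: ennreal_mult exp_add) (simp add: diff_divide_distrib algebra_simps)
    finally show "measure \<pi> ({..s} \<times> {t..}) * measure \<pi> ({t..} \<times> {..s}) \<le> exp (- (2 * (t - s)) / \<epsilon>)"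
      by simp
  qed
qed

text \<open>All that is retained of the entropic plans: the identification of the limit rests on
  these properties and no longer involves \<epsilon>.\<close>

locale limit_plan =
  fixes \<mu> \<nu> :: "real measure" and \<pi> :: "(real \<times> real) measure"
  assumes \<mu>: "real_distribution \<mu>" and \<nu>: "real_distribution \<nu>" and M: "\<pi> \<in> Marg \<mu> \<nu>"
    and prod_right: "\<And>t A A' B B'. A \<in> sets borel \<Longrightarrow> A' \<in> sets borel \<Longrightarrow> B \<in> sets borel \<Longrightarrow> B' \<in> sets borel \<Longrightarrow>
        A \<union> A' \<subseteq> {..t} \<Longrightarrow> B \<union> B' \<subseteq> {t..} \<Longrightarrow>
        measure \<pi> (A \<times> B) * measure \<pi> (A' \<times> B') = measure \<pi> (A \<times> B') * measure \<pi> (A' \<times> B)"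
    and prod_left: "\<And>t A A' B B'. A \<in> sets borel \<Longrightarrow> A' \<in> sets borel \<Longrightarrow> B \<in> sets borel \<Longrightarrow> B' \<in> sets borel \<Longrightarrow>
        A \<union> A' \<subseteq> {t..} \<Longrightarrow> B \<union> B' \<subseteq> {..t} \<Longrightarrow>
        measure \<pi> (A \<times> B) * measure \<pi> (A' \<times> B') = measure \<pi> (A \<times> B') * measure \<pi> (A' \<times> B)"
    and no_crossing: "\<And>s t. s < t \<Longrightarrow> measure \<pi> ({..s} \<times> {t..}) * measure \<pi> ({t..} \<times> {..s}) = 0"

text \<open>The properties are relations between masses of rectangles, and these masses converge
  because the marginals are fixed.\<close>

lemma limit_of_entropic_plans:
  assumes \<mu>: "real_distribution \<mu>" and \<nu>: "real_distribution \<nu>"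
    and e: "\<And>n. e n > 0" "e \<longlonglongrightarrow> 0" and \<sigma>: "\<sigma> \<in> Marg \<mu> \<nu>"
    and conv: "\<And>f :: real \<times> real \<Rightarrow> real. continuous_on UNIV f \<Longrightarrow> bounded (range f) \<Longrightarrow>
        (\<lambda>n. integral\<^sup>L (entropic_plan (e n) \<mu> \<nu>) f) \<longlonglongrightarrow> integral\<^sup>L \<sigma> f"
  shows "limit_plan \<mu> \<nu> \<sigma>"
proof -
  let ?\<pi> = "\<lambda>n. entropic_plan (e n) \<mu> \<nu>"
  have M: "?\<pi> n \<in> Marg \<mu> \<nu>" for n by (rule entropic_plan_factored(1)[OF \<mu> \<nu> e(1)])
  have mi: "(\<integral>z. indicator A (fst z) * indicator B (snd z) * (1::real) \<partial>\<rho>) = measure \<rho> (A \<times> B)"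
    if "\<rho> \<in> Marg \<mu> \<nu>" "A \<in> sets borel" "B \<in> sets borel" for \<rho> A B
  proof -
    interpret finite_measure \<rho> using MargD(1)[OF that(1)] .
    have "(\<lambda>z. indicator A (fst z) * indicator B (snd z) * (1::real)) = indicator (A \<times> B)"
      by (auto simp: indicator_def fun_eq_iff)
    then show ?thesis using that MargD(2,3)[OF that(1)] by simp
  qed
  have lim: "(\<lambda>n. measure (?\<pi> n) (A \<times> B)) \<longlonglongrightarrow> measure \<sigma> (A \<times> B)"
    if "A \<in> sets borel" "B \<in> sets borel" for A B
    using Marg_weak_conv_imp_rectangle_conv[OF M \<sigma> \<mu> \<nu> conv, of "\<lambda>_. 1" A B] that
    by (simp only: mi[OF M that] mi[OF \<sigma> that]) (simp add: bounded_iff exI[of _ 1])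
  show ?thesis
  proof (rule limit_plan.intro)
    fix t and A A' B B' :: "real set"
    assume b: "A \<in> sets borel" "A' \<in> sets borel" "B \<in> sets borel" "B' \<in> sets borel"
    note l = tendsto_mult[OF lim lim]
    show "measure \<sigma> (A \<times> B) * measure \<sigma> (A' \<times> B') = measure \<sigma> (A \<times> B') * measure \<sigma> (A' \<times> B)"
      if "A \<union> A' \<subseteq> {..t}" "B \<union> B' \<subseteq> {t..}"
      using l[OF b(1,3) b(2,4)] l[OF b(1,4) b(2,3)]
      unfolding entropic_plan_products(1)[OF \<mu> \<nu> e(1) b that] by (rule LIMSEQ_unique)
    show "measure \<sigma> (A \<times> B) * measure \<sigma> (A' \<times> B') = measure \<sigma> (A \<times> B') * measure \<sigma> (A' \<times> B)"
      if "A \<union> A' \<subseteq> {t..}" "B \<union> B' \<subseteq> {..t}"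
      using l[OF b(1,3) b(2,4)] l[OF b(1,4) b(2,3)]
      unfolding entropic_plan_products(2)[OF \<mu> \<nu> e(1) b that] by (rule LIMSEQ_unique)
  next
    fix s t :: real assume st: "s < t"
    have "filterlim e (at_right 0) sequentially"
      using e by (intro tendsto_imp_filterlim_at_right) auto
    then have "filterlim (\<lambda>n. inverse (e n)) at_top sequentially"
      by (rule filterlim_compose[OF filterlim_inverse_at_top_right])
    then have "filterlim (\<lambda>n. (2 * (t - s)) * inverse (e n)) at_top sequentially"
      using st by (intro filterlim_tendsto_pos_mult_at_top[OF tendsto_const]) auto
    then have "(\<lambda>n. exp (- ((2 * (t - s)) * inverse (e n)))) \<longlonglongrightarrow> 0"
      by (intro filterlim_compose[OF exp_at_bot]) (simp add: filterlim_uminus_at_bot)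
    then have l0: "(\<lambda>n. exp (- (2 * (t - s)) / e n)) \<longlonglongrightarrow> 0" by (simp only: divide_inverse minus_mult_left)
    have "measure \<sigma> ({..s} \<times> {t..}) * measure \<sigma> ({t..} \<times> {..s}) \<le> 0"
    proof (rule LIMSEQ_le[OF _ l0])
      show "(\<lambda>n. measure (?\<pi> n) ({..s} \<times> {t..}) * measure (?\<pi> n) ({t..} \<times> {..s})) \<longlonglongrightarrow>
          measure \<sigma> ({..s} \<times> {t..}) * measure \<sigma> ({t..} \<times> {..s})"
        by (intro tendsto_mult lim) auto
    qed (use entropic_plan_products(3)[OF \<mu> \<nu> e(1) st] in blast)
    moreover have "0 \<le> measure \<sigma> ({..s} \<times> {t..}) * measure \<sigma> ({t..} \<times> {..s})" by simp
    ultimately show "measure \<sigma> ({..s} \<times> {t..}) * measure \<sigma> ({t..} \<times> {..s}) = 0" by linarith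
  qed (fact \<mu> \<nu> \<sigma>)+
qed

text \<open>Exchange of the coordinates turns \<open>E_minus\<close> into \<open>E_plus\<close>, so
  only mass that moves to the right needs a direct treatment.\<close>

lemma limit_plan_swap:
  assumes "limit_plan \<mu> \<nu> \<pi>"
  shows "limit_plan \<nu> \<mu> (distr \<pi> borel (\<lambda>(x, y). (y, x)))"
proof -
  interpret limit_plan \<mu> \<nu> \<pi> by fact
  interpret P: finite_measure \<pi> using MargD(1)[OF M] .
  have [measurable_cong]: "sets \<pi> = sets (borel \<Otimes>\<^sub>M borel)" by (subst borel_prod) (rule MargD(2)[OF M])
  have sw: "(\<lambda>(x, y). (y, x)) \<in> measurable \<pi> borel"
    unfolding borel_prod[symmetric] by measurable
  let ?s = "distr \<pi> borel (\<lambda>(x, y). (y, x))"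
  have ms: "measure ?s (A \<times> B) = measure \<pi> (B \<times> A)" if "A \<in> sets borel" "B \<in> sets borel" for A B
  proof -
    have "measure ?s (A \<times> B) = measure \<pi> ((\<lambda>(x, y). (y, x)) -` (A \<times> B) \<inter> space \<pi>)"
      using that by (intro measure_distr sw Times_borel)
    also have "(\<lambda>(x, y). (y, x)) -` (A \<times> B) \<inter> space \<pi> = B \<times> A" by (auto simp: MargD(3)[OF M])
    finally show ?thesis .
  qed
  have f: "(fst :: real \<times> real \<Rightarrow> real) \<in> measurable borel borel" "(snd :: real \<times> real \<Rightarrow> real) \<in> measurable borel borel"
    unfolding borel_prod[symmetric] by measurable
  show ?thesis
  proof (rule limit_plan.intro)
    show "?s \<in> Marg \<nu> \<mu>"
      unfolding Marg_def
    proof (intro CollectI conjI)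
      show "finite_measure ?s" by (rule P.finite_measure_distr[OF sw])
      show "distr ?s borel fst = \<nu>"
        using MargD(5)[OF M] by (subst distr_distr[OF f(1) sw]) (simp add: comp_def split_beta')
      show "distr ?s borel snd = \<mu>"
        using MargD(4)[OF M] by (subst distr_distr[OF f(2) sw]) (simp add: comp_def split_beta')
    qed simp
    fix t and A A' B B' :: "real set"
    assume b: "A \<in> sets borel" "A' \<in> sets borel" "B \<in> sets borel" "B' \<in> sets borel"
    show "measure ?s (A \<times> B) * measure ?s (A' \<times> B') = measure ?s (A \<times> B') * measure ?s (A' \<times> B)"
      if "A \<union> A' \<subseteq> {..t}" "B \<union> B' \<subseteq> {t..}"
      using prod_left[OF b(3,4,1,2) that(2,1)] by (simp add: ms b ac_simps)
    show "measure ?s (A \<times> B) * measure ?s (A' \<times> B') = measure ?s (A \<times> B') * measure ?s (A' \<times> B)"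
      if "A \<union> A' \<subseteq> {t..}" "B \<union> B' \<subseteq> {..t}"
      using prod_right[OF b(3,4,1,2) that(2,1)] by (simp add: ms b ac_simps)
  next
    show "measure ?s ({..s} \<times> {t..}) * measure ?s ({t..} \<times> {..s}) = 0" if "s < t" for s t
      using no_crossing[OF that] by (simp add: ms disj_commute)
  qed (fact \<mu> \<nu>)+
qed

context limit_plan
begin

sublocale P: finite_measure \<pi> using MargD(1)[OF M] .
sublocale m: real_distribution \<mu> by (rule \<mu>)
sublocale n: real_distribution \<nu> by (rule \<nu>)

lemma sets_\<pi>: "sets \<pi> = sets borel" and space_\<pi>: "space \<pi> = UNIV"
  using MargD[OF M] by auto

lemma sets_\<pi>_pair [measurable_cong]: "sets \<pi> = sets (borel \<Otimes>\<^sub>M borel)"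
  by (subst borel_prod) (rule sets_\<pi>)

lemma Times_sets [simp]: "A \<in> sets borel \<Longrightarrow> B \<in> sets borel \<Longrightarrow> A \<times> B \<in> sets \<pi>"
  by (simp add: sets_\<pi> Times_borel)

text \<open>The masses \<open>?p\<close> and \<open>?q\<close> that cross \<open>t\<close> to the
  right and to the left differ by \<open>cdf \<mu> t - cdf \<nu> t\<close>, and one of them
  vanishes; so \<open>?p\<close> is the positive part of the difference.\<close>

lemma measure_right:
  "measure \<pi> ({..t} \<times> {t<..}) = max 0 (cdf \<mu> t - cdf \<nu> t)"
proof -
  let ?p = "measure \<pi> ({..t} \<times> {t<..})" and ?q = "measure \<pi> ({t<..} \<times> {..t})"
  \<comment> \<open>\<open>no_crossing\<close> needs a gap of positive length, so
    \<open>{t<..}\<close> is exhausted by half-lines at distance \<open>1 / Suc n\<close> from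
    \<open>t\<close>.\<close>
  define A where "A n = {t + 1 / real (Suc n)..}" for n
  have AU: "(\<Union>n. A n) = {t<..}"
  proof (intro equalityI subsetI)
    fix x assume "x \<in> {t<..}"
    then obtain n where "1 / real (Suc n) < x - t" using nat_approx_posE[of "x - t"] by auto
    then show "x \<in> (\<Union>n. A n)" by (auto simp: A_def intro!: exI[of _ n])
  qed (auto simp: A_def intro: less_le_trans[rotated])
  have Ai: "incseq A"
    by (auto simp: incseq_def A_def frac_le intro: order_trans[rotated])
  have Am: "A n \<in> sets borel" for n by (simp add: A_def)
  have lim1: "(\<lambda>n. measure \<pi> ({..t} \<times> A n)) \<longlonglongrightarrow> measure \<pi> (\<Union>n. {..t} \<times> A n)"
    using Ai Am by (intro P.finite_Lim_measure_incseq) (auto simp: incseq_def)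
  have lim2: "(\<lambda>n. measure \<pi> (A n \<times> {..t})) \<longlonglongrightarrow> measure \<pi> (\<Union>n. A n \<times> {..t})"
    using Ai Am by (intro P.finite_Lim_measure_incseq) (auto simp: incseq_def)
  have U: "(\<Union>n. {..t} \<times> A n) = {..t} \<times> {t<..}" "(\<Union>n. A n \<times> {..t}) = {t<..} \<times> {..t}"
    using AU by auto
  have "(\<lambda>n. 0) \<longlonglongrightarrow> ?p * ?q"
    using tendsto_mult[OF lim1[unfolded U] lim2[unfolded U]]
    unfolding A_def by (subst (asm) no_crossing) auto
  then have pq: "?p * ?q = 0" by (simp add: LIMSEQ_const_iff)
  have "cdf \<mu> t = measure \<pi> ({..t} \<times> UNIV)"
    unfolding cdf_def by (rule Marg_measure_fst(1)[OF M, symmetric]) simp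
  also have "{..t} \<times> UNIV = ({..t} \<times> {..t}) \<union> ({..t} \<times> {t<..})" by auto
  also have "measure \<pi> \<dots> = measure \<pi> ({..t} \<times> {..t}) + ?p"
    by (rule P.finite_measure_Union) auto
  finally have 1: "cdf \<mu> t = measure \<pi> ({..t} \<times> {..t}) + ?p" .
  have "cdf \<nu> t = measure \<pi> (UNIV \<times> {..t})"
    unfolding cdf_def by (rule Marg_measure_snd(1)[OF M, symmetric]) simp
  also have "UNIV \<times> {..t} = ({..t} \<times> {..t}) \<union> ({t<..} \<times> {..t})" by auto
  also have "measure \<pi> \<dots> = measure \<pi> ({..t} \<times> {..t}) + ?q"
    by (rule P.finite_measure_Union) auto
  finally have 2: "cdf \<nu> t = measure \<pi> ({..t} \<times> {..t}) + ?q" .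
  have "0 \<le> ?p" "0 \<le> ?q" "?p = 0 \<or> ?q = 0" using pq by auto
  then show ?thesis using 1 2 by (auto simp: max_def intro: antisym)
qed

lemma measure_right_left:
  "measure \<pi> ({..<t} \<times> {t..}) = max 0 (cdf_left \<mu> t - cdf_left \<nu> t)"
proof -
  let ?p = "measure \<pi> ({..<t} \<times> {t..})" and ?q = "measure \<pi> ({t..} \<times> {..<t})"
  define A where "A n = {..t - 1 / real (Suc n)}" for n
  have AU: "(\<Union>n. A n) = {..<t}"
  proof (intro equalityI subsetI)
    fix x assume "x \<in> {..<t}"
    then obtain n where "1 / real (Suc n) < t - x" using nat_approx_posE[of "t - x"] by auto
    then show "x \<in> (\<Union>n. A n)" by (auto simp: A_def intro!: exI[of _ n])
  qed (auto simp: A_def intro: le_less_trans)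
  have Ai: "incseq A"
    by (auto simp: incseq_def A_def frac_le intro: order_trans)
  have Am: "A n \<in> sets borel" for n by (simp add: A_def)
  have lim1: "(\<lambda>n. measure \<pi> (A n \<times> {t..})) \<longlonglongrightarrow> measure \<pi> (\<Union>n. A n \<times> {t..})"
    using Ai Am by (intro P.finite_Lim_measure_incseq) (auto simp: incseq_def)
  have lim2: "(\<lambda>n. measure \<pi> ({t..} \<times> A n)) \<longlonglongrightarrow> measure \<pi> (\<Union>n. {t..} \<times> A n)"
    using Ai Am by (intro P.finite_Lim_measure_incseq) (auto simp: incseq_def)
  have U: "(\<Union>n. {t..} \<times> A n) = {t..} \<times> {..<t}" "(\<Union>n. A n \<times> {t..}) = {..<t} \<times> {t..}"
    using AU by auto
  have "(\<lambda>n. 0) \<longlonglongrightarrow> ?p * ?q"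
    using tendsto_mult[OF lim1[unfolded U] lim2[unfolded U]]
    unfolding A_def by (subst (asm) no_crossing) auto
  then have pq: "?p * ?q = 0" by (simp add: LIMSEQ_const_iff)
  have "cdf_left \<mu> t = measure \<pi> ({..<t} \<times> UNIV)"
    unfolding cdf_left_def by (rule Marg_measure_fst(1)[OF M, symmetric]) simp
  also have "{..<t} \<times> UNIV = ({..<t} \<times> {..<t}) \<union> ({..<t} \<times> {t..})" by auto
  also have "measure \<pi> \<dots> = measure \<pi> ({..<t} \<times> {..<t}) + ?p"
    by (rule P.finite_measure_Union) auto
  finally have 1: "cdf_left \<mu> t = measure \<pi> ({..<t} \<times> {..<t}) + ?p" .
  have "cdf_left \<nu> t = measure \<pi> (UNIV \<times> {..<t})"
    unfolding cdf_left_def by (rule Marg_measure_snd(1)[OF M, symmetric]) simp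
  also have "UNIV \<times> {..<t} = ({..<t} \<times> {..<t}) \<union> ({t..} \<times> {..<t})" by auto
  also have "measure \<pi> \<dots> = measure \<pi> ({..<t} \<times> {..<t}) + ?q"
    by (rule P.finite_measure_Union) auto
  finally have 2: "cdf_left \<nu> t = measure \<pi> ({..<t} \<times> {..<t}) + ?q" .
  have "0 \<le> ?p" "0 \<le> ?q" "?p = 0 \<or> ?q = 0" using pq by auto
  then show ?thesis using 1 2 by (auto simp: max_def intro: antisym)
qed

end

section \<open>Components of a limit plan\<close>

lemma E_minus_swap: "E_minus \<mu> \<nu> = E_plus \<nu> \<mu>"
  by (auto simp: E_minus_def E_plus_def)

lemma E_plus_disjoint: "E_plus \<mu> \<nu> \<inter> E_plus \<nu> \<mu> = {}"
  by (auto simp: E_plus_def)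

text \<open>To the right of \<open>x\<close>, right continuity keeps \<open>cdf \<nu>\<close> below
  \<open>cdf \<mu> x\<close>, which is a lower bound of \<open>cdf_left \<mu> y\<close>. To the
  left, \<open>cdf \<mu>\<close> stays above \<open>cdf_left \<nu> x\<close>, which is an upper
  bound of \<open>cdf \<nu> y\<close>. Each of the two defining inequalities serves one
  side.\<close>

lemma open_E_plus:
  assumes \<mu>: "real_distribution \<mu>" and \<nu>: "real_distribution \<nu>"
  shows "open (E_plus \<mu> \<nu>)"
proof (rule openI)
  interpret m: real_distribution \<mu> by fact
  interpret n: real_distribution \<nu> by fact
  fix x assume x: "x \<in> E_plus \<mu> \<nu>"
  have le: "cdf_left M y \<le> cdf M y" "z < y \<Longrightarrow> cdf M z \<le> cdf_left M y" if "real_distribution M" for M z y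
  proof -
    interpret r: real_distribution M by fact
    show "cdf_left M y \<le> cdf M y" unfolding cdf_def cdf_left_def by (intro r.finite_measure_mono) auto
    show "z < y \<Longrightarrow> cdf M z \<le> cdf_left M y" unfolding cdf_def cdf_left_def by (intro r.finite_measure_mono) auto
  qed
  have "continuous (at_right x) (cdf \<nu>)" by (rule n.cdf_is_right_cont)
  then have "(cdf \<nu> \<longlongrightarrow> cdf \<nu> x) (at_right x)" by (simp add: continuous_within)
  then have "eventually (\<lambda>y. cdf \<nu> y < cdf \<mu> x) (at_right x)"
    using x by (intro order_tendstoD) (auto simp: E_plus_def)
  then obtain b where b: "b > x" "\<And>y. x < y \<Longrightarrow> y < b \<Longrightarrow> cdf \<nu> y < cdf \<mu> x"
    unfolding eventually_at_right_field by auto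
  have "(cdf \<mu> \<longlongrightarrow> cdf_left \<mu> x) (at_left x)"
    unfolding cdf_left_def by (rule m.cdf_at_left)
  then have "eventually (\<lambda>y. cdf_left \<nu> x < cdf \<mu> y) (at_left x)"
    using x by (intro order_tendstoD) (auto simp: E_plus_def)
  then obtain a where a: "a < x" "\<And>y. a < y \<Longrightarrow> y < x \<Longrightarrow> cdf_left \<nu> x < cdf \<mu> y"
    unfolding eventually_at_left_field by auto
  have "y \<in> E_plus \<mu> \<nu>" if y: "a < y" "y < b" for y
  proof (cases y x rule: linorder_cases)
    case less
    obtain w where w: "a < w" "w < y" using dense[OF y(1)] by blast
    have "cdf_left \<nu> x < cdf_left \<mu> y" using a(2)[of w] w less le(2)[OF \<mu> w(2)] by auto
    moreover have "cdf \<nu> y \<le> cdf_left \<nu> x" by (rule le(2)[OF \<nu> less])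
    ultimately show ?thesis using le(1)[OF \<mu>, of y] le(1)[OF \<nu>, of y] by (auto simp: E_plus_def)
  next
    case greater
    have "cdf \<nu> y < cdf \<mu> x" using b(2)[of y] y greater by auto
    moreover have "cdf \<mu> x \<le> cdf_left \<mu> y" by (rule le(2)[OF \<mu> greater])
    ultimately show ?thesis using le(1)[OF \<mu>, of y] le(1)[OF \<nu>, of y] by (auto simp: E_plus_def)
  qed (use x in simp)
  moreover define d where "d = min (x - a) (b - x)"
  ultimately have "d > 0" "ball x d \<subseteq> E_plus \<mu> \<nu>"
    using a(1) b(1) by (auto simp: dist_real_def)
  then show "\<exists>e>0. ball x e \<subseteq> E_plus \<mu> \<nu>" by blast
qed

text \<open>Openness keeps the infimum out of \<open>I\<close>; maximality keeps it out of all of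
  \<open>E\<close>, since adjoining it to \<open>I\<close> preserves connectedness.\<close>

lemma component_Inf_notin:
  fixes E :: "real set"
  assumes I: "I \<in> components E" and E: "open E" and b: "bdd_below I"
  shows "Inf I \<notin> I" "Inf I \<notin> E"
proof -
  have oI: "open I" using I E by (rule open_components[rotated])
  have ne: "I \<noteq> {}" using in_components_nonempty[OF I] .
  show 1: "Inf I \<notin> I"
  proof
    assume "Inf I \<in> I"
    then obtain e where e: "e > 0" "ball (Inf I) e \<subseteq> I" using oI openE by blast
    then have "Inf I - e / 2 \<in> I" by (auto simp: dist_real_def subset_iff)
    then show False using cInf_lower[OF _ b, of "Inf I - e / 2"] e(1) by simp
  qed
  show "Inf I \<notin> E"
  proof
    assume a: "Inf I \<in> E"
    have "connected (insert (Inf I) I)"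
      by (rule connected_intermediate_closure[OF in_components_connected[OF I]])
        (use closure_contains_Inf[OF ne b] closure_subset in auto)
    then have "insert (Inf I) I \<subseteq> I"
      using a in_components_subset[OF I] ne by (intro components_maximal[OF I]) auto
    then show False using 1 by simp
  qed
qed

lemma component_Sup_notin:
  fixes E :: "real set"
  assumes I: "I \<in> components E" and E: "open E" and b: "bdd_above I"
  shows "Sup I \<notin> I" "Sup I \<notin> E"
proof -
  have oI: "open I" using I E by (rule open_components[rotated])
  have ne: "I \<noteq> {}" using in_components_nonempty[OF I] .
  show 1: "Sup I \<notin> I"
  proof
    assume "Sup I \<in> I"
    then obtain e where e: "e > 0" "ball (Sup I) e \<subseteq> I" using oI openE by blast
    then have "Sup I + e / 2 \<in> I" by (auto simp: dist_real_def subset_iff)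
    then show False using cSup_upper[OF _ b, of "Sup I + e / 2"] e(1) by simp
  qed
  show "Sup I \<notin> E"
  proof
    assume a: "Sup I \<in> E"
    have "connected (insert (Sup I) I)"
      by (rule connected_intermediate_closure[OF in_components_connected[OF I]])
        (use closure_contains_Sup[OF ne b] closure_subset in auto)
    then have "insert (Sup I) I \<subseteq> I"
      using a in_components_subset[OF I] ne by (intro components_maximal[OF I]) auto
    then show False using 1 by simp
  qed
qed

section \<open>Pairs classified by their midpoint\<close>

definition mid :: "real \<times> real \<Rightarrow> real" where
  "mid z = (fst z + snd z) / 2"

lemma mid_measurable [measurable]: "mid \<in> borel_measurable (borel \<Otimes>\<^sub>M borel)"
  unfolding mid_def[abs_def] by measurable

lemma emeasure_atom: "X \<in> sets borel \<Longrightarrow> emeasure (atom c x) X = ennreal c * indicator X x"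
  by (simp add: atom_def)

text \<open>Separates geometry from measure: what follows concerns a single pair, and almost every
  pair of a limit plan qualifies, with \<open>E_plus \<mu> \<nu>\<close> and
  \<open>E_plus \<nu> \<mu>\<close> as \<open>E\<close> and \<open>E'\<close>.\<close>

locale monotone_point =
  fixes E E' :: "real set" and z :: "real \<times> real"
  assumes oE: "open E" and disj: "E \<inter> E' = {}"
    and up: "fst z < snd z \<Longrightarrow> {fst z<..<snd z} \<subseteq> E"
    and down: "snd z < fst z \<Longrightarrow> {snd z<..<fst z} \<subseteq> E'"
begin

text \<open>The open interval between the coordinates is connected, lies in \<open>E\<close> and
  meets \<open>I\<close> in the midpoint, so maximality places it inside \<open>I\<close>. A
  coordinate outside \<open>I\<close> must then be an endpoint of \<open>I\<close>.\<close>

lemma mid_in_componentD: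
  assumes I: "I \<in> components E" and m: "mid z \<in> I"
  shows "fst z \<le> snd z" "{fst z<..<snd z} \<subseteq> I" "fst z = snd z \<Longrightarrow> fst z \<in> I"
    "fst z \<in> I \<or> (bdd_below I \<and> fst z = Inf I \<and> fst z < snd z)"
    "snd z \<in> I \<or> (bdd_above I \<and> snd z = Sup I \<and> fst z < snd z)"
proof -
  have IE: "I \<subseteq> E" using in_components_subset[OF I] .
  have iv: "a \<in> I \<Longrightarrow> c \<in> I \<Longrightarrow> a \<le> b \<Longrightarrow> b \<le> c \<Longrightarrow> b \<in> I" for a b c
    using connectedD_interval[OF in_components_connected[OF I]] by blast
  show le: "fst z \<le> snd z"
  proof (rule ccontr)
    assume n: "\<not> fst z \<le> snd z"
    then have "mid z \<in> {snd z<..<fst z}" by (auto simp: mid_def field_simps)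
    then have "mid z \<in> E'" using down n by (meson not_le subsetD)
    then show False using m IE disj by blast
  qed
  show eq: "fst z = snd z \<Longrightarrow> fst z \<in> I" using m by (simp add: mid_def)
  have mm: "fst z < snd z \<Longrightarrow> fst z < mid z \<and> mid z < snd z" by (simp add: mid_def field_simps)
  show sub: "{fst z<..<snd z} \<subseteq> I"
  proof (cases "fst z < snd z")
    case True
    then show ?thesis using up m mm by (intro components_maximal[OF I]) auto
  qed auto
  show "fst z \<in> I \<or> (bdd_below I \<and> fst z = Inf I \<and> fst z < snd z)"
  proof (cases "fst z \<in> I")
    case False
    then have "fst z \<noteq> snd z" using eq by metis
    then have lt: "fst z < snd z" using le by simp
    have lb: "fst z \<le> w" if "w \<in> I" for w
      using iv[OF that m, of "fst z"] False mm[OF lt] by force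
    have "Inf I = fst z"
    proof (rule cInf_eq_non_empty)
      show "I \<noteq> {}" using m by auto
      fix u assume u: "\<And>x. x \<in> I \<Longrightarrow> u \<le> x"
      show "u \<le> fst z"
      proof (rule ccontr)
        assume "\<not> ?thesis"
        then obtain v where v: "fst z < v" "v < min u (snd z)" using dense[of "fst z" "min u (snd z)"] lt by auto
        then have "v \<in> I" using sub by auto
        then show False using u[of v] v by auto
      qed
    qed (rule lb)
    then show ?thesis using lb lt by (auto simp: bdd_below_def)
  qed simp
  show "snd z \<in> I \<or> (bdd_above I \<and> snd z = Sup I \<and> fst z < snd z)"
  proof (cases "snd z \<in> I")
    case False
    then have "fst z \<noteq> snd z" using eq by metis
    then have lt: "fst z < snd z" using le by simp
    have ub: "w \<le> snd z" if "w \<in> I" for w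
      using iv[OF m that, of "snd z"] False mm[OF lt] by force
    have "Sup I = snd z"
    proof (rule cSup_eq_non_empty)
      show "I \<noteq> {}" using m by auto
      fix u assume u: "\<And>x. x \<in> I \<Longrightarrow> x \<le> u"
      show "snd z \<le> u"
      proof (rule ccontr)
        assume "\<not> ?thesis"
        then obtain v where v: "max u (fst z) < v" "v < snd z" using dense[of "max u (fst z)" "snd z"] lt by auto
        then have "v \<in> I" using sub by auto
        then show False using u[of v] v by auto
      qed
    qed (rule ub)
    then show ?thesis using ub lt by (auto simp: bdd_above_def)
  qed simp
qed

text \<open>\<open>t\<close> may be one of the coordinates; as \<open>I\<close> is open, it still
  meets the open interval between them, and maximality applies.\<close>

lemma mid_in_componentI:
  assumes I: "I \<in> components E" and t: "t \<in> I" "fst z \<le> t" "t \<le> snd z"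
  shows "mid z \<in> I"
proof (cases "fst z = snd z")
  case True
  then show ?thesis using t by (auto simp: mid_def)
next
  case False
  then have lt: "fst z < snd z" using t by auto
  have oI: "open I" using I oE by (rule open_components[rotated])
  have "t \<in> closure {fst z<..<snd z}" using lt t by (simp add: closure_greaterThanLessThan)
  then have "I \<inter> {fst z<..<snd z} \<noteq> {}"
    using open_Int_closure_eq_empty[OF oI, of "{fst z<..<snd z}"] t(1) by blast
  then have "{fst z<..<snd z} \<subseteq> I" using up[OF lt] by (intro components_maximal[OF I]) auto
  then show ?thesis using lt by (auto simp: mid_def field_simps)
qed

lemma end_in_component_le:
  assumes I: "I \<in> components E"
  shows "fst z \<in> I \<Longrightarrow> fst z \<le> snd z" "snd z \<in> I \<Longrightarrow> fst z \<le> snd z"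
proof -
  have oI: "open I" using I oE by (rule open_components[rotated])
  have IE: "I \<subseteq> E" using in_components_subset[OF I] .
  have False if a: "snd z < fst z" and t: "t \<in> I" "t = fst z \<or> t = snd z" for t
  proof -
    have "t \<in> closure {snd z<..<fst z}" using a t by (auto simp: closure_greaterThanLessThan)
    then have "I \<inter> {snd z<..<fst z} \<noteq> {}"
      using open_Int_closure_eq_empty[OF oI, of "{snd z<..<fst z}"] t(1) by blast
    then show False using down[OF a] IE disj by blast
  qed
  then show "fst z \<in> I \<Longrightarrow> fst z \<le> snd z" "snd z \<in> I \<Longrightarrow> fst z \<le> snd z"
    by (metis not_le)+
qed

text \<open>The right side has the shape of \<open>mu_plus_comp\<close>: what starts in
  \<open>I\<close>, and what leaves the left endpoint to the right. The strict inequality excludes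
  mass that stays at the endpoint.\<close>

lemma mid_in_component_iff_fst:
  assumes I: "I \<in> components E"
  shows "mid z \<in> I \<longleftrightarrow> fst z \<in> I \<or> (bdd_below I \<and> fst z = Inf I \<and> fst z < snd z)"
proof
  assume "mid z \<in> I" then show "fst z \<in> I \<or> (bdd_below I \<and> fst z = Inf I \<and> fst z < snd z)"
    by (rule mid_in_componentD(4)[OF I])
next
  assume "fst z \<in> I \<or> (bdd_below I \<and> fst z = Inf I \<and> fst z < snd z)"
  then show "mid z \<in> I"
  proof
    assume "fst z \<in> I" then show ?thesis
      using mid_in_componentI[OF I, of "fst z"] end_in_component_le(1)[OF I] by simp
  next
    assume a: "bdd_below I \<and> fst z = Inf I \<and> fst z < snd z"
    then obtain t where "t \<in> I" "t < snd z"
      using cInf_lessD[of I "snd z"] in_components_nonempty[OF I] by auto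
    then show ?thesis using a cInf_lower[of t I] by (intro mid_in_componentI[OF I, of t]) auto
  qed
qed

lemma mid_in_component_iff_snd:
  assumes I: "I \<in> components E"
  shows "mid z \<in> I \<longleftrightarrow> snd z \<in> I \<or> (bdd_above I \<and> snd z = Sup I \<and> fst z < snd z)"
proof
  assume "mid z \<in> I" then show "snd z \<in> I \<or> (bdd_above I \<and> snd z = Sup I \<and> fst z < snd z)"
    by (rule mid_in_componentD(5)[OF I])
next
  assume "snd z \<in> I \<or> (bdd_above I \<and> snd z = Sup I \<and> fst z < snd z)"
  then show "mid z \<in> I"
  proof
    assume "snd z \<in> I" then show ?thesis
      using mid_in_componentI[OF I, of "snd z"] end_in_component_le(2)[OF I] by simp
  next
    assume a: "bdd_above I \<and> snd z = Sup I \<and> fst z < snd z"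
    then obtain t where "t \<in> I" "fst z < t"
      using less_cSupD[of I "fst z"] in_components_nonempty[OF I] by auto
    then show ?thesis using a cSup_upper[of t I] by (intro mid_in_componentI[OF I, of t]) auto
  qed
qed

end

context limit_plan
begin

text \<open>Outside \<open>E_plus\<close> one of the two defining inequalities fails, so the mass of
  \<open>{..t} \<times> {t<..}\<close> or that of \<open>{..<t} \<times> {t..}\<close> is 0; the
  strict quadrant lies in both.\<close>

lemma null_gap:
  assumes "t \<notin> E_plus \<mu> \<nu>"
  shows "emeasure \<pi> ({..<t} \<times> {t<..}) = 0"
proof -
  have "measure \<pi> ({..<t} \<times> {t<..}) \<le> measure \<pi> ({..t} \<times> {t<..})"
    "measure \<pi> ({..<t} \<times> {t<..}) \<le> measure \<pi> ({..<t} \<times> {t..})"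
    by (auto intro!: P.finite_measure_mono)
  then have "measure \<pi> ({..<t} \<times> {t<..}) \<le> 0"
    using assms by (auto simp: measure_right measure_right_left E_plus_def max_def split: if_splits)
  then show ?thesis by (simp add: P.emeasure_eq_measure measure_le_0_iff)
qed

text \<open>An open interval that meets the complement of \<open>E_plus\<close> also meets a
  countable dense subset of it, so countably many null quadrants suffice.\<close>

lemma AE_up: "AE z in \<pi>. fst z < snd z \<longrightarrow> {fst z<..<snd z} \<subseteq> E_plus \<mu> \<nu>"
proof -
  obtain T where T: "countable T" "T \<subseteq> - E_plus \<mu> \<nu>" "- E_plus \<mu> \<nu> \<subseteq> closure T"
    using separable by blast
  have "AE z in \<pi>. \<forall>t\<in>T. \<not> (fst z < t \<and> t < snd z)"
  proof (subst AE_ball_countable[OF T(1)], rule ballI)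
    fix t assume "t \<in> T"
    then have "{..<t} \<times> {t<..} \<in> null_sets \<pi>"
      using null_gap[of t] T(2) by (auto simp: null_sets_def)
    then show "AE z in \<pi>. \<not> (fst z < t \<and> t < snd z)"
      by (rule AE_I') auto
  qed
  then show ?thesis
  proof eventually_elim
    case (elim z)
    show ?case
    proof (intro impI subsetI, rule ccontr)
      fix t assume t: "fst z < snd z" "t \<in> {fst z<..<snd z}" "t \<notin> E_plus \<mu> \<nu>"
      then have "{fst z<..<snd z} \<inter> closure T \<noteq> {}" using T(3) by blast
      then have "{fst z<..<snd z} \<inter> T \<noteq> {}"
        by (simp add: open_Int_closure_eq_empty)
      then show False using elim by auto
    qed
  qed
qed

lemma swap_measurable: "(\<lambda>(x, y). (y, x)) \<in> measurable \<pi> borel"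
  unfolding borel_prod[symmetric] by measurable

lemma AE_down: "AE z in \<pi>. snd z < fst z \<longrightarrow> {snd z<..<fst z} \<subseteq> E_plus \<nu> \<mu>"
  using AE_distrD[OF swap_measurable limit_plan.AE_up[OF limit_plan_swap[OF limit_plan_axioms]]]
  by (simp add: split_beta)

lemma AE_monotone_point: "AE z in \<pi>. monotone_point (E_plus \<mu> \<nu>) (E_plus \<nu> \<mu>) z"
  using AE_up AE_down
  by eventually_elim (simp add: monotone_point_def open_E_plus[OF \<mu> \<nu>] E_plus_disjoint)

definition part :: "real set \<Rightarrow> (real \<times> real) measure" where
  "part I = restr \<pi> (mid -` I)"

lemma mid_vimage [simp]: "I \<in> sets borel \<Longrightarrow> mid -` I \<in> sets \<pi>"
  using measurable_sets[of mid \<pi> borel I] by (simp add: space_\<pi>)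

lemma sets_part [simp]: "sets (part I) = sets borel"
  by (simp add: part_def sets_\<pi>)

lemma emeasure_part:
  "I \<in> sets borel \<Longrightarrow> X \<in> sets borel \<Longrightarrow> emeasure (part I) X = emeasure \<pi> (mid -` I \<inter> X)"
  unfolding part_def by (rule emeasure_restr) (simp, simp add: sets_\<pi>)

lemma emeasure_part':
  "I \<in> sets borel \<Longrightarrow> Measurable.pred (borel \<Otimes>\<^sub>M borel) P \<Longrightarrow> emeasure (part I) {z. P z} = emeasure \<pi> {z. mid z \<in> I \<and> P z}"
proof -
  assume I: "I \<in> sets borel" and P: "Measurable.pred (borel \<Otimes>\<^sub>M borel) P"
  have "{z. P z} \<in> sets borel" using P unfolding borel_prod[symmetric] by (simp add: pred_def space_pair_measure)
  from emeasure_part[OF I this] show ?thesis by (simp add: vimage_def Int_def)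
qed

lemma AE_part:
  assumes "I \<in> sets borel" "AE z in \<pi>. mid z \<in> I \<longrightarrow> P z"
  shows "AE z in part I. P z"
  unfolding part_def restr_def using assms(2) measurable_sets[of mid \<pi> borel I] assms(1)
  by (subst AE_density) (auto simp: space_\<pi> indicator_def elim!: AE_mp)

lemma component_sets:
  assumes "I \<in> components (E_plus \<mu> \<nu>)"
  shows "open I" "I \<in> sets borel"
  using open_components[OF open_E_plus[OF \<mu> \<nu>] assms] by auto

lemma finite_part: "finite_measure (part I)" if "I \<in> sets borel"
proof
  have "emeasure (part I) (space (part I)) = emeasure \<pi> (mid -` I)"
    using emeasure_part[OF that, of UNIV] sets_eq_imp_space_eq[OF sets_part[of I]] by simp
  then show "emeasure (part I) (space (part I)) \<noteq> \<infinity>" by (simp add: P.emeasure_eq_measure)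
qed

text \<open>By the midpoint criterion the part consists of the pairs that start in \<open>I\<close>
  and of those that start at \<open>Inf I\<close> and move right. The latter carry the whole
  crossing mass at \<open>Inf I\<close>, because nothing jumps over that point.\<close>

lemma distr_part_fst:
  assumes I: "I \<in> components (E_plus \<mu> \<nu>)"
  shows "distr (part I) borel fst = mu_plus_comp \<mu> \<nu> I"
proof (rule measure_eqI)
  show "sets (distr (part I) borel fst) = sets (mu_plus_comp \<mu> \<nu> I)" by (simp add: mu_plus_comp_def)
  fix X assume "X \<in> sets (distr (part I) borel fst)"
  then have X [measurable]: "X \<in> sets borel" by simp
  have Im [measurable]: "I \<in> sets borel" using component_sets[OF I] by simp
  note notin = component_Inf_notin[OF I open_E_plus[OF \<mu> \<nu>]]
  have [measurable_cong]: "sets (part I) = sets (borel \<Otimes>\<^sub>M borel)" by (subst borel_prod) simp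
  have sl: "sets (left_atom I c) = sets borel" for c by (simp add: left_atom_def)
  let ?a = "Inf I"
  let ?L = "{z. bdd_below I \<and> ?a \<in> X \<and> fst z = ?a \<and> fst z < snd z}"
  have sp: "space (part I) = UNIV" using sets_eq_imp_space_eq[OF sets_part[of I]] by simp
  have "{z. c \<and> fst z = d \<and> fst z < snd z} \<in> sets (borel \<Otimes>\<^sub>M borel)" for c and d :: real
  proof (cases c)
    case True
    have "{z \<in> space (borel \<Otimes>\<^sub>M borel). fst z = d \<and> fst z < snd z} \<in> sets (borel \<Otimes>\<^sub>M (borel :: real measure))"
      by measurable
    then show ?thesis using True by (simp add: space_pair_measure)
  qed simp
  from this[of "bdd_below I \<and> ?a \<in> X" ?a] have Lm: "?L \<in> sets \<pi>" unfolding sets_\<pi>_pair by (simp only: conj_assoc)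
  have "emeasure (distr (part I) borel fst) X = emeasure (part I) {z. fst z \<in> X}"
    by (subst emeasure_distr) (auto simp: vimage_def sp)
  also have "\<dots> = emeasure \<pi> {z. mid z \<in> I \<and> fst z \<in> X}"
    by (rule emeasure_part') measurable
  also have "\<dots> = emeasure \<pi> ((X \<inter> I) \<times> UNIV \<union> ?L)"
  proof (rule emeasure_eq_AE)
    show "AE z in \<pi>. z \<in> {z. mid z \<in> I \<and> fst z \<in> X} \<longleftrightarrow> z \<in> (X \<inter> I) \<times> UNIV \<union> ?L"
      using AE_monotone_point
    proof eventually_elim
      case (elim z)
      then show ?case using monotone_point.mid_in_component_iff_fst[OF elim I] by (cases z) auto
    qed
    have "{z \<in> space (borel \<Otimes>\<^sub>M borel). mid z \<in> I \<and> fst z \<in> X} \<in> sets (borel \<Otimes>\<^sub>M borel)"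
      by measurable
    then show "{z. mid z \<in> I \<and> fst z \<in> X} \<in> sets \<pi>"
      unfolding sets_\<pi>_pair by (simp add: space_pair_measure)
  qed (use Lm in auto)
  also have "\<dots> = emeasure \<pi> ((X \<inter> I) \<times> UNIV) + emeasure \<pi> ?L"
    by (rule plus_emeasure[symmetric]) (use Lm notin(1) in auto)
  also have "emeasure \<pi> ((X \<inter> I) \<times> UNIV) = emeasure \<mu> (X \<inter> I)"
    by (rule Marg_measure_fst(2)[OF M]) simp
  also have "emeasure \<pi> ?L = emeasure (left_atom I (\<lambda>a. cdf \<mu> a - cdf \<nu> a)) X"
  proof (cases "bdd_below I \<and> ?a \<in> X")
    case False
    then show ?thesis by (auto simp: left_atom_def emeasure_atom)
  next
    case True
    then have Leq: "?L = {..?a} \<times> {?a<..} - {..<?a} \<times> {?a<..}" by auto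
    have "measure \<pi> ?L = measure \<pi> ({..?a} \<times> {?a<..}) - measure \<pi> ({..<?a} \<times> {?a<..})"
      by (subst Leq, rule P.finite_measure_Diff) auto
    also have "measure \<pi> ({..<?a} \<times> {?a<..}) = 0"
      using null_gap[OF notin(2)] True by (simp add: P.emeasure_eq_measure)
    \<comment> \<open>The positive part in \<open>measure_right\<close> agrees with the truncation
      at 0 in \<open>ennreal\<close>, so no sign has to be determined.\<close>
    finally have "emeasure \<pi> ?L = ennreal (cdf \<mu> ?a - cdf \<nu> ?a)"
      by (simp add: P.emeasure_eq_measure measure_right max_def ennreal_neg)
    then show ?thesis using True by (simp add: left_atom_def emeasure_atom)
  qed
  also have "emeasure \<mu> (X \<inter> I) + emeasure (left_atom I (\<lambda>a. cdf \<mu> a - cdf \<nu> a)) X = emeasure (mu_plus_comp \<mu> \<nu> I) X"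
    unfolding mu_plus_comp_def
    by (subst emeasure_plus_measure) (auto simp: sl emeasure_restr Int_commute add.commute)
  finally show "emeasure (distr (part I) borel fst) X = emeasure (mu_plus_comp \<mu> \<nu> I) X" .
qed

text \<open>Arrival at the right endpoint \<open>b\<close> involves left limits: up to the null
  quadrant beyond \<open>b\<close> it is the crossing mass of
  \<open>{..<b} \<times> {b..}\<close>.\<close>

lemma distr_part_snd:
  assumes I: "I \<in> components (E_plus \<mu> \<nu>)"
  shows "distr (part I) borel snd = nu_plus_comp \<mu> \<nu> I"
proof (rule measure_eqI)
  show "sets (distr (part I) borel snd) = sets (nu_plus_comp \<mu> \<nu> I)" by (simp add: nu_plus_comp_def)
  fix X assume "X \<in> sets (distr (part I) borel snd)"
  then have X [measurable]: "X \<in> sets borel" by simp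
  have Im [measurable]: "I \<in> sets borel" using component_sets[OF I] by simp
  note notin = component_Sup_notin[OF I open_E_plus[OF \<mu> \<nu>]]
  have [measurable_cong]: "sets (part I) = sets (borel \<Otimes>\<^sub>M borel)" by (subst borel_prod) simp
  have sl: "sets (right_atom I c) = sets borel" for c by (simp add: right_atom_def)
  let ?b = "Sup I"
  let ?L = "{z. bdd_above I \<and> ?b \<in> X \<and> snd z = ?b \<and> fst z < snd z}"
  have sp: "space (part I) = UNIV" using sets_eq_imp_space_eq[OF sets_part[of I]] by simp
  have "{z. c \<and> snd z = d \<and> fst z < snd z} \<in> sets (borel \<Otimes>\<^sub>M borel)" for c and d :: real
  proof (cases c)
    case True
    have "{z \<in> space (borel \<Otimes>\<^sub>M borel). snd z = d \<and> fst z < snd z} \<in> sets (borel \<Otimes>\<^sub>M (borel :: real measure))"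
      by measurable
    then show ?thesis using True by (simp add: space_pair_measure)
  qed simp
  from this[of "bdd_above I \<and> ?b \<in> X" ?b] have Lm: "?L \<in> sets \<pi>" unfolding sets_\<pi>_pair by (simp only: conj_assoc)
  have "emeasure (distr (part I) borel snd) X = emeasure (part I) {z. snd z \<in> X}"
    by (subst emeasure_distr) (auto simp: vimage_def sp)
  also have "\<dots> = emeasure \<pi> {z. mid z \<in> I \<and> snd z \<in> X}"
    by (rule emeasure_part') measurable
  also have "\<dots> = emeasure \<pi> (UNIV \<times> (X \<inter> I) \<union> ?L)"
  proof (rule emeasure_eq_AE)
    show "AE z in \<pi>. z \<in> {z. mid z \<in> I \<and> snd z \<in> X} \<longleftrightarrow> z \<in> UNIV \<times> (X \<inter> I) \<union> ?L"
      using AE_monotone_point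
    proof eventually_elim
      case (elim z)
      then show ?case using monotone_point.mid_in_component_iff_snd[OF elim I] by (cases z) auto
    qed
    have "{z \<in> space (borel \<Otimes>\<^sub>M borel). mid z \<in> I \<and> snd z \<in> X} \<in> sets (borel \<Otimes>\<^sub>M borel)"
      by measurable
    then show "{z. mid z \<in> I \<and> snd z \<in> X} \<in> sets \<pi>"
      unfolding sets_\<pi>_pair by (simp add: space_pair_measure)
  qed (use Lm in auto)
  also have "\<dots> = emeasure \<pi> (UNIV \<times> (X \<inter> I)) + emeasure \<pi> ?L"
    by (rule plus_emeasure[symmetric]) (use Lm notin(1) in auto)
  also have "emeasure \<pi> (UNIV \<times> (X \<inter> I)) = emeasure \<nu> (X \<inter> I)"
    by (rule Marg_measure_snd(2)[OF M]) simp
  also have "emeasure \<pi> ?L = emeasure (right_atom I (\<lambda>b. cdf_left \<mu> b - cdf_left \<nu> b)) X"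
  proof (cases "bdd_above I \<and> ?b \<in> X")
    case False
    then show ?thesis by (auto simp: right_atom_def emeasure_atom)
  next
    case True
    then have Leq: "?L = {..<?b} \<times> {?b..} - {..<?b} \<times> {?b<..}" by auto
    have "measure \<pi> ?L = measure \<pi> ({..<?b} \<times> {?b..}) - measure \<pi> ({..<?b} \<times> {?b<..})"
      by (subst Leq, rule P.finite_measure_Diff) auto
    also have "measure \<pi> ({..<?b} \<times> {?b<..}) = 0"
      using null_gap[OF notin(2)] True by (simp add: P.emeasure_eq_measure)
    finally have "emeasure \<pi> ?L = ennreal (cdf_left \<mu> ?b - cdf_left \<nu> ?b)"
      by (simp add: P.emeasure_eq_measure measure_right_left max_def ennreal_neg)
    then show ?thesis using True by (simp add: right_atom_def emeasure_atom)
  qed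
  also have "emeasure \<nu> (X \<inter> I) + emeasure (right_atom I (\<lambda>b. cdf_left \<mu> b - cdf_left \<nu> b)) X = emeasure (nu_plus_comp \<mu> \<nu> I) X"
    unfolding nu_plus_comp_def
    by (subst emeasure_plus_measure) (auto simp: sl emeasure_restr Int_commute)
  finally show "emeasure (distr (part I) borel snd) X = emeasure (nu_plus_comp \<mu> \<nu> I) X" .
qed

lemma part_Marg:
  assumes "I \<in> components (E_plus \<mu> \<nu>)"
  shows "part I \<in> Marg (mu_plus_comp \<mu> \<nu> I) (nu_plus_comp \<mu> \<nu> I)"
  using distr_part_fst[OF assms] distr_part_snd[OF assms] finite_part component_sets[OF assms]
  by (simp add: Marg_def)

lemma AE_part_in:
  assumes I: "I \<in> components (E_plus \<mu> \<nu>)"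
  shows "AE z in part I. fst z \<le> snd z \<and> {fst z<..<snd z} \<subseteq> I \<and> (fst z = snd z \<longrightarrow> fst z \<in> I)"
proof (rule AE_part)
  show "AE z in \<pi>. mid z \<in> I \<longrightarrow> fst z \<le> snd z \<and> {fst z<..<snd z} \<subseteq> I \<and> (fst z = snd z \<longrightarrow> fst z \<in> I)"
    using AE_monotone_point
    by eventually_elim (use monotone_point.mid_in_componentD[OF _ I] in blast)
qed (use component_sets[OF I] in simp)

text \<open>Up to a null set, a pair that straddles a point of \<open>I\<close> has its midpoint in
  \<open>I\<close>, so the rectangle loses no mass to other parts.\<close>

lemma part_eq_on_rectangle:
  assumes I: "I \<in> components (E_plus \<mu> \<nu>)" and t: "t \<in> I"
    and AB [measurable]: "A \<in> sets borel" "B \<in> sets borel" and sub: "A \<subseteq> {..t}" "B \<subseteq> {t..}"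
  shows "measure (part I) (A \<times> B) = measure \<pi> (A \<times> B)"
proof -
  have [measurable]: "I \<in> sets borel" using component_sets[OF I] by simp
  have "emeasure (part I) (A \<times> B) = emeasure \<pi> (mid -` I \<inter> (A \<times> B))"
    by (rule emeasure_part) (auto simp: Times_borel)
  also have "\<dots> = emeasure \<pi> (A \<times> B)"
  proof (rule emeasure_eq_AE)
    show "AE z in \<pi>. z \<in> mid -` I \<inter> (A \<times> B) \<longleftrightarrow> z \<in> A \<times> B"
      using AE_monotone_point
    proof eventually_elim
      case (elim z)
      then show ?case
        using monotone_point.mid_in_componentI[OF elim I t] sub by (cases z) auto
    qed
  qed auto
  finally show ?thesis by (simp add: measure_def)
qed

end

section \<open>Kellerer form of the components\<close>

text \<open>The measures are added up over the disjointed cover; consistency makes the sum agree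
  with \<open>N n\<close> on all of \<open>C n\<close> and not only on the n-th piece. Nothing is
  asked of \<open>N n\<close> outside \<open>C n\<close>.\<close>

lemma glue_measures:
  fixes N :: "nat \<Rightarrow> real measure" and C :: "nat \<Rightarrow> real set"
  assumes N: "\<And>n. sets (N n) = sets borel" and C: "\<And>n. C n \<in> sets borel"
    and fin: "\<And>n. emeasure (N n) (C n) \<noteq> \<infinity>"
    and cons: "\<And>n k A. A \<in> sets borel \<Longrightarrow> A \<subseteq> C n \<Longrightarrow> A \<subseteq> C k \<Longrightarrow> emeasure (N n) A = emeasure (N k) A"
  shows "\<exists>\<eta>. sets \<eta> = sets borel \<and> sigma_finite_measure \<eta> \<and>
    (\<forall>n A. A \<in> sets borel \<longrightarrow> A \<subseteq> C n \<longrightarrow> emeasure \<eta> A = emeasure (N n) A) \<and> emeasure \<eta> (- (\<Union>n. C n)) = 0"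
proof -
  define D where "D = disjointed C"
  have Dm: "D n \<in> sets borel" for n
    unfolding D_def disjointed_def using C by (intro sets.Diff sets.finite_UN) auto
  have DC: "D n \<subseteq> C n" for n unfolding D_def by (rule disjointed_subset)
  have DU: "(\<Union>n. D n) = (\<Union>n. C n)" unfolding D_def by (rule UN_disjointed_eq)
  have Dd: "disjoint_family D" unfolding D_def by (rule disjoint_family_disjointed)
  define \<eta> where "\<eta> = sum_measure UNIV (\<lambda>n. restr (N n) (D n))"
  have s: "sets \<eta> = sets borel" by (simp add: \<eta>_def)
  have e: "emeasure \<eta> A = (\<Sum>n. emeasure (N n) (D n \<inter> A))" if "A \<in> sets borel" for A
    unfolding \<eta>_def using that N Dm
    by (subst emeasure_sum_measure) (auto simp: nn_integral_count_space_nat emeasure_restr intro!: suminf_cong)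
  have eC: "emeasure \<eta> A = emeasure (N n) A" if A: "A \<in> sets borel" "A \<subseteq> C n" for A n
  proof -
    have "emeasure \<eta> A = (\<Sum>k. emeasure (N n) (D k \<inter> A))"
      unfolding e[OF A(1)] using A Dm DC by (intro suminf_cong cons) auto
    also have "\<dots> = emeasure (N n) (\<Union>k. D k \<inter> A)"
    proof (rule suminf_emeasure)
      show "range (\<lambda>k. D k \<inter> A) \<subseteq> sets (N n)" using A Dm N by auto
      show "disjoint_family (\<lambda>k. D k \<inter> A)" by (rule disjoint_family_subset[OF Dd]) auto
    qed
    also have "(\<Union>k. D k \<inter> A) = A" using A(2) DU by blast
    finally show ?thesis .
  qed
  have z: "emeasure \<eta> (- (\<Union>n. C n)) = 0"
  proof -
    have "D n \<inter> - (\<Union>n. C n) = {}" for n using DC by blast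
    then show ?thesis using C by (subst e) auto
  qed
  have "sigma_finite_measure \<eta>"
  proof (rule sigma_finite_measure.intro)
    have "emeasure \<eta> (C n) \<noteq> \<infinity>" for n using eC[OF C, of n n] fin by simp
    then show "\<exists>A. countable A \<and> A \<subseteq> sets \<eta> \<and> \<Union> A = space \<eta> \<and> (\<forall>a\<in>A. emeasure \<eta> a \<noteq> \<infinity>)"
      using z C sets_eq_imp_space_eq[OF s]
      by (intro exI[of _ "insert (- (\<Union>n. C n)) (range C)"]) (auto simp: s)
  qed
  then show ?thesis using s eC z by blast
qed

text \<open>One component isolated from the rest of the plan. \<open>pos\<close> says that no point
  of \<open>I\<close> is a barrier, from either side; \<open>T\<close> holds the diagonal points
  that carry mass, and its countability is where the hypotheses of the theorem enter.\<close>

locale local_product = finite_measure \<rho> for \<rho> :: "(real \<times> real) measure" +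
  fixes I T :: "real set"
  assumes sets_\<rho>: "sets \<rho> = sets borel"
    and I: "open I" "connected I" "I \<noteq> {}"
    and prod: "\<And>t A A' B B'. t \<in> I \<Longrightarrow> A \<in> sets borel \<Longrightarrow> A' \<in> sets borel \<Longrightarrow> B \<in> sets borel \<Longrightarrow> B' \<in> sets borel \<Longrightarrow>
        A \<union> A' \<subseteq> {..t} \<Longrightarrow> B \<union> B' \<subseteq> {t..} \<Longrightarrow>
        measure \<rho> (A \<times> B) * measure \<rho> (A' \<times> B') = measure \<rho> (A \<times> B') * measure \<rho> (A' \<times> B)"
    and pos: "\<And>t. t \<in> I \<Longrightarrow> measure \<rho> ({..t} \<times> {t<..}) > 0" "\<And>t. t \<in> I \<Longrightarrow> measure \<rho> ({..<t} \<times> {t..}) > 0"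
    and AE_in: "AE z in \<rho>. fst z \<le> snd z \<and> {fst z<..<snd z} \<subseteq> I \<and> (fst z = snd z \<longrightarrow> fst z \<in> I)"
    and T: "countable T" "AE z in \<rho>. fst z = snd z \<longrightarrow> fst z \<in> T"
begin

lemma space_\<rho>: "space \<rho> = UNIV"
  using sets_eq_imp_space_eq[OF sets_\<rho>] by simp

lemma sets_\<rho>_pair [measurable_cong]: "sets \<rho> = sets (borel \<Otimes>\<^sub>M borel)"
  by (subst borel_prod) (rule sets_\<rho>)

lemma Times_sets [simp]: "A \<in> sets borel \<Longrightarrow> B \<in> sets borel \<Longrightarrow> A \<times> B \<in> sets \<rho>"
  by (simp add: sets_\<rho> Times_borel)

lemma interval: "a \<in> I \<Longrightarrow> c \<in> I \<Longrightarrow> a \<le> b \<Longrightarrow> b \<le> c \<Longrightarrow> b \<in> I"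
  using connectedD_interval[OF I(2)] by blast

text \<open>The plan keeps a positive fraction of its mass alive between any two points of \<open>I\<close>. At the
  first time \<open>u\<close> at which mass started before \<open>s\<close> has died out, all mass started before \<open>u\<close> would
  have to stop at \<open>u\<close>; by the product property at \<open>u\<close>, so would the mass started at \<open>u\<close>.\<close>

lemma survival_pos:
  assumes s: "s \<in> I" and t: "t \<in> I" and st: "s \<le> t"
  shows "measure \<rho> ({..s} \<times> {t<..}) > 0"
proof (rule ccontr)
  assume "\<not> ?thesis"
  then have t0: "measure \<rho> ({..s} \<times> {t<..}) = 0" by (simp add: measure_le_0_iff not_less)
  let ?\<phi> = "\<lambda>u. measure \<rho> ({..s} \<times> {u<..})"
  define Z where "Z = {u. s \<le> u \<and> u \<le> t \<and> ?\<phi> u = 0}"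
  have tZ: "t \<in> Z" using st t0 by (simp add: Z_def)
  have bZ: "bdd_below Z" by (auto simp: Z_def bdd_below_def)
  define u where "u = Inf Z"
  have su: "s \<le> u" unfolding u_def using tZ by (intro cInf_greatest) (auto simp: Z_def)
  have ut: "u \<le> t" unfolding u_def using tZ bZ by (rule cInf_lower)
  have uI: "u \<in> I" using interval[OF s t su ut] .
  have below: "?\<phi> v > 0" if "s \<le> v" "v < u" for v
  proof (rule ccontr)
    assume "\<not> ?thesis"
    then have "v \<in> Z" using that ut by (auto simp: Z_def measure_le_0_iff not_less)
    then have "u \<le> v" unfolding u_def using bZ by (intro cInf_lower)
    then show False using that by simp
  qed
  \<comment> \<open>The infimum is attained: the quadrants with right bound above \<open>u\<close>
    are null, and they increase to the one at \<open>u\<close>.\<close>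
  have "?\<phi> u = 0"
  proof -
    have U: "{..s} \<times> {u<..} = (\<Union>n. {..s} \<times> {u + 1 / real (Suc n)<..})"
    proof (intro equalityI subsetI)
      fix z assume z: "z \<in> {..s} \<times> {u<..}"
      then have p: "0 < snd z - u" by (simp add: mem_Times_iff)
      obtain n where "1 / real (Suc n) < snd z - u" by (rule nat_approx_posE[OF p])
      then have "u + 1 / real (Suc n) < snd z" by linarith
      then have "z \<in> {..s} \<times> {u + 1 / real (Suc n)<..}" using z by (simp add: mem_Times_iff)
      then show "z \<in> (\<Union>n. {..s} \<times> {u + 1 / real (Suc n)<..})" by blast
    next
      fix z assume "z \<in> (\<Union>n. {..s} \<times> {u + 1 / real (Suc n)<..})"
      then obtain n where "z \<in> {..s} \<times> {u + 1 / real (Suc n)<..}" by blast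
      then have n: "fst z \<le> s" "u + 1 / real (Suc n) < snd z" by (simp_all add: mem_Times_iff)
      have "0 < 1 / real (Suc n)" by simp
      then have "u < snd z" using n(2) by linarith
      then show "z \<in> {..s} \<times> {u<..}" using n(1) by (simp add: mem_Times_iff)
    qed
    have "{..s} \<times> {u + 1 / real (Suc n)<..} \<in> null_sets \<rho>" for n
    proof -
      obtain z where z: "z \<in> Z" "z < u + 1 / real (Suc n)"
        using cInf_lessD[of Z "u + 1 / real (Suc n)"] tZ unfolding u_def by auto
      have "?\<phi> (u + 1 / real (Suc n)) \<le> ?\<phi> z"
        using z(2) by (intro finite_measure_mono) auto
      then show ?thesis
        using z(1) by (auto simp: Z_def null_sets_def emeasure_eq_measure measure_le_0_iff)
    qed
    then have "(\<Union>n. {..s} \<times> {u + 1 / real (Suc n)<..}) \<in> null_sets \<rho>" by (rule null_sets_UN)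
    then show ?thesis unfolding U[symmetric] by (simp add: null_sets_def measure_def)
  qed
  then have su': "s < u" using pos(1)[OF s] su by (cases "s = u") auto
  \<comment> \<open>At \<open>v\<close> mass from \<open>{..s}\<close> is still alive. By the
    product property at \<open>v\<close>, the mass from \<open>{..v}\<close> that survives beyond
    \<open>u\<close> is proportional to that from \<open>{..s}\<close>, hence 0.\<close>
  have v0: "measure \<rho> ({..v} \<times> {u<..}) = 0" if v: "s \<le> v" "v < u" for v
  proof -
    have vI: "v \<in> I" using interval[OF s uI] v by auto
    have "measure \<rho> ({..s} \<times> {u<..}) * measure \<rho> ({..v} \<times> {v<..}) =
        measure \<rho> ({..s} \<times> {v<..}) * measure \<rho> ({..v} \<times> {u<..})"
      by (rule prod[OF vI]) (use v in auto)
    then show ?thesis using \<open>?\<phi> u = 0\<close> below[OF v] by simp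
  qed
  have n1: "{..<u} \<times> {u<..} \<in> null_sets \<rho>"
  proof -
    have "{..max s (u - 1 / real (Suc n))} \<times> {u<..} \<in> null_sets \<rho>" for n
      using v0[of "max s (u - 1 / real (Suc n))"] su' by (auto simp: null_sets_def emeasure_eq_measure)
    then have "(\<Union>n. {..max s (u - 1 / real (Suc n))} \<times> {u<..}) \<in> null_sets \<rho>" by (rule null_sets_UN)
    moreover have "{..<u} \<times> {u<..} \<subseteq> (\<Union>n. {..max s (u - 1 / real (Suc n))} \<times> {u<..})"
    proof
      fix z assume z: "z \<in> {..<u} \<times> {u<..}"
      then have p: "0 < u - fst z" by (simp add: mem_Times_iff)
      obtain n where "1 / real (Suc n) < u - fst z" by (rule nat_approx_posE[OF p])
      then have "fst z \<le> max s (u - 1 / real (Suc n))" by linarith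
      then have "z \<in> {..max s (u - 1 / real (Suc n))} \<times> {u<..}" using z by (simp add: mem_Times_iff)
      then show "z \<in> (\<Union>n. {..max s (u - 1 / real (Suc n))} \<times> {u<..})" by blast
    qed
    ultimately show ?thesis by (intro null_sets_subset[of _ \<rho> "{..<u} \<times> {u<..}"]) auto
  qed
  \<comment> \<open>The first factor is positive by \<open>pos\<close>, since nothing from
    \<open>{..<u}\<close> gets beyond \<open>u\<close>; so the second one, the mass that leaves
    \<open>u\<close> itself, must vanish.\<close>
  have "measure \<rho> ({..<u} \<times> {u}) * measure \<rho> ({u} \<times> {u<..}) =
      measure \<rho> ({..<u} \<times> {u<..}) * measure \<rho> ({u} \<times> {u})"
    by (rule prod[OF uI]) auto
  moreover have "measure \<rho> ({..<u} \<times> {u<..}) = 0" using n1 by (simp add: null_sets_def measure_def)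
  moreover have "measure \<rho> ({..<u} \<times> {u..}) = measure \<rho> ({..<u} \<times> {u}) + measure \<rho> ({..<u} \<times> {u<..})"
  proof -
    have eq: "{..<u} \<times> {u..} = {..<u} \<times> {u} \<union> {..<u} \<times> {u<..}" by auto
    show ?thesis by (subst eq, rule finite_measure_Union) auto
  qed
  ultimately have "measure \<rho> ({u} \<times> {u<..}) = 0" using pos(2)[OF uI] by auto
  moreover have "measure \<rho> ({..u} \<times> {u<..}) = measure \<rho> ({..<u} \<times> {u<..}) + measure \<rho> ({u} \<times> {u<..})"
  proof -
    have eq: "{..u} \<times> {u<..} = {..<u} \<times> {u<..} \<union> {u} \<times> {u<..}" by auto
    show ?thesis by (subst eq, rule finite_measure_Union) auto
  qed
  ultimately show False using pos(1)[OF uI] \<open>measure \<rho> ({..<u} \<times> {u<..}) = 0\<close> by simp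
qed

lemma survival_pos': "s \<in> I \<Longrightarrow> t \<in> I \<Longrightarrow> s \<le> t \<Longrightarrow> measure \<rho> ({..s} \<times> {t..}) > 0"
  by (rule less_le_trans[OF survival_pos[of s t]]) (auto intro!: finite_measure_mono)

definition slice1 :: "real \<Rightarrow> real set \<Rightarrow> real measure" where
  "slice1 c B = scale_measure (ennreal c) (distr (restr \<rho> (UNIV \<times> B)) borel fst)"

definition slice2 :: "real \<Rightarrow> real set \<Rightarrow> real measure" where
  "slice2 c A = scale_measure (ennreal c) (distr (restr \<rho> (A \<times> UNIV)) borel snd)"

lemma sets_slice [simp]: "sets (slice1 c B) = sets borel" "sets (slice2 c A) = sets borel"
  by (simp_all add: slice1_def slice2_def)

lemma emeasure_slice1:
  assumes "0 \<le> c" "A \<in> sets borel" "B \<in> sets borel"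
  shows "emeasure (slice1 c B) A = ennreal (c * measure \<rho> (A \<times> B))"
proof -
  have m: "fst \<in> measurable (restr \<rho> (UNIV \<times> B)) borel"
    unfolding restr_def by simp
  have "emeasure (slice1 c B) A = ennreal c * emeasure (restr \<rho> (UNIV \<times> B)) (fst -` A \<inter> space (restr \<rho> (UNIV \<times> B)))"
    unfolding slice1_def using assms m by (simp add: emeasure_distr)
  also have "fst -` A \<inter> space (restr \<rho> (UNIV \<times> B)) = A \<times> UNIV" by (auto simp: restr_def space_\<rho>)
  also have "emeasure (restr \<rho> (UNIV \<times> B)) (A \<times> UNIV) = emeasure \<rho> (A \<times> B)"
    using assms by (subst emeasure_restr) (auto simp: Times_Int_Times)
  finally show ?thesis using assms by (simp add: emeasure_eq_measure ennreal_mult)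
qed

lemma emeasure_slice2:
  assumes "0 \<le> c" "A \<in> sets borel" "B \<in> sets borel"
  shows "emeasure (slice2 c A) B = ennreal (c * measure \<rho> (A \<times> B))"
proof -
  have m: "snd \<in> measurable (restr \<rho> (A \<times> UNIV)) borel"
    unfolding restr_def by simp
  have "emeasure (slice2 c A) B = ennreal c * emeasure (restr \<rho> (A \<times> UNIV)) (snd -` B \<inter> space (restr \<rho> (A \<times> UNIV)))"
    unfolding slice2_def using assms m by (simp add: emeasure_distr)
  also have "snd -` B \<inter> space (restr \<rho> (A \<times> UNIV)) = UNIV \<times> B" by (auto simp: restr_def space_\<rho>)
  also have "emeasure (restr \<rho> (A \<times> UNIV)) (UNIV \<times> B) = emeasure \<rho> (A \<times> B)"
    using assms by (subst emeasure_restr) (auto simp: Times_Int_Times)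
  finally show ?thesis using assms by (simp add: emeasure_eq_measure ennreal_mult)
qed

text \<open>Normalised by \<open>\<eta>1 {..t0} = 1\<close>, the product property forces \<open>\<eta>1 A\<close> to be
  \<open>\<rho> (A \<times> {t..}) / \<rho> ({..t0} \<times> {t..})\<close> for \<open>A \<subseteq> {..t}\<close>; these measures are consistent and are glued.\<close>

theorem factorization:
  "\<exists>\<eta>1 \<eta>2 :: real measure. sigma_finite_measure \<eta>1 \<and> sets \<eta>1 = sets borel \<and>
     sigma_finite_measure \<eta>2 \<and> sets \<eta>2 = sets borel \<and> \<rho> = restr (\<eta>1 \<Otimes>\<^sub>M \<eta>2) {(x, y). x \<le> y}"
proof -
  obtain t0 where t0: "t0 \<in> I" using I(3) by blast
  \<comment> \<open>Each ingredient has its purpose: the rationals reach the pairs with x < y,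
    \<open>T\<close> the diagonal points that carry mass, and the atoms of the second marginal are
    included so that the remaining diagonal points are null for \<open>\<eta>2\<close>.\<close>
  define W where "W = insert t0 (I \<inter> (\<rat> \<union> T \<union> {y. measure \<rho> (UNIV \<times> {y}) \<noteq> 0}))"
  have snd_m: "snd \<in> measurable \<rho> borel" by measurable
  have "countable {y. measure \<rho> (UNIV \<times> {y}) \<noteq> 0}"
  proof -
    interpret S: finite_measure "distr \<rho> borel snd" by (rule finite_measure_distr[OF snd_m])
    have "measure (distr \<rho> borel snd) {y} = measure \<rho> (UNIV \<times> {y})" for y
      by (subst measure_distr[OF snd_m]) (auto simp: space_\<rho> intro!: arg_cong[where f = "measure \<rho>"])
    then show ?thesis using S.countable_support by simp
  qed
  then have Wc: "countable W" using T(1) countable_rat by (auto simp: W_def)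
  have WI: "W \<subseteq> I" using t0 by (auto simp: W_def)
  have ratW: "\<exists>r\<in>W. a < r \<and> r < b" if ab: "a < b" "{a<..<b} \<inter> I \<noteq> {}" for a b
  proof -
    have "open ({a<..<b} \<inter> I)" using I(1) by auto
    moreover obtain x where "x \<in> {a<..<b} \<inter> I" using ab by blast
    ultimately obtain e where e: "e > 0" "ball x e \<subseteq> {a<..<b} \<inter> I" using openE by blast
    obtain r where r: "r \<in> \<rat>" "x - e < r" "r < x" using Rats_dense_in_real[of "x - e" x] e by auto
    then have "r \<in> ball x e" by (auto simp: dist_real_def)
    then show ?thesis using e r by (auto simp: W_def intro!: bexI[of _ r])
  qed
  have near: "{a<..<b} \<inter> I \<noteq> {}" if "x \<in> I" "a \<le> x" "x \<le> b" "a < b" for a b x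
  proof -
    have "x \<in> closure {a<..<b}" using that by (simp add: closure_greaterThanLessThan)
    then show ?thesis using open_Int_closure_eq_empty[OF I(1), of "{a<..<b}"] that(1) by blast
  qed
  have W_below: "\<exists>r\<in>W. r \<le> t0 \<and> r \<le> x" if x: "x \<in> I" for x
  proof -
    define c where "c = min x t0"
    have c: "c \<in> I" "c \<le> x" "c \<le> t0" using x t0 by (auto simp: c_def min_def)
    then have "{c - 1<..<c} \<inter> I \<noteq> {}" by (intro near[of c]) auto
    then obtain r where "r \<in> W" "r < c" using ratW[of "c - 1" c] by auto
    then show ?thesis using c by (intro bexI[of _ r]) auto
  qed
  \<comment> \<open>\<open>\<eta>1\<close> is built on half-lines \<open>{..t}\<close> that grow to
    the right and \<open>\<eta>2\<close> on half-lines \<open>{t..}\<close> that grow to the left,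
    so they are glued along the points of \<open>W\<close> after and before
    \<open>t0\<close>.\<close>
  define R where "R = {t \<in> W. t0 \<le> t}"
  define L where "L = {t \<in> W. t \<le> t0}"
  have RL: "countable R" "countable L" "t0 \<in> R" "t0 \<in> L" "R \<subseteq> I" "L \<subseteq> I" "W = R \<union> L"
  proof -
    show "countable R" "countable L" using Wc by (auto simp: R_def L_def intro: countable_subset[of _ W])
    show "t0 \<in> R" "t0 \<in> L" by (auto simp: R_def L_def W_def)
    show "R \<subseteq> I" "L \<subseteq> I" using WI by (auto simp: R_def L_def)
    show "W = R \<union> L" by (auto simp: R_def L_def)
  qed
  define tr where "tr = from_nat_into R"
  define tl where "tl = from_nat_into L"
  have tr: "range tr = R" unfolding tr_def using RL by (intro range_from_nat_into) auto
  have tl: "range tl = L" unfolding tl_def using RL by (intro range_from_nat_into) auto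
  have trI: "tr n \<in> I" "t0 \<le> tr n" for n
  proof -
    have "tr n \<in> R" using tr by (metis rangeI)
    then show "tr n \<in> I" "t0 \<le> tr n" using RL(5) by (auto simp: R_def)
  qed
  have tlI: "tl n \<in> I" "tl n \<le> t0" for n
  proof -
    have "tl n \<in> L" using tl by (metis rangeI)
    then show "tl n \<in> I" "tl n \<le> t0" using RL(6) by (auto simp: L_def)
  qed
  define w where "w t = measure \<rho> ({..t0} \<times> {t..})" for t
  define w' where "w' t = measure \<rho> ({..t} \<times> {t0..})" for t
  have wp: "t \<in> I \<Longrightarrow> t0 \<le> t \<Longrightarrow> w t > 0" for t unfolding w_def by (rule survival_pos'[OF t0])
  have wp': "t \<in> I \<Longrightarrow> t \<le> t0 \<Longrightarrow> w' t > 0" for t unfolding w'_def by (rule survival_pos'[OF _ t0])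
  have ww: "w t0 = w' t0" by (simp add: w_def w'_def)
  have cons1: "1 / w a * measure \<rho> (A \<times> {a..}) = 1 / w b * measure \<rho> (A \<times> {b..})"
    if ab: "a \<in> I" "b \<in> I" "t0 \<le> a" "a \<le> b" and A: "A \<in> sets borel" "A \<subseteq> {..a}" for a b A
  proof -
    have "measure \<rho> (A \<times> {a..}) * measure \<rho> ({..t0} \<times> {b..}) = measure \<rho> (A \<times> {b..}) * measure \<rho> ({..t0} \<times> {a..})"
      by (rule prod[OF ab(1)]) (use ab A in auto)
    then show ?thesis using wp[of a] wp[of b] ab by (simp add: w_def field_simps)
  qed
  \<comment> \<open>The factor \<open>w t0\<close> makes the slice at \<open>t0\<close> have
    coefficient 1; with this scale the product of \<open>\<eta>1\<close> and \<open>\<eta>2\<close>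
    is \<rho> itself on the quadrant at \<open>t0\<close>.\<close>
  have cons2: "w t0 / w' a * measure \<rho> ({..a} \<times> B) = w t0 / w' b * measure \<rho> ({..b} \<times> B)"
    if ab: "a \<in> I" "b \<in> I" "b \<le> t0" "a \<le> b" and B: "B \<in> sets borel" "B \<subseteq> {b..}" for a b B
  proof -
    have "measure \<rho> ({..a} \<times> B) * measure \<rho> ({..b} \<times> {t0..}) = measure \<rho> ({..a} \<times> {t0..}) * measure \<rho> ({..b} \<times> B)"
      by (rule prod[OF ab(2)]) (use ab B in auto)
    then show ?thesis using wp'[of a] wp'[of b] ab by (simp add: w'_def field_simps)
  qed
  have w0: "0 \<le> 1 / w t" "0 \<le> w t0 / w' t" for t by (simp_all add: w_def w'_def)
  have sl1: "emeasure (slice1 (1 / w t) {t..}) A = ennreal (1 / w t * measure \<rho> (A \<times> {t..}))"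
    if "A \<in> sets borel" for t A
    by (rule emeasure_slice1) (use w0 that in auto)
  have sl2: "emeasure (slice2 (w t0 / w' t) {..t}) B = ennreal (w t0 / w' t * measure \<rho> ({..t} \<times> B))"
    if "B \<in> sets borel" for t B
    by (rule emeasure_slice2) (use w0 that in auto)
  obtain \<eta>1 where \<eta>1: "sets \<eta>1 = sets borel" "sigma_finite_measure \<eta>1"
    "\<And>n A. A \<in> sets borel \<Longrightarrow> A \<subseteq> {..tr n} \<Longrightarrow> emeasure \<eta>1 A = emeasure (slice1 (1 / w (tr n)) {tr n..}) A"
    "emeasure \<eta>1 (- (\<Union>n. {..tr n})) = 0"
  proof -
    have "\<exists>\<eta>. sets \<eta> = sets borel \<and> sigma_finite_measure \<eta> \<and>
      (\<forall>n A. A \<in> sets borel \<longrightarrow> A \<subseteq> {..tr n} \<longrightarrow> emeasure \<eta> A = emeasure (slice1 (1 / w (tr n)) {tr n..}) A) \<and>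
      emeasure \<eta> (- (\<Union>n. {..tr n})) = 0"
    proof (rule glue_measures)
      fix n k A assume A: "A \<in> sets borel" "A \<subseteq> {..tr n}" "A \<subseteq> {..tr k}"
      show "emeasure (slice1 (1 / w (tr n)) {tr n..}) A = emeasure (slice1 (1 / w (tr k)) {tr k..}) A"
      proof (cases "tr n \<le> tr k")
        case True
        show ?thesis unfolding sl1[OF A(1)] cons1[OF trI(1) trI(1) trI(2) True A(1,2)] ..
      next
        case False
        then have le: "tr k \<le> tr n" by simp
        show ?thesis unfolding sl1[OF A(1)] cons1[OF trI(1) trI(1) trI(2) le A(1,3)] ..
      qed
    next
      show "emeasure (slice1 (1 / w (tr n)) {tr n..}) {..tr n} \<noteq> \<infinity>" for n by (subst sl1) auto
    qed auto
    then show ?thesis by (elim exE conjE) (rule that, auto)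
  qed
  obtain \<eta>2 where \<eta>2: "sets \<eta>2 = sets borel" "sigma_finite_measure \<eta>2"
    "\<And>n B. B \<in> sets borel \<Longrightarrow> B \<subseteq> {tl n..} \<Longrightarrow> emeasure \<eta>2 B = emeasure (slice2 (w t0 / w' (tl n)) {..tl n}) B"
    "emeasure \<eta>2 (- (\<Union>n. {tl n..})) = 0"
  proof -
    have "\<exists>\<eta>. sets \<eta> = sets borel \<and> sigma_finite_measure \<eta> \<and>
      (\<forall>n B. B \<in> sets borel \<longrightarrow> B \<subseteq> {tl n..} \<longrightarrow> emeasure \<eta> B = emeasure (slice2 (w t0 / w' (tl n)) {..tl n}) B) \<and>
      emeasure \<eta> (- (\<Union>n. {tl n..})) = 0"
    proof (rule glue_measures)
      fix n k B assume B: "B \<in> sets borel" "B \<subseteq> {tl n..}" "B \<subseteq> {tl k..}"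
      show "emeasure (slice2 (w t0 / w' (tl n)) {..tl n}) B = emeasure (slice2 (w t0 / w' (tl k)) {..tl k}) B"
      proof (cases "tl n \<le> tl k")
        case True
        show ?thesis unfolding sl2[OF B(1)] cons2[OF tlI(1) tlI(1) tlI(2) True B(1,3)] ..
      next
        case False
        then have le: "tl k \<le> tl n" by simp
        show ?thesis unfolding sl2[OF B(1)] cons2[OF tlI(1) tlI(1) tlI(2) le B(1,2)] ..
      qed
    next
      show "emeasure (slice2 (w t0 / w' (tl n)) {..tl n}) {tl n..} \<noteq> \<infinity>" for n by (subst sl2) auto
    qed auto
    then show ?thesis by (elim exE conjE) (rule that, auto)
  qed
  have e1: "emeasure \<eta>1 A = ennreal (1 / w t * measure \<rho> (A \<times> {t..}))"
    if tR: "t \<in> R" and Am: "A \<in> sets borel" "A \<subseteq> {..t}" for t A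
  proof -
    obtain n where "t = tr n" using tR unfolding tr[symmetric] by blast
    then show ?thesis using \<eta>1(3)[of A n] Am sl1[of A t] by simp
  qed
  have e2: "emeasure \<eta>2 B = ennreal (w t0 / w' t * measure \<rho> ({..t} \<times> B))"
    if tL: "t \<in> L" and Bm: "B \<in> sets borel" "B \<subseteq> {t..}" for t B
  proof -
    obtain n where "t = tl n" using tL unfolding tl[symmetric] by blast
    then show ?thesis using \<eta>2(3)[of B n] Bm sl2[of B t] by simp
  qed
  define tt where "tt = from_nat_into W"
  have tt: "range tt = W" unfolding tt_def using Wc by (intro range_from_nat_into) (auto simp: W_def)
  define U where "U = (\<Union>i. {..tt i} \<times> {tt i..})"
  have Um: "U \<in> sets borel" unfolding U_def by (intro sets.countable_UN) (auto intro: Times_borel)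
  have Umem: "z \<in> U \<longleftrightarrow> (\<exists>t\<in>W. fst z \<le> t \<and> t \<le> snd z)" for z
    unfolding U_def tt[symmetric] by (cases z) auto
  have eqU: "emeasure \<rho> X = emeasure (\<eta>1 \<Otimes>\<^sub>M \<eta>2) X" if X: "X \<in> sets borel" "X \<subseteq> U" for X
  proof (rule pair_eq_on_countable_cover[OF sets_\<rho> \<eta>1(2,1) \<eta>2(2,1) _ _ _ X(1) X(2)[unfolded U_def]])
    fix i S B assume S: "S \<in> sets borel" "B \<in> sets borel" "S \<subseteq> {..tt i}" "B \<subseteq> {tt i..}"
    define t where "t = tt i"
    have tW: "t \<in> W" using tt by (auto simp: t_def)
    then have tI: "t \<in> I" using WI by blast
    \<comment> \<open>One factor is known from the slice at \<open>t\<close>, the other from the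
      slice at \<open>t0\<close>, according to the side of \<open>t0\<close> on which
      \<open>t\<close> lies; the product property at \<open>t\<close> combines them.\<close>
    have "ennreal (measure \<rho> (S \<times> B)) = emeasure \<eta>1 S * emeasure \<eta>2 B"
    proof (cases "t0 \<le> t")
      case True
      have "measure \<rho> (S \<times> B) * measure \<rho> ({..t0} \<times> {t..}) = measure \<rho> (S \<times> {t..}) * measure \<rho> ({..t0} \<times> B)"
        by (rule prod[OF tI]) (use S True in \<open>auto simp: t_def\<close>)
      then have "measure \<rho> (S \<times> B) = (1 / w t * measure \<rho> (S \<times> {t..})) * (w t0 / w' t0 * measure \<rho> ({..t0} \<times> B))"
        using wp[OF tI True] wp'[OF t0] ww by (simp add: w_def[of t] field_simps)
      moreover have "emeasure \<eta>1 S = ennreal (1 / w t * measure \<rho> (S \<times> {t..}))"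
        by (rule e1) (use S tW True in \<open>auto simp: R_def t_def\<close>)
      moreover have "emeasure \<eta>2 B = ennreal (w t0 / w' t0 * measure \<rho> ({..t0} \<times> B))"
        by (rule e2) (use S True RL in \<open>auto simp: t_def\<close>)
      ultimately show ?thesis
        by (simp only:) (intro ennreal_mult mult_nonneg_nonneg w0 measure_nonneg)
    next
      case False
      then have False': "t \<le> t0" by simp
      have "measure \<rho> (S \<times> B) * measure \<rho> ({..t} \<times> {t0..}) = measure \<rho> (S \<times> {t0..}) * measure \<rho> ({..t} \<times> B)"
        by (rule prod[OF tI]) (use S False' in \<open>auto simp: t_def\<close>)
      then have "measure \<rho> (S \<times> B) = (1 / w t0 * measure \<rho> (S \<times> {t0..})) * (w t0 / w' t * measure \<rho> ({..t} \<times> B))"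
        using wp'[OF tI False'] wp[OF t0] by (simp add: w'_def[of t] field_simps)
      moreover have "emeasure \<eta>1 S = ennreal (1 / w t0 * measure \<rho> (S \<times> {t0..}))"
        by (rule e1) (use S False' RL in \<open>auto simp: t_def\<close>)
      moreover have "emeasure \<eta>2 B = ennreal (w t0 / w' t * measure \<rho> ({..t} \<times> B))"
        by (rule e2) (use S tW False' in \<open>auto simp: L_def t_def\<close>)
      ultimately show ?thesis
        by (simp only:) (intro ennreal_mult mult_nonneg_nonneg w0 measure_nonneg)
    qed
    then show "emeasure \<eta>1 S * emeasure \<eta>2 B = emeasure \<rho> (S \<times> B)" by (simp add: emeasure_eq_measure)
  qed auto
  have \<rho>U: "AE z in \<rho>. z \<in> U"
    using AE_in T(2)
  proof eventually_elim
    case (elim z)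
    show ?case
    proof (cases "fst z = snd z")
      case True
      then show ?thesis using elim unfolding Umem W_def by (intro bexI[of _ "fst z"]) auto
    next
      case False
      then have lt: "fst z < snd z" using elim by simp
      obtain v where v: "fst z < v" "v < snd z" using dense[OF lt] by blast
      then have "v \<in> {fst z<..<snd z}" by simp
      then have "{fst z<..<snd z} \<inter> I \<noteq> {}" using elim by blast
      then obtain r where "r \<in> W" "fst z < r" "r < snd z" using ratW[OF lt] by blast
      then show ?thesis unfolding Umem by (intro bexI[of _ r]) auto
    qed
  qed
  interpret \<eta>2: sigma_finite_measure \<eta>2 by fact
  have s2: "sets (\<eta>1 \<Otimes>\<^sub>M \<eta>2) = sets (borel \<Otimes>\<^sub>M borel)" using \<eta>1(1) \<eta>2(1) by (intro sets_pair_measure_cong)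
  then have s2': "sets (\<eta>1 \<Otimes>\<^sub>M \<eta>2) = sets borel" by (subst (asm) borel_prod)
  have sp: "space \<eta>1 = UNIV" "space \<eta>2 = UNIV"
    using sets_eq_imp_space_eq[OF \<eta>1(1)] sets_eq_imp_space_eq[OF \<eta>2(1)] by auto
  \<comment> \<open>Evaluated on a slice at some \<open>r\<close> in \<open>L\<close> to the left of
    \<open>x\<close>, the mass \<open>\<eta>2 {x}\<close> is a multiple of a mass bounded by the
    atom of the second marginal at \<open>x\<close>, which is 0 outside \<open>W\<close>.\<close>
  have atoms: "emeasure \<eta>2 {x} = 0" if x: "x \<in> I - W" for x
  proof -
    have x0: "measure \<rho> (UNIV \<times> {x}) = 0" using x by (auto simp: W_def)
    obtain r where r: "r \<in> W" "r \<le> t0" "r \<le> x" using W_below x by blast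
    have "measure \<rho> ({..r} \<times> {x}) \<le> measure \<rho> (UNIV \<times> {x})" by (intro finite_measure_mono) auto
    then have "measure \<rho> ({..r} \<times> {x}) = 0" using x0 by (simp add: measure_le_0_iff)
    then show ?thesis using e2[of r "{x}"] r by (simp add: L_def)
  qed
  \<comment> \<open>What the half-plane x \<le> y contains outside \<open>U\<close>: pairs with x
    beyond all of \<open>R\<close>, pairs with y before all of \<open>L\<close>, and diagonal points
    of \<open>I\<close> outside \<open>W\<close>.\<close>
  define N1 where "N1 = (- (\<Union>n. {..tr n})) \<times> (UNIV :: real set)"
  define N2 where "N2 = (UNIV :: real set) \<times> (- (\<Union>n. {tl n..}))"
  define N3 where "N3 = {z :: real \<times> real. fst z = snd z \<and> fst z \<in> I - W}"
  have n1: "N1 \<in> null_sets (\<eta>1 \<Otimes>\<^sub>M \<eta>2)"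
    unfolding N1_def using \<eta>1(1,4) \<eta>2(1)
    by (intro \<eta>2.times_in_null_sets1) (auto simp: null_sets_def)
  have n2: "N2 \<in> null_sets (\<eta>1 \<Otimes>\<^sub>M \<eta>2)"
    unfolding N2_def using \<eta>1(1) \<eta>2(1,4)
    by (intro \<eta>2.times_in_null_sets2) (auto simp: null_sets_def)
  have n3: "N3 \<in> null_sets (\<eta>1 \<Otimes>\<^sub>M \<eta>2)"
  proof -
    have "W \<in> sets borel" by (rule sets.countable[OF _ Wc]) simp
    then have V: "I - W \<in> sets borel" by (rule sets.Diff[OF borel_open[OF I(1)]])
    have "{z \<in> space (borel \<Otimes>\<^sub>M borel). fst z = snd z \<and> fst z \<in> V} \<in> sets (borel \<Otimes>\<^sub>M borel)"
      if [measurable]: "V \<in> sets borel" for V :: "real set"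
      by measurable
    from this[OF V] have m: "N3 \<in> sets (\<eta>1 \<Otimes>\<^sub>M \<eta>2)"
      unfolding s2 N3_def space_pair_measure space_borel UNIV_Times_UNIV by (simp only: UNIV_I simp_thms)
    have "emeasure (\<eta>1 \<Otimes>\<^sub>M \<eta>2) N3 = (\<integral>\<^sup>+x. emeasure \<eta>2 (Pair x -` N3) \<partial>\<eta>1)"
      by (rule \<eta>2.emeasure_pair_measure_alt[OF m])
    also have "\<dots> = (\<integral>\<^sup>+x. 0 \<partial>\<eta>1)"
    proof (rule nn_integral_cong)
      fix x
      have "Pair x -` N3 = (if x \<in> I - W then {x} else {})" by (auto simp: N3_def)
      then show "emeasure \<eta>2 (Pair x -` N3) = 0" using atoms by simp
    qed
    finally show ?thesis using m by (simp add: null_sets_def)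
  qed
  \<comment> \<open>If x < y and no point of \<open>W\<close> lies between them, the open interval
    from x to y misses \<open>I\<close>, although \<open>I\<close> has points on both sides of it;
    this contradicts connectedness.\<close>
  have cover: "z \<in> U \<union> (N1 \<union> N2 \<union> N3)" if le: "fst z \<le> snd z" for z
  proof (rule ccontr)
    assume n: "z \<notin> U \<union> (N1 \<union> N2 \<union> N3)"
    have "z \<notin> N1" "z \<notin> N2" using n by auto
    then have "fst z \<in> (\<Union>n. {..tr n})" "snd z \<in> (\<Union>n. {tl n..})"
      by (simp_all add: N1_def N2_def mem_Times_iff not_less)
    then obtain i j where i: "fst z \<le> tr i" and j: "tl j \<le> snd z" by blast
    show False
    proof (cases "fst z = snd z")
      case True
      then have "fst z \<in> I" using interval[OF tlI(1) trI(1), of j "fst z" i] i j by simp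
      moreover have "fst z \<notin> W" using n True by (auto simp: Umem)
      ultimately show False using n True by (auto simp: N3_def)
    next
      case False
      then have lt: "fst z < snd z" using le by simp
      have e: "{fst z<..<snd z} \<inter> I = {}"
      proof (rule ccontr)
        assume "\<not> ?thesis"
        then obtain r where "r \<in> W" "fst z < r" "r < snd z" using ratW[OF lt] by blast
        then have "z \<in> U" unfolding Umem by (intro bexI[of _ r]) auto
        then show False using n by blast
      qed
      have "tr i > snd z"
      proof (rule ccontr)
        assume "\<not> ?thesis"
        then show False using near[OF trI(1)[of i] i _ lt] e by simp
      qed
      moreover have "tl j < fst z"
      proof (rule ccontr)
        assume "\<not> ?thesis"
        then show False using near[OF tlI(1)[of j] _ j lt] e by simp
      qed
      moreover obtain v where "fst z < v" "v < snd z" using dense[OF lt] by blast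
      ultimately have "v \<in> {fst z<..<snd z} \<inter> I"
        using interval[OF tlI(1) trI(1), of j v i] by auto
      then show False using e by blast
    qed
  qed
  have Nn: "N1 \<union> N2 \<union> N3 \<in> null_sets (\<eta>1 \<Otimes>\<^sub>M \<eta>2)" using n1 n2 n3 by auto
  have Fm: "{(x, y). x \<le> y} \<in> sets (\<eta>1 \<Otimes>\<^sub>M \<eta>2)"
  proof -
    have "{z \<in> space (borel \<Otimes>\<^sub>M borel). fst z \<le> snd z} \<in> sets (borel \<Otimes>\<^sub>M (borel :: real measure))" by measurable
    then show ?thesis unfolding s2 by (simp add: space_pair_measure split_beta')
  qed
  have "\<rho> = restr (\<eta>1 \<Otimes>\<^sub>M \<eta>2) {(x, y). x \<le> y}"
  proof (rule measure_eqI)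
    show "sets \<rho> = sets (restr (\<eta>1 \<Otimes>\<^sub>M \<eta>2) {(x, y). x \<le> y})" by (simp add: s2' sets_\<rho>)
    fix X assume "X \<in> sets \<rho>"
    then have X: "X \<in> sets borel" by (simp add: sets_\<rho>)
    have "emeasure \<rho> X = emeasure \<rho> (X \<inter> U)"
      using \<rho>U X Um by (intro emeasure_eq_AE) (auto simp: sets_\<rho>)
    also have "\<dots> = emeasure (\<eta>1 \<Otimes>\<^sub>M \<eta>2) (X \<inter> U)"
      using X Um by (intro eqU) auto
    also have "\<dots> = emeasure (\<eta>1 \<Otimes>\<^sub>M \<eta>2) ({(x, y). x \<le> y} \<inter> X)"
    proof (rule emeasure_eq_AE)
      show "AE z in \<eta>1 \<Otimes>\<^sub>M \<eta>2. z \<in> X \<inter> U \<longleftrightarrow> z \<in> {(x, y). x \<le> y} \<inter> X"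
      proof (rule AE_I'[OF Nn], rule subsetI)
        fix z assume z: "z \<in> {z \<in> space (\<eta>1 \<Otimes>\<^sub>M \<eta>2). \<not> (z \<in> X \<inter> U \<longleftrightarrow> z \<in> {(x, y). x \<le> y} \<inter> X)}"
        have "z \<in> U \<Longrightarrow> fst z \<le> snd z" unfolding Umem by auto
        then have "fst z \<le> snd z" "z \<notin> U" using z by (auto simp: split_beta)
        then show "z \<in> N1 \<union> N2 \<union> N3" using cover[of z] by blast
      qed
    qed (use X Um Fm s2' in auto)
    also have "\<dots> = emeasure (restr (\<eta>1 \<Otimes>\<^sub>M \<eta>2) {(x, y). x \<le> y}) X"
      using X Fm s2' by (subst emeasure_restr) auto
    finally show "emeasure \<rho> X = emeasure (restr (\<eta>1 \<Otimes>\<^sub>M \<eta>2) {(x, y). x \<le> y}) X" .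
  qed
  then show ?thesis using \<eta>1 \<eta>2 by blast
qed

end

section \<open>Identification of the limit\<close>

lemma sigma_finite_plus_measure:
  fixes M N :: "real measure"
  assumes M: "sigma_finite_measure M" "sets M = sets borel" and N: "sigma_finite_measure N" "sets N = sets borel"
  shows "sigma_finite_measure (plus_measure M N)"
proof -
  obtain A :: "nat \<Rightarrow> real set" where A: "range A \<subseteq> sets M" "(\<Union>i. A i) = space M" "\<And>i. emeasure M (A i) \<noteq> \<infinity>"
    using sigma_finite_measure.sigma_finite[OF M(1)] by metis
  obtain B :: "nat \<Rightarrow> real set" where B: "range B \<subseteq> sets N" "(\<Union>i. B i) = space N" "\<And>i. emeasure N (B i) \<noteq> \<infinity>"
    using sigma_finite_measure.sigma_finite[OF N(1)] by metis
  have sp: "space M = UNIV" "space N = UNIV"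
    using sets_eq_imp_space_eq[OF M(2)] sets_eq_imp_space_eq[OF N(2)] by auto
  have m: "A i \<in> sets borel" "B i \<in> sets borel" for i using A(1) B(1) M(2) N(2) by auto
  define C where "C n = A (fst (prod_decode n)) \<inter> B (snd (prod_decode n))" for n
  show ?thesis
  proof (rule sigma_finite_exhaustI[of C])
    show "C n \<in> sets (plus_measure M N)" for n unfolding C_def by (simp add: sets.Int m)
    show "(\<Union>n. C n) = space (plus_measure M N)"
    proof -
      have "x \<in> (\<Union>n. C n)" for x
      proof -
        obtain i j where "x \<in> A i" "x \<in> B j" using A(2) B(2) sp by blast
        then have "x \<in> C (prod_encode (i, j))" by (simp add: C_def)
        then show ?thesis by blast
      qed
      then show ?thesis using sets_eq_imp_space_eq[OF sets_plus_measure[of M N]] by auto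
    qed
    show "emeasure (plus_measure M N) (C n) \<noteq> \<infinity>" for n
    proof -
      have "emeasure M (C n) \<le> emeasure M (A (fst (prod_decode n)))"
        "emeasure N (C n) \<le> emeasure N (B (snd (prod_decode n)))"
        using m M(2) N(2) by (auto intro!: emeasure_mono simp: C_def)
      then have "emeasure M (C n) < \<infinity>" "emeasure N (C n) < \<infinity>"
        using A(3) B(3) by (auto simp: less_top intro: le_less_trans)
      then show ?thesis
        using m by (subst emeasure_plus_measure) (auto simp: M(2) N(2) C_def)
    qed
  qed
qed

lemma real_density_exists:
  fixes L M :: "real measure"
  assumes L: "sigma_finite_measure L" "sets L = sets borel" and M: "sigma_finite_measure M" "sets M = sets borel"
    and le: "\<And>A. A \<in> sets borel \<Longrightarrow> emeasure M A \<le> emeasure L A"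
  shows "\<exists>p :: real \<Rightarrow> real. p \<in> borel_measurable borel \<and> (\<forall>x. 0 \<le> p x) \<and> M = density L (\<lambda>x. ennreal (p x))"
proof -
  interpret L: sigma_finite_measure L by fact
  have "absolutely_continuous L M"
    unfolding absolutely_continuous_def
  proof
    fix A assume "A \<in> null_sets L"
    then show "A \<in> null_sets M" using le[of A] L(2) M(2) by (auto simp: null_sets_def)
  qed
  then obtain f where f: "f \<in> borel_measurable L" "density L f = M"
    using L.Radon_Nikodym[of M] L(2) M(2) by auto
  have fin: "AE x in L. f x \<noteq> \<infinity>"
    using L.sigma_finite_iff_density_finite[OF f(1)] M(1) f(2) by simp
  have [measurable]: "f \<in> borel_measurable borel" using f(1) L(2) by (simp cong: measurable_cong_sets)
  note [measurable_cong] = L(2)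
  have "density L (\<lambda>x. ennreal (enn2real (f x))) = density L f"
  proof (rule density_cong)
    show "AE x in L. ennreal (enn2real (f x)) = f x"
      using fin by eventually_elim (simp add: less_top)
  qed auto
  then show ?thesis using f(2) by (intro exI[of _ "\<lambda>x. enn2real (f x)"]) auto
qed

lemma le_sets_borel: "{(x :: real, y). x \<le> y} \<in> sets borel"
proof -
  have "{z \<in> space (borel \<Otimes>\<^sub>M borel). fst z \<le> snd z} \<in> sets (borel \<Otimes>\<^sub>M (borel :: real measure))"
    by measurable
  then show ?thesis by (subst borel_prod[symmetric]) (simp add: space_pair_measure split_beta')
qed

text \<open>The first factors of both plans have densities with respect to their sum
  \<open>L\<close>, the second ones with respect to their sum \<open>K\<close>. So both plans have
  product densities with respect to \<open>L \<Otimes>\<^sub>M K\<close> restricted to the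
  half-plane, and the argument for entropic plans applies again.\<close>

lemma kellerer_plan_unique:
  assumes "is_kellerer_plan \<mu> \<nu> \<pi>" "is_kellerer_plan \<mu> \<nu> \<pi>'"
  shows "\<pi> = \<pi>'"
proof -
  let ?F = "{(x :: real, y :: real). x \<le> y}"
  obtain a b where a: "sigma_finite_measure a" "sets a = sets borel" and b: "sigma_finite_measure b" "sets b = sets borel"
    and \<pi>: "\<pi> = restr (a \<Otimes>\<^sub>M b) ?F"
    using assms(1) unfolding is_kellerer_plan_def by blast
  obtain a' b' where a': "sigma_finite_measure a'" "sets a' = sets borel" and b': "sigma_finite_measure b'" "sets b' = sets borel"
    and \<pi>': "\<pi>' = restr (a' \<Otimes>\<^sub>M b') ?F"
    using assms(2) unfolding is_kellerer_plan_def by blast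
  define L where "L = plus_measure a a'"
  define K where "K = plus_measure b b'"
  have L: "sigma_finite_measure L" "sets L = sets borel" and K: "sigma_finite_measure K" "sets K = sets borel"
    using sigma_finite_plus_measure[OF a a'] sigma_finite_plus_measure[OF b b'] by (auto simp: L_def K_def)
  have le: "emeasure a X \<le> emeasure L X" "emeasure a' X \<le> emeasure L X"
    "emeasure b X \<le> emeasure K X" "emeasure b' X \<le> emeasure K X" if "X \<in> sets borel" for X
    using that a a' b b' by (auto simp: L_def K_def emeasure_plus_measure)
  obtain p where p [measurable]: "p \<in> borel_measurable borel" and p0: "\<And>x. 0 \<le> p x" and ap: "a = density L (\<lambda>x. ennreal (p x))"
    using real_density_exists[OF L a le(1)] by blast
  obtain p' where p' [measurable]: "p' \<in> borel_measurable borel" and p'0: "\<And>x. 0 \<le> p' x" and ap': "a' = density L (\<lambda>x. ennreal (p' x))"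
    using real_density_exists[OF L a' le(2)] by blast
  obtain q where q [measurable]: "q \<in> borel_measurable borel" and q0: "\<And>x. 0 \<le> q x" and bq: "b = density K (\<lambda>x. ennreal (q x))"
    using real_density_exists[OF K b le(3)] by blast
  obtain q' where q' [measurable]: "q' \<in> borel_measurable borel" and q'0: "\<And>x. 0 \<le> q' x" and bq': "b' = density K (\<lambda>x. ennreal (q' x))"
    using real_density_exists[OF K b' le(4)] by blast
  note [measurable_cong] = L(2) K(2)
  have LK: "sets (L \<Otimes>\<^sub>M K) = sets (borel \<Otimes>\<^sub>M borel)" using L K by (intro sets_pair_measure_cong)
  have F: "?F \<in> sets (L \<Otimes>\<^sub>M K)" unfolding LK using le_sets_borel by (subst borel_prod)
  have LK': "sets (restr (L \<Otimes>\<^sub>M K) ?F) = sets borel" unfolding sets_restr using LK by (subst (asm) borel_prod)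
  have e: "restr (density L (\<lambda>x. ennreal (f x)) \<Otimes>\<^sub>M density K (\<lambda>x. ennreal (g x))) ?F =
      density (restr (L \<Otimes>\<^sub>M K) ?F) (\<lambda>z. ennreal (f (fst z) * g (snd z)))"
    if f: "f \<in> borel_measurable borel" "\<And>x. 0 \<le> f x" and g: "g \<in> borel_measurable borel" "\<And>x. 0 \<le> g x"
      and sf: "sigma_finite_measure (density K (\<lambda>x. ennreal (g x)))" for f g :: "real \<Rightarrow> real"
  proof -
    have [measurable]: "f \<in> borel_measurable borel" "g \<in> borel_measurable borel" by fact+
    have [measurable]: "indicator ?F \<in> borel_measurable (L \<Otimes>\<^sub>M K)" using F by simp
    have "density L (\<lambda>x. ennreal (f x)) \<Otimes>\<^sub>M density K (\<lambda>x. ennreal (g x)) =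
        density (L \<Otimes>\<^sub>M K) (\<lambda>z. ennreal (f (fst z) * g (snd z)))"
      using K(1) sf f(2) g(2) by (subst pair_measure_density) (auto simp: split_beta' ennreal_mult)
    then show ?thesis
      unfolding restr_def
      by (simp only:) (subst (1 2) density_density_eq, auto simp: mult.commute intro!: arg_cong[where f = "density _"])
  qed
  have 1: "\<pi> = density (restr (L \<Otimes>\<^sub>M K) ?F) (\<lambda>z. ennreal (p (fst z) * q (snd z)))"
    unfolding \<pi> using e[OF p p0 q q0] b(1) by (simp add: ap bq)
  have 2: "\<pi>' = density (restr (L \<Otimes>\<^sub>M K) ?F) (\<lambda>z. ennreal (p' (fst z) * q' (snd z)))"
    unfolding \<pi>' using e[OF p' p'0 q' q'0] b'(1) by (simp add: ap' bq')
  show ?thesis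
    by (rule factored_density_unique[OF LK' p q p' q' p0 q0 p'0 q'0 1 2])
      (use assms in \<open>auto simp: is_kellerer_plan_def\<close>)
qed

text \<open>The complement of the support is a union of null open sets, of which countably many
  suffice by Lindelof's theorem.\<close>

lemma AE_msupport:
  fixes M :: "real measure"
  assumes "sets M = sets borel"
  shows "AE x in M. x \<in> msupport M"
proof -
  define F where "F = {U. open U \<and> emeasure M U = 0}"
  obtain F' where F': "F' \<subseteq> F" "countable F'" "\<Union>F' = \<Union>F"
    using Lindelof[of F] by (auto simp: F_def)
  have "(\<Union>U\<in>F'. U) \<in> null_sets M"
    using F' assms by (intro null_sets_UN') (auto simp: F_def null_sets_def)
  then show ?thesis
    by (rule AE_I') (use F'(3) in \<open>auto simp: msupport_def F_def not_less zero_less_iff_neq_zero\<close>)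
qed

lemma countable_components:
  fixes E :: "real set"
  assumes "open E" shows "countable (components E)"
  by (rule countable_disjoint_open_subsets)
    (use assms pairwise_disjoint_components in \<open>auto simp: open_components pairwise_def disjnt_def\<close>)

context limit_plan
begin

text \<open>The two inequalities in \<open>E_plus\<close> are exactly the positivity of the two
  crossing masses at \<open>t\<close> that the factorization requires. Uniqueness then evaluates the
  \<open>THE\<close> in \<open>kellerer_plan\<close>.\<close>

lemma kellerer_plan_part:
  assumes I: "I \<in> components (E_plus \<mu> \<nu>)"
    and T: "countable T" "AE z in part I. fst z = snd z \<longrightarrow> fst z \<in> T"
  shows "kellerer_plan (mu_plus_comp \<mu> \<nu> I) (nu_plus_comp \<mu> \<nu> I) = part I"
proof -
  have IE: "I \<subseteq> E_plus \<mu> \<nu>" using in_components_subset[OF I] .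
  have "local_product (part I) I T"
  proof (intro local_product.intro local_product_axioms.intro)
    show "finite_measure (part I)" using finite_part component_sets[OF I] by simp
    show "connected I" "I \<noteq> {}" "open I"
      using in_components_connected[OF I] in_components_nonempty[OF I] component_sets[OF I] by auto
    fix t assume t: "t \<in> I"
    note e = part_eq_on_rectangle[OF I t]
    show "measure (part I) (A \<times> B) * measure (part I) (A' \<times> B') = measure (part I) (A \<times> B') * measure (part I) (A' \<times> B)"
      if "A \<in> sets borel" "A' \<in> sets borel" "B \<in> sets borel" "B' \<in> sets borel"
        "A \<union> A' \<subseteq> {..t}" "B \<union> B' \<subseteq> {t..}" for A A' B B'
      using that prod_right[OF that] by (simp add: e)
    have tE: "t \<in> E_plus \<mu> \<nu>" using t IE by blast
    have "measure (part I) ({..t} \<times> {t<..}) = measure \<pi> ({..t} \<times> {t<..})" by (rule e) auto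
    then show "0 < measure (part I) ({..t} \<times> {t<..})"
      using tE by (simp add: measure_right E_plus_def)
    have "measure (part I) ({..<t} \<times> {t..}) = measure \<pi> ({..<t} \<times> {t..})" by (rule e) auto
    then show "0 < measure (part I) ({..<t} \<times> {t..})"
      using tE by (simp add: measure_right_left E_plus_def)
  qed (use AE_part_in[OF I] T in auto)
  from local_product.factorization[OF this]
  have "is_kellerer_plan (mu_plus_comp \<mu> \<nu> I) (nu_plus_comp \<mu> \<nu> I) (part I)"
    using part_Marg[OF I] by (simp add: is_kellerer_plan_def)
  then show ?thesis
    unfolding kellerer_plan_def using kellerer_plan_unique by (intro the_equality) blast+
qed

text \<open>A diagonal pair would have its common coordinate both inside and outside the separating
  set.\<close>

lemma diagonal_of_singular:
  assumes I: "I \<in> components (E_plus \<mu> \<nu>)"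
    and s: "mutually_singular (mu_plus_comp \<mu> \<nu> I) (nu_plus_comp \<mu> \<nu> I)"
  shows "AE z in part I. fst z \<noteq> snd z"
proof -
  obtain A where A [measurable]: "A \<in> sets borel" and 0: "emeasure (mu_plus_comp \<mu> \<nu> I) A = 0" "emeasure (nu_plus_comp \<mu> \<nu> I) (- A) = 0"
    using s by (auto simp: mutually_singular_def)
  have "AE x in mu_plus_comp \<mu> \<nu> I. x \<notin> A"
    by (rule AE_I[of _ _ A]) (use A 0 in \<open>auto simp: mu_plus_comp_def\<close>)
  moreover have "AE x in nu_plus_comp \<mu> \<nu> I. x \<in> A"
    by (rule AE_I[of _ _ "- A"]) (use A 0 in \<open>auto simp: nu_plus_comp_def\<close>)
  ultimately have "AE z in part I. fst z \<notin> A" "AE z in part I. snd z \<in> A"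
    using Marg_AE_fst_iff[OF part_Marg[OF I], of "\<lambda>x. x \<notin> A"] Marg_AE_snd_iff[OF part_Marg[OF I], of "\<lambda>x. x \<in> A"]
    by auto
  then show ?thesis by eventually_elim auto
qed

lemma diagonal_of_finite_support:
  assumes I: "I \<in> components (E_plus \<mu> \<nu>)" and f: "finite (msupport \<mu>)"
  shows "AE z in part I. fst z \<in> msupport \<mu>"
proof (rule AE_part)
  have "msupport \<mu> \<in> sets borel" using finite_imp_closed[OF f] by simp
  then have "AE z in \<pi>. fst z \<in> msupport \<mu>"
    using Marg_AE_fst_iff[OF M, of "\<lambda>x. x \<in> msupport \<mu>"] AE_msupport[OF m.events_eq_borel] by (simp add: pred_def)
  then show "AE z in \<pi>. mid z \<in> I \<longrightarrow> fst z \<in> msupport \<mu>" by eventually_elim auto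
qed (use component_sets[OF I] in simp)

lemma sum_parts:
  assumes X: "X \<in> sets borel"
  shows "(\<integral>\<^sup>+I. emeasure (part I) X \<partial>count_space (components (E_plus \<mu> \<nu>))) = emeasure \<pi> (mid -` E_plus \<mu> \<nu> \<inter> X)"
proof -
  have "(\<integral>\<^sup>+I. emeasure (part I) X \<partial>count_space (components (E_plus \<mu> \<nu>))) =
      (\<integral>\<^sup>+I. emeasure \<pi> (mid -` I \<inter> X) \<partial>count_space (components (E_plus \<mu> \<nu>)))"
    using component_sets X by (intro nn_integral_cong) (auto simp: emeasure_part)
  also have "\<dots> = emeasure \<pi> (\<Union>I\<in>components (E_plus \<mu> \<nu>). mid -` I \<inter> X)"
  proof (rule emeasure_UN_countable[symmetric])
    show "mid -` I \<inter> X \<in> sets \<pi>" if "I \<in> components (E_plus \<mu> \<nu>)" for I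
      using X mid_vimage component_sets[OF that] by (intro sets.Int) (auto simp: sets_\<pi>[symmetric])
    show "countable (components (E_plus \<mu> \<nu>))" by (rule countable_components[OF open_E_plus[OF \<mu> \<nu>]])
    show "disjoint_family_on (\<lambda>I. mid -` I \<inter> X) (components (E_plus \<mu> \<nu>))"
      unfolding disjoint_family_on_def using components_eq by fastforce
  qed
  also have "(\<Union>I\<in>components (E_plus \<mu> \<nu>). mid -` I \<inter> X) = mid -` (\<Union>(components (E_plus \<mu> \<nu>))) \<inter> X" by blast
  finally show ?thesis unfolding Union_components .
qed

lemma emeasure_mu_plus:
  assumes X: "X \<in> sets borel"
  shows "emeasure (mu_plus \<mu> \<nu>) X = emeasure \<pi> (mid -` E_plus \<mu> \<nu> \<inter> (X \<times> UNIV))"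
proof -
  have "emeasure (mu_plus \<mu> \<nu>) X = (\<integral>\<^sup>+I. emeasure (mu_plus_comp \<mu> \<nu> I) X \<partial>count_space (components (E_plus \<mu> \<nu>)))"
    unfolding mu_plus_def using X by (intro emeasure_sum_measure) (auto simp: mu_plus_comp_def)
  also have "\<dots> = (\<integral>\<^sup>+I. emeasure (part I) (X \<times> UNIV) \<partial>count_space (components (E_plus \<mu> \<nu>)))"
    using X by (intro nn_integral_cong) (simp add: Marg_measure_fst(2)[OF part_Marg])
  also have "\<dots> = emeasure \<pi> (mid -` E_plus \<mu> \<nu> \<inter> (X \<times> UNIV))"
    using X by (intro sum_parts Times_borel) auto
  finally show ?thesis .
qed

lemma emeasure_sum_nu_plus_comp:
  assumes X: "X \<in> sets borel"
  shows "emeasure (sum_measure (components (E_plus \<mu> \<nu>)) (nu_plus_comp \<mu> \<nu>)) X = emeasure \<pi> (mid -` E_plus \<mu> \<nu> \<inter> (UNIV \<times> X))"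
proof -
  have "emeasure (sum_measure (components (E_plus \<mu> \<nu>)) (nu_plus_comp \<mu> \<nu>)) X =
      (\<integral>\<^sup>+I. emeasure (nu_plus_comp \<mu> \<nu> I) X \<partial>count_space (components (E_plus \<mu> \<nu>)))"
    using X by (intro emeasure_sum_measure) (auto simp: nu_plus_comp_def)
  also have "\<dots> = (\<integral>\<^sup>+I. emeasure (part I) (UNIV \<times> X) \<partial>count_space (components (E_plus \<mu> \<nu>)))"
    using X by (intro nn_integral_cong) (simp add: Marg_measure_snd(2)[OF part_Marg])
  also have "\<dots> = emeasure \<pi> (mid -` E_plus \<mu> \<nu> \<inter> (UNIV \<times> X))"
    using X by (intro sum_parts Times_borel) auto
  finally show ?thesis .
qed

end

lemma mu_minus_comp_swap: "mu_minus_comp \<mu> \<nu> I = nu_plus_comp \<nu> \<mu> I"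
  by (simp add: mu_minus_comp_def nu_plus_comp_def)

lemma nu_minus_comp_swap: "nu_minus_comp \<mu> \<nu> I = mu_plus_comp \<nu> \<mu> I"
  by (simp add: nu_minus_comp_def mu_plus_comp_def)

context limit_plan
begin

section \<open>The immobile part and the assembly of the plan\<close>

lemma finite_endpoints_countable: "countable (finite_endpoints \<mu> \<nu>)"
proof -
  have c: "countable (components (E_plus \<mu> \<nu>) \<union> components (E_minus \<mu> \<nu>))"
    unfolding E_minus_swap using countable_components open_E_plus[OF \<mu> \<nu>] open_E_plus[OF \<nu> \<mu>] by simp
  show ?thesis
    unfolding finite_endpoints_def Let_def
    by (intro countable_Un countable_image) (auto intro: countable_subset[OF _ c])
qed

text \<open>Off the diagonal the midpoint lies strictly between the coordinates, hence, up to a null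
  set, in one of the two moving regions.\<close>

lemma AE_diagonal: "AE z in \<pi>. mid z \<in> E_eq \<mu> \<nu> \<longrightarrow> fst z = snd z"
  using AE_up AE_down
proof eventually_elim
  case (elim z)
  show ?case
  proof (intro impI, rule ccontr)
    assume e: "mid z \<in> E_eq \<mu> \<nu>" and n: "fst z \<noteq> snd z"
    then consider "fst z < snd z" | "snd z < fst z" by linarith
    then have "mid z \<in> E_plus \<mu> \<nu> \<union> E_plus \<nu> \<mu>"
    proof cases
      case 1
      then have "mid z \<in> {fst z<..<snd z}" by (simp add: mid_def field_simps)
      then show ?thesis using 1 elim(1) by blast
    next
      case 2
      then have "mid z \<in> {snd z<..<fst z}" by (simp add: mid_def field_simps)
      then show ?thesis using 2 elim(2) by blast
    qed
    then show False using e by (simp add: E_eq_def E_minus_swap)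
  qed
qed

lemma E_sets: "E_plus \<mu> \<nu> \<in> sets borel" "E_minus \<mu> \<nu> \<in> sets borel" "E_eq \<mu> \<nu> \<in> sets borel"
  unfolding E_eq_def E_minus_swap using open_E_plus[OF \<mu> \<nu>] open_E_plus[OF \<nu> \<mu>] by auto

lemma emeasure_split:
  assumes X: "X \<in> sets borel"
  shows "emeasure \<pi> X = emeasure \<pi> (mid -` E_plus \<mu> \<nu> \<inter> X) + emeasure \<pi> (mid -` E_minus \<mu> \<nu> \<inter> X)
    + emeasure \<pi> (mid -` E_eq \<mu> \<nu> \<inter> X)"
proof -
  have m: "mid -` E \<inter> X \<in> sets \<pi>" if "E \<in> sets borel" for E
    using mid_vimage[OF that] X by (intro sets.Int) (simp_all add: sets_\<pi>[symmetric])
  have U: "X = (mid -` E_plus \<mu> \<nu> \<inter> X \<union> mid -` E_minus \<mu> \<nu> \<inter> X) \<union> mid -` E_eq \<mu> \<nu> \<inter> X"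
    by (auto simp: E_eq_def)
  have "emeasure \<pi> X = emeasure \<pi> ((mid -` E_plus \<mu> \<nu> \<inter> X \<union> mid -` E_minus \<mu> \<nu> \<inter> X) \<union> mid -` E_eq \<mu> \<nu> \<inter> X)"
    using U by simp
  also have "\<dots> = emeasure \<pi> (mid -` E_plus \<mu> \<nu> \<inter> X \<union> mid -` E_minus \<mu> \<nu> \<inter> X) + emeasure \<pi> (mid -` E_eq \<mu> \<nu> \<inter> X)"
  proof (rule plus_emeasure[symmetric])
    show "mid -` E_plus \<mu> \<nu> \<inter> X \<union> mid -` E_minus \<mu> \<nu> \<inter> X \<in> sets \<pi>"
      by (intro sets.Un m E_sets)
    show "(mid -` E_plus \<mu> \<nu> \<inter> X \<union> mid -` E_minus \<mu> \<nu> \<inter> X) \<inter> (mid -` E_eq \<mu> \<nu> \<inter> X) = {}"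
      unfolding E_eq_def by blast
  qed (rule m, rule E_sets)
  also have "emeasure \<pi> (mid -` E_plus \<mu> \<nu> \<inter> X \<union> mid -` E_minus \<mu> \<nu> \<inter> X) =
      emeasure \<pi> (mid -` E_plus \<mu> \<nu> \<inter> X) + emeasure \<pi> (mid -` E_minus \<mu> \<nu> \<inter> X)"
  proof (rule plus_emeasure[symmetric])
    show "mid -` E_plus \<mu> \<nu> \<inter> X \<inter> (mid -` E_minus \<mu> \<nu> \<inter> X) = {}"
      using E_plus_disjoint[of \<mu> \<nu>] unfolding E_minus_swap by blast
  qed (rule m, rule E_sets)+
  finally show ?thesis .
qed

abbreviation swapped :: "(real \<times> real) measure" where
  "swapped \<equiv> distr \<pi> borel (\<lambda>(x, y). (y, x))"

lemma emeasure_swapped: "X \<in> sets borel \<Longrightarrow> emeasure swapped X = emeasure \<pi> ((\<lambda>(x, y). (y, x)) -` X)"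
  by (subst emeasure_distr[OF swap_measurable]) (auto simp: space_\<pi>)

lemma mid_swap: "(\<lambda>(x, y). (y, x)) -` (mid -` E \<inter> X) = mid -` E \<inter> (\<lambda>(x, y). (y, x)) -` X"
  by (auto simp: mid_def add.commute)

lemma emeasure_mu_minus:
  assumes X: "X \<in> sets borel"
  shows "emeasure (mu_minus \<mu> \<nu>) X = emeasure \<pi> (mid -` E_minus \<mu> \<nu> \<inter> (X \<times> UNIV))"
proof -
  interpret S: limit_plan \<nu> \<mu> swapped by (rule limit_plan_swap[OF limit_plan_axioms])
  have "mu_minus_comp \<mu> \<nu> = nu_plus_comp \<nu> \<mu>" by (rule ext) (rule mu_minus_comp_swap)
  then have "emeasure (mu_minus \<mu> \<nu>) X = emeasure swapped (mid -` E_plus \<nu> \<mu> \<inter> (UNIV \<times> X))"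
    unfolding mu_minus_def E_minus_swap using S.emeasure_sum_nu_plus_comp[OF X] by simp
  also have "\<dots> = emeasure \<pi> ((\<lambda>(x, y). (y, x)) -` (mid -` E_plus \<nu> \<mu> \<inter> (UNIV \<times> X)))"
  proof (rule emeasure_swapped)
    show "mid -` E_plus \<nu> \<mu> \<inter> (UNIV \<times> X) \<in> sets borel"
      using mid_vimage[of "E_plus \<nu> \<mu>"] X open_E_plus[OF \<nu> \<mu>] by (intro sets.Int Times_borel) (auto simp: sets_\<pi>)
  qed
  also have "(\<lambda>(x, y). (y, x)) -` (mid -` E_plus \<nu> \<mu> \<inter> (UNIV \<times> X)) = mid -` E_minus \<mu> \<nu> \<inter> (X \<times> UNIV)"
    unfolding mid_swap by (auto simp: E_minus_swap)
  finally show ?thesis .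
qed

text \<open>Almost all of this mass lies on the diagonal, so its first marginal determines
  it.\<close>

definition stay :: "real measure" where
  "stay = distr (restr \<pi> (mid -` E_eq \<mu> \<nu>)) borel fst"

lemma emeasure_stay:
  assumes X: "X \<in> sets borel"
  shows "emeasure stay X = emeasure \<pi> (mid -` E_eq \<mu> \<nu> \<inter> (X \<times> UNIV))"
proof -
  have m: "fst \<in> measurable (restr \<pi> (mid -` E_eq \<mu> \<nu>)) borel" unfolding restr_def by simp
  have "emeasure stay X = emeasure (restr \<pi> (mid -` E_eq \<mu> \<nu>)) (fst -` X \<inter> space (restr \<pi> (mid -` E_eq \<mu> \<nu>)))"
    unfolding stay_def by (rule emeasure_distr[OF m X])
  also have "fst -` X \<inter> space (restr \<pi> (mid -` E_eq \<mu> \<nu>)) = X \<times> UNIV" by (auto simp: restr_def space_\<pi>)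
  also have "emeasure (restr \<pi> (mid -` E_eq \<mu> \<nu>)) (X \<times> UNIV) = emeasure \<pi> (mid -` E_eq \<mu> \<nu> \<inter> (X \<times> UNIV))"
    by (rule emeasure_restr) (use X E_sets in auto)
  finally show ?thesis .
qed

lemma sets_stay: "sets stay = sets borel" by (simp add: stay_def)

lemma emeasure_\<mu>_split:
  assumes X: "X \<in> sets borel"
  shows "emeasure \<mu> X = emeasure (mu_plus \<mu> \<nu>) X + emeasure (mu_minus \<mu> \<nu>) X + emeasure stay X"
  using emeasure_split[of "X \<times> UNIV"] Marg_measure_fst(2)[OF M X] X
  by (simp add: Times_borel emeasure_mu_plus emeasure_mu_minus emeasure_stay)

text \<open>Additivity over the three regions, solved for the last term. All masses are finite, so
  the real difference in \<open>mu_eq\<close> is nonnegative and its truncation is harmless.\<close>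

lemma emeasure_stay_atom:
  "emeasure stay {x} = ennreal (measure \<mu> {x} - measure (mu_plus \<mu> \<nu>) {x} - measure (mu_minus \<mu> \<nu>) {x})"
proof -
  have fin: "emeasure (mu_plus \<mu> \<nu>) {x} = ennreal (measure (mu_plus \<mu> \<nu>) {x})"
    "emeasure (mu_minus \<mu> \<nu>) {x} = ennreal (measure (mu_minus \<mu> \<nu>) {x})"
    "emeasure stay {x} = ennreal (measure stay {x})"
    by (rule emeasure_eq_ennreal_measure,
        simp add: emeasure_mu_plus emeasure_mu_minus emeasure_stay P.emeasure_eq_measure)+
  have "ennreal (measure \<mu> {x}) = ennreal (measure (mu_plus \<mu> \<nu>) {x} + measure (mu_minus \<mu> \<nu>) {x} + measure stay {x})"
    using emeasure_\<mu>_split[of "{x}"] by (simp add: fin m.emeasure_eq_measure)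
  then have "measure \<mu> {x} = measure (mu_plus \<mu> \<nu>) {x} + measure (mu_minus \<mu> \<nu>) {x} + measure stay {x}"
    by (subst (asm) ennreal_inj) auto
  then show ?thesis by (simp add: fin)
qed

text \<open>The components avoid \<open>E_eq\<close> and the added atoms sit at endpoints, so none
  of the moving mass of \<mu> starts in \<open>Y\<close>.\<close>

lemma stay_outside_endpoints:
  assumes Y: "Y \<in> sets borel" "Y \<subseteq> E_eq \<mu> \<nu> - finite_endpoints \<mu> \<nu>"
  shows "emeasure stay Y = emeasure \<mu> Y"
proof -
  have "emeasure (mu_plus \<mu> \<nu>) Y = 0"
  proof -
    have "emeasure (mu_plus_comp \<mu> \<nu> I) Y = 0" if I: "I \<in> components (E_plus \<mu> \<nu>)" for I
    proof -
      have "I \<inter> Y = {}" using in_components_subset[OF I] Y(2) by (auto simp: E_eq_def)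
      moreover have "Inf I \<notin> Y" if "bdd_below I"
        using that I Y(2) by (auto simp: finite_endpoints_def Let_def)
      ultimately show ?thesis
        unfolding mu_plus_comp_def using Y(1) component_sets[OF I]
        by (subst emeasure_plus_measure) (auto simp: left_atom_def emeasure_atom emeasure_restr)
    qed
    then show ?thesis
      unfolding mu_plus_def using Y(1)
      by (subst emeasure_sum_measure) (auto simp: mu_plus_comp_def nn_integral_0_iff_AE AE_count_space)
  qed
  moreover have "emeasure (mu_minus \<mu> \<nu>) Y = 0"
  proof -
    have "emeasure (mu_minus_comp \<mu> \<nu> I) Y = 0" if I: "I \<in> components (E_minus \<mu> \<nu>)" for I
    proof -
      have "I \<inter> Y = {}" using in_components_subset[OF I] Y(2) by (auto simp: E_eq_def)
      moreover have "Sup I \<notin> Y" if "bdd_above I"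
        using that I Y(2) by (auto simp: finite_endpoints_def Let_def)
      moreover have "I \<in> sets borel"
        using I open_components[OF open_E_plus[OF \<nu> \<mu>]] by (auto simp: E_minus_swap)
      ultimately show ?thesis
        unfolding mu_minus_comp_def using Y(1)
        by (subst emeasure_plus_measure) (auto simp: right_atom_def emeasure_atom emeasure_restr)
    qed
    then show ?thesis
      unfolding mu_minus_def using Y(1)
      by (subst emeasure_sum_measure) (auto simp: mu_minus_comp_def nn_integral_0_iff_AE AE_count_space)
  qed
  ultimately show ?thesis using emeasure_\<mu>_split[OF Y(1)] by simp
qed

lemma AE_stay: "AE x in stay. x \<in> E_eq \<mu> \<nu>"
proof -
  have "emeasure stay (- E_eq \<mu> \<nu>) = emeasure \<pi> {}"
    unfolding emeasure_stay[OF borel_comp[OF E_sets(3)]]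
  proof (rule emeasure_eq_AE)
    show "AE z in \<pi>. z \<in> mid -` E_eq \<mu> \<nu> \<inter> (- E_eq \<mu> \<nu>) \<times> UNIV \<longleftrightarrow> z \<in> {}"
      using AE_diagonal by eventually_elim (auto simp: mid_def)
    show "mid -` E_eq \<mu> \<nu> \<inter> (- E_eq \<mu> \<nu>) \<times> UNIV \<in> sets \<pi>"
      using E_sets by (intro sets.Int mid_vimage Times_sets) auto
  qed simp
  then show ?thesis
    using E_sets(3) by (intro AE_I[of _ _ "- E_eq \<mu> \<nu>"]) (auto simp: sets_stay)
qed

text \<open>There are only countably many endpoints, so the two measures can be compared off them
  and at each of them separately.\<close>

lemma stay_eq_mu_eq: "stay = mu_eq \<mu> \<nu>"
proof (rule measure_eqI)
  let ?B = "finite_endpoints \<mu> \<nu>"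
  show "sets stay = sets (mu_eq \<mu> \<nu>)" by (simp add: sets_stay mu_eq_def)
  fix X assume "X \<in> sets stay"
  then have X: "X \<in> sets borel" by (simp add: sets_stay)
  have B: "?B \<in> sets borel" by (rule sets.countable[OF _ finite_endpoints_countable]) simp
  let ?Y = "- ?B \<inter> E_eq \<mu> \<nu> \<inter> X"
  have Ym: "?Y \<in> sets borel" using B E_sets X by auto
  have "emeasure stay X = emeasure stay (?Y \<union> (\<Union>x\<in>?B. {x} \<inter> X))"
  proof (rule emeasure_eq_AE)
    show "AE x in stay. x \<in> X \<longleftrightarrow> x \<in> ?Y \<union> (\<Union>x\<in>?B. {x} \<inter> X)"
      using AE_stay by eventually_elim auto
    have "(\<Union>x\<in>?B. {x} \<inter> X) = ?B \<inter> X" by auto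
    then show "?Y \<union> (\<Union>x\<in>?B. {x} \<inter> X) \<in> sets stay" using Ym B X by (simp add: sets_stay sets.Un sets.Int)
  qed (use X in \<open>simp add: sets_stay\<close>)
  also have "\<dots> = emeasure stay ?Y + emeasure stay (\<Union>x\<in>?B. {x} \<inter> X)"
  proof (rule plus_emeasure[symmetric])
    have "(\<Union>x\<in>?B. {x} \<inter> X) = ?B \<inter> X" by auto
    then show "(\<Union>x\<in>?B. {x} \<inter> X) \<in> sets stay" using B X by (simp add: sets_stay sets.Int)
  qed (use Ym in \<open>auto simp: sets_stay\<close>)
  also have "emeasure stay ?Y = emeasure \<mu> ?Y"
    by (rule stay_outside_endpoints[OF Ym]) auto
  also have "emeasure stay (\<Union>x\<in>?B. {x} \<inter> X) = (\<integral>\<^sup>+x. emeasure stay ({x} \<inter> X) \<partial>count_space ?B)"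
    using X by (intro emeasure_UN_countable finite_endpoints_countable) (auto simp: sets_stay disjoint_family_on_def)
  also have "\<dots> = (\<integral>\<^sup>+x. emeasure (atom (measure \<mu> {x} - measure (mu_plus \<mu> \<nu>) {x} - measure (mu_minus \<mu> \<nu>) {x}) x) X \<partial>count_space ?B)"
    using X by (intro nn_integral_cong) (auto simp: emeasure_atom emeasure_stay_atom indicator_def)
  also have "emeasure \<mu> ?Y + \<dots> = emeasure (mu_eq \<mu> \<nu>) X"
    unfolding mu_eq_def using X B E_sets
    by (subst emeasure_plus_measure) (auto simp: emeasure_restr emeasure_sum_measure)
  finally show "emeasure stay X = emeasure (mu_eq \<mu> \<nu>) X" .
qed

lemma emeasure_diagonal_mu_eq:
  assumes X: "X \<in> sets borel"
  shows "emeasure (distr (mu_eq \<mu> \<nu>) borel (\<lambda>x. (x, x))) X = emeasure \<pi> (mid -` E_eq \<mu> \<nu> \<inter> X)"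
proof -
  have dm: "(\<lambda>x. (x, x)) \<in> measurable borel (borel :: (real \<times> real) measure)"
    unfolding borel_prod[symmetric] by measurable
  then have d: "(\<lambda>x. (x, x)) \<in> measurable stay (borel :: (real \<times> real) measure)"
    using sets_stay by (simp cong: measurable_cong_sets)
  define D where "D = (\<lambda>x. (x, x)) -` X"
  have Dm: "D \<in> sets borel" using measurable_sets[OF dm X] by (simp add: D_def)
  have "emeasure (distr (mu_eq \<mu> \<nu>) borel (\<lambda>x. (x, x))) X = emeasure stay D"
    unfolding stay_eq_mu_eq[symmetric] D_def
    using sets_eq_imp_space_eq[OF sets_stay] by (subst emeasure_distr[OF d X]) simp
  also have "\<dots> = emeasure \<pi> (mid -` E_eq \<mu> \<nu> \<inter> (D \<times> UNIV))" by (rule emeasure_stay[OF Dm])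
  also have "\<dots> = emeasure \<pi> (mid -` E_eq \<mu> \<nu> \<inter> X)"
  proof (rule emeasure_eq_AE)
    show "AE z in \<pi>. z \<in> mid -` E_eq \<mu> \<nu> \<inter> D \<times> UNIV \<longleftrightarrow> z \<in> mid -` E_eq \<mu> \<nu> \<inter> X"
      using AE_diagonal by eventually_elim (auto simp: D_def mem_Times_iff)
    show "mid -` E_eq \<mu> \<nu> \<inter> D \<times> UNIV \<in> sets \<pi>"
      using E_sets Dm by (intro sets.Int mid_vimage Times_sets) auto
    show "mid -` E_eq \<mu> \<nu> \<inter> X \<in> sets \<pi>"
      using E_sets X by (intro sets.Int mid_vimage) (auto simp: sets_\<pi>)
  qed
  finally show ?thesis .
qed

text \<open>Summed over the components, the parts form the plan restricted to midpoints in
  \<open>E_plus\<close>; exchange of the coordinates gives the same for \<open>E_minus\<close>, and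
  the diagonal term accounts for \<open>E_eq\<close>.\<close>

lemma kellerer_transport_eq:
  assumes diag: "\<And>I. I \<in> components (E_plus \<mu> \<nu>) \<Longrightarrow>
      \<exists>T. countable T \<and> (AE z in limit_plan.part \<pi> I. fst z = snd z \<longrightarrow> fst z \<in> T)"
    and diag': "\<And>I. I \<in> components (E_plus \<nu> \<mu>) \<Longrightarrow>
      \<exists>T. countable T \<and> (AE z in limit_plan.part swapped I. fst z = snd z \<longrightarrow> fst z \<in> T)"
  shows "kellerer_transport \<mu> \<nu> = \<pi>"
proof (rule measure_eqI)
  interpret S: limit_plan \<nu> \<mu> swapped by (rule limit_plan_swap[OF limit_plan_axioms])
  show "sets (kellerer_transport \<mu> \<nu>) = sets \<pi>" by (simp add: kellerer_transport_def sets_\<pi>)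
  fix X assume "X \<in> sets (kellerer_transport \<mu> \<nu>)"
  then have X: "X \<in> sets borel" by (simp add: kellerer_transport_def)
  have k1: "kellerer_plan (mu_plus_comp \<mu> \<nu> I) (nu_plus_comp \<mu> \<nu> I) = part I"
    if "I \<in> components (E_plus \<mu> \<nu>)" for I
    using diag[OF that] kellerer_plan_part[OF that] by blast
  have swm: "(\<lambda>(x, y). (y, x)) \<in> measurable borel (borel :: (real \<times> real) measure)"
    unfolding borel_prod[symmetric] by measurable
  have Xs: "(\<lambda>(x, y). (y, x)) -` X \<in> sets borel"
    using measurable_sets[OF swm X] by simp
  have k2: "emeasure (kellerer_plan_rev (mu_minus_comp \<mu> \<nu> I) (nu_minus_comp \<mu> \<nu> I)) X
      = emeasure (S.part I) ((\<lambda>(x, y). (y, x)) -` X)"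
    if I: "I \<in> components (E_plus \<nu> \<mu>)" for I
  proof -
    have "kellerer_plan (nu_minus_comp \<mu> \<nu> I) (mu_minus_comp \<mu> \<nu> I) = S.part I"
      unfolding mu_minus_comp_swap nu_minus_comp_swap
      using diag'[OF I] S.kellerer_plan_part[OF I] by blast
    moreover have "(\<lambda>(x, y). (y, x)) \<in> measurable (S.part I) borel"
      using swm S.sets_part by (simp cong: measurable_cong_sets)
    moreover have "space (S.part I) = UNIV" using sets_eq_imp_space_eq[OF S.sets_part] by simp
    ultimately show ?thesis
      unfolding kellerer_plan_rev_def using X by (simp add: emeasure_distr)
  qed
  have s1: "sets (kellerer_plan (mu_plus_comp \<mu> \<nu> I) (nu_plus_comp \<mu> \<nu> I)) = sets borel"
    if "I \<in> components (E_plus \<mu> \<nu>)" for I using k1[OF that] by simp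
  have s2: "sets (kellerer_plan_rev (mu_minus_comp \<mu> \<nu> I) (nu_minus_comp \<mu> \<nu> I)) = sets borel" for I
    by (simp add: kellerer_plan_rev_def)
  have "emeasure (sum_measure (components (E_plus \<mu> \<nu>))
      (\<lambda>I. kellerer_plan (mu_plus_comp \<mu> \<nu> I) (nu_plus_comp \<mu> \<nu> I))) X =
      (\<integral>\<^sup>+I. emeasure (part I) X \<partial>count_space (components (E_plus \<mu> \<nu>)))"
    using X s1 by (subst emeasure_sum_measure) (auto intro!: nn_integral_cong simp: k1)
  then have e1: "emeasure (sum_measure (components (E_plus \<mu> \<nu>))
      (\<lambda>I. kellerer_plan (mu_plus_comp \<mu> \<nu> I) (nu_plus_comp \<mu> \<nu> I))) X = emeasure \<pi> (mid -` E_plus \<mu> \<nu> \<inter> X)"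
    unfolding sum_parts[OF X] .
  have "emeasure (sum_measure (components (E_minus \<mu> \<nu>))
      (\<lambda>I. kellerer_plan_rev (mu_minus_comp \<mu> \<nu> I) (nu_minus_comp \<mu> \<nu> I))) X =
      (\<integral>\<^sup>+I. emeasure (S.part I) ((\<lambda>(x, y). (y, x)) -` X) \<partial>count_space (components (E_plus \<nu> \<mu>)))"
    unfolding E_minus_swap using X s2 by (subst emeasure_sum_measure) (auto intro!: nn_integral_cong simp: k2)
  also have "\<dots> = emeasure swapped (mid -` E_plus \<nu> \<mu> \<inter> (\<lambda>(x, y). (y, x)) -` X)"
    by (rule S.sum_parts[OF Xs])
  also have "\<dots> = emeasure \<pi> ((\<lambda>(x, y). (y, x)) -` (mid -` E_plus \<nu> \<mu> \<inter> (\<lambda>(x, y). (y, x)) -` X))"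
  proof (rule emeasure_swapped)
    show "mid -` E_plus \<nu> \<mu> \<inter> (\<lambda>(x, y). (y, x)) -` X \<in> sets borel"
      using mid_vimage[of "E_plus \<nu> \<mu>"] Xs open_E_plus[OF \<nu> \<mu>] by (intro sets.Int) (auto simp: sets_\<pi>)
  qed
  also have "(\<lambda>(x, y). (y, x)) -` (mid -` E_plus \<nu> \<mu> \<inter> (\<lambda>(x, y). (y, x)) -` X) = mid -` E_minus \<mu> \<nu> \<inter> X"
    unfolding mid_swap by (auto simp: E_minus_swap)
  finally have e2: "emeasure (sum_measure (components (E_minus \<mu> \<nu>))
      (\<lambda>I. kellerer_plan_rev (mu_minus_comp \<mu> \<nu> I) (nu_minus_comp \<mu> \<nu> I))) X = emeasure \<pi> (mid -` E_minus \<mu> \<nu> \<inter> X)" .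
  show "emeasure (kellerer_transport \<mu> \<nu>) X = emeasure \<pi> X"
    unfolding kellerer_transport_def emeasure_split[OF X]
    using X by (simp add: emeasure_plus_measure e1 e2 emeasure_diagonal_mu_eq)
qed

end

text \<open>Each hypothesis is stable under exchange of the marginals: both supports are finite, and
  mutual singularity is symmetric, with the complement as separating set. So one criterion covers
  the components of both signs.\<close>

lemma limit_plan_eq_kellerer_transport:
  assumes L: "limit_plan \<mu> \<nu> \<pi>"
    and H: "(finite (msupport \<mu>) \<and> finite (msupport \<nu>)) \<or>
         ((\<forall>I\<in>components (E_plus \<mu> \<nu>).
             mutually_singular (mu_plus_comp \<mu> \<nu> I) (nu_plus_comp \<mu> \<nu> I)) \<and>
          (\<forall>I\<in>components (E_minus \<mu> \<nu>).
             mutually_singular (mu_minus_comp \<mu> \<nu> I) (nu_minus_comp \<mu> \<nu> I)))"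
  shows "kellerer_transport \<mu> \<nu> = \<pi>"
proof (rule limit_plan.kellerer_transport_eq[OF L])
  have d: "\<exists>T. countable T \<and> (AE z in limit_plan.part \<pi>' I. fst z = snd z \<longrightarrow> fst z \<in> T)"
    if L': "limit_plan \<mu>' \<nu>' \<pi>'" and I: "I \<in> components (E_plus \<mu>' \<nu>')"
      and H': "finite (msupport \<mu>') \<or> mutually_singular (mu_plus_comp \<mu>' \<nu>' I) (nu_plus_comp \<mu>' \<nu>' I)"
    for \<mu>' \<nu>' \<pi>' I
    using H'
  proof
    assume f: "finite (msupport \<mu>')"
    have "AE z in limit_plan.part \<pi>' I. fst z = snd z \<longrightarrow> fst z \<in> msupport \<mu>'"
      using limit_plan.diagonal_of_finite_support[OF L' I f] by eventually_elim blast
    then show ?thesis using countable_finite[OF f] by blast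
  next
    assume s: "mutually_singular (mu_plus_comp \<mu>' \<nu>' I) (nu_plus_comp \<mu>' \<nu>' I)"
    have "AE z in limit_plan.part \<pi>' I. fst z = snd z \<longrightarrow> fst z \<in> {}"
      using limit_plan.diagonal_of_singular[OF L' I s] by eventually_elim simp
    then show ?thesis using countable_empty by blast
  qed
  have ms: "mutually_singular b a" if ab: "mutually_singular a b"
    for a b :: "real measure"
  proof -
    obtain A where "A \<in> sets borel" "emeasure a A = 0" "emeasure b (- A) = 0"
      using ab by (auto simp: mutually_singular_def)
    then show ?thesis unfolding mutually_singular_def by (intro bexI[of _ "- A"]) auto
  qed
  show "\<exists>T. countable T \<and> (AE z in limit_plan.part \<pi> I. fst z = snd z \<longrightarrow> fst z \<in> T)"
    if "I \<in> components (E_plus \<mu> \<nu>)" for I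
    using d[OF L that] H that by blast
  show "\<exists>T. countable T \<and> (AE z in limit_plan.part (distr \<pi> borel (\<lambda>(x, y). (y, x))) I. fst z = snd z \<longrightarrow> fst z \<in> T)"
    if I: "I \<in> components (E_plus \<nu> \<mu>)" for I
  proof (rule d[OF limit_plan_swap[OF L] I])
    show "finite (msupport \<nu>) \<or> mutually_singular (mu_plus_comp \<nu> \<mu> I) (nu_plus_comp \<nu> \<mu> I)"
      using H
    proof
      assume "(\<forall>I\<in>components (E_plus \<mu> \<nu>). mutually_singular (mu_plus_comp \<mu> \<nu> I) (nu_plus_comp \<mu> \<nu> I)) \<and>
          (\<forall>I\<in>components (E_minus \<mu> \<nu>). mutually_singular (mu_minus_comp \<mu> \<nu> I) (nu_minus_comp \<mu> \<nu> I))"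
      then have "mutually_singular (nu_plus_comp \<nu> \<mu> I) (mu_plus_comp \<nu> \<mu> I)"
        using I unfolding E_minus_swap mu_minus_comp_swap nu_minus_comp_swap by blast
      then have "mutually_singular (mu_plus_comp \<nu> \<mu> I) (nu_plus_comp \<nu> \<mu> I)"
        by (rule ms)
      then show ?thesis ..
    qed simp
  qed
qed

theorem theorem2:
  fixes \<mu> \<nu> :: "real measure"
  assumes "real_distribution \<mu>" and "real_distribution \<nu>"
    and "(finite (msupport \<mu>) \<and> finite (msupport \<nu>)) \<or>
         ((\<forall>I\<in>components (E_plus \<mu> \<nu>).
             mutually_singular (mu_plus_comp \<mu> \<nu> I) (nu_plus_comp \<mu> \<nu> I)) \<and>
          (\<forall>I\<in>components (E_minus \<mu> \<nu>).
             mutually_singular (mu_minus_comp \<mu> \<nu> I) (nu_minus_comp \<mu> \<nu> I)))"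
  shows "weakly_converges (\<lambda>\<epsilon>. entropic_plan \<epsilon> \<mu> \<nu>) (kellerer_transport \<mu> \<nu>) (at_right 0)"
  unfolding weakly_converges_def
proof (intro allI impI)
  fix f :: "real \<times> real \<Rightarrow> real"
  assume f: "continuous_on UNIV f" "bounded (range f)"
  let ?L = "integral\<^sup>L (kellerer_transport \<mu> \<nu>) f"
  show "((\<lambda>\<epsilon>. integral\<^sup>L (entropic_plan \<epsilon> \<mu> \<nu>) f) \<longlongrightarrow> ?L) (at_right 0)"
  \<comment> \<open>The limit from the right is tested along sequences; the bound 1 is an arbitrary
    number above 0.\<close>
  proof (rule tendsto_at_right_sequentially[of 0 1])
    fix S :: "nat \<Rightarrow> real" assume S: "\<And>n. 0 < S n" "S \<longlonglongrightarrow> 0"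
    let ?a = "\<lambda>n. integral\<^sup>L (entropic_plan (S n) \<mu> \<nu>) f"
    show "?a \<longlonglongrightarrow> ?L"
    proof (rule ccontr)
      assume "\<not> ?thesis"
      \<comment> \<open>A subsequence that keeps distance \<open>e\<close> from the claimed limit
        has, by compactness, a further subsequence that converges to a limit plan, and every limit
        plan is the claimed limit.\<close>
      then obtain e where e: "e > 0" "\<And>N. \<exists>n\<ge>N. e \<le> norm (?a n - ?L)"
        unfolding LIMSEQ_iff by (auto simp: not_less)
      have "infinite {n. e \<le> norm (?a n - ?L)}"
        unfolding infinite_nat_iff_unbounded_le using e(2) by auto
      from infinite_enumerate[OF this] obtain r :: "nat \<Rightarrow> nat" where
        r: "strict_mono r" "\<And>n. e \<le> norm (?a (r n) - ?L)" by auto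
      have M: "entropic_plan (S (r n)) \<mu> \<nu> \<in> Marg \<mu> \<nu>" for n
        by (rule entropic_plan_factored(1)[OF assms(1,2) S(1)])
      from Marg_sequentially_compact[OF assms(1,2), of "\<lambda>n. entropic_plan (S (r n)) \<mu> \<nu>", OF M]
      obtain q \<sigma> where "strict_mono q \<and> \<sigma> \<in> Marg \<mu> \<nu> \<and>
        (\<forall>f :: real \<times> real \<Rightarrow> real. continuous_on UNIV f \<longrightarrow> bounded (range f) \<longrightarrow>
          (\<lambda>n. integral\<^sup>L (entropic_plan (S (r (q n))) \<mu> \<nu>) f) \<longlonglongrightarrow> integral\<^sup>L \<sigma> f)"
        by (elim exE)
      then have q: "strict_mono q" and \<sigma>: "\<sigma> \<in> Marg \<mu> \<nu>" and
        conv: "\<And>f :: real \<times> real \<Rightarrow> real. continuous_on UNIV f \<Longrightarrow> bounded (range f) \<Longrightarrow>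
          (\<lambda>n. integral\<^sup>L (entropic_plan (S (r (q n))) \<mu> \<nu>) f) \<longlonglongrightarrow> integral\<^sup>L \<sigma> f"
        by simp_all
      have "(S \<circ> (r \<circ> q)) \<longlonglongrightarrow> 0"
        by (rule LIMSEQ_subseq_LIMSEQ[OF S(2) strict_mono_o[OF r(1) q]])
      then have S0: "(\<lambda>n. S (r (q n))) \<longlonglongrightarrow> 0" by (simp add: comp_def)
      have "limit_plan \<mu> \<nu> \<sigma>"
        by (rule limit_of_entropic_plans[OF assms(1,2) S(1) S0 \<sigma> conv])
      then have "kellerer_transport \<mu> \<nu> = \<sigma>"
        using assms(3) by (rule limit_plan_eq_kellerer_transport)
      then have "(\<lambda>n. ?a (r (q n))) \<longlonglongrightarrow> ?L" using conv[OF f] by simp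
      from LIMSEQ_D[OF this e(1)] obtain N where "norm (?a (r (q N)) - ?L) < e" by auto
      then show False using r(2)[of "q N"] by simp
    qed
  qed simp
qed

end
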